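(* Let $n\ge2$ and let $I\subset\mathbb{R}$ be an interval with $|I|=1$. Then $$W^1L^n(I^n)\hookrightarrow\mathcal{R}(L^{\infty,n;-1},L^\infty)\hookrightarrow L^{\infty,n;-1}(I^n),$$ and the second embedding is strict, i.e. $\mathcal{R}(L^{\infty,n;-1},L^\infty)\ne L^{\infty,n;-1}(I^n)$.
   Context: Rearrangements: for a measurable real function $f$ on $I^m$ ($m\ge1$, $|I|=1$), $\lambda_f(t)=|\{x:|f(x)|>t\}|$ and $f^*(t)=\inf\{s\ge 0:\lambda_f(s)\le t\}$. Lorentz–Zygmund spaces: for $1\le p,q\le\infty$ and $\alpha\in\mathbb{R}$, $L^{p,q;\alpha}(I^m)$ is the space of measurable $f$ with $\|f\|_{L^{p,q;\alpha}(I^m)}=\|t^{1/p-1/q}[1+\log(1/t)]^{\alpha}f^*(t)\|_{L^q(0,1)}<\infty$. In particular $\|f\|_{L^{\infty,n;-1}(I^m)}=\|t^{-1/n}[1+\log(1/t)]^{-1}f^*(t)\|_{L^n(0,1)}$. (Where this functional is only a quasi-norm, it is replaced by an equivalent rearrangement invariant norm, obtained with $f^{**}(t)=t^{-1}\int_0^tf^*(s)\,ds$ in place of $f^*$; this does not affect the spaces or the embeddings.) Sobolev space: $W^1L^n(I^n)=\{u\in L^n(I^n):|\nabla u|\in L^n(I^n)\}$ ($\nabla u$ the distributional gradient, $|\cdot|$ Euclidean length), with norm $\|u\|_{L^n(I^n)}+\||\nabla u|\|_{L^n(I^n)}$. Mixed norm spaces: for $x\in I^n$ and $k\in\{1,\dots,n\}$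 let $\widehat{x}_k\in I^{n-1}$ be $x$ with its $k$th coordinate removed. For rearrangement invariant Banach function spaces $X(I^{n-1})$, $Y(I)$, let $\psi_k(f,Y)(\widehat{x}_k)=\|f(\widehat{x}_k,\cdot)\|_{Y(I)}$ (norm in the $k$th variable), $\|f\|_{\mathcal{R}_k(X,Y)}=\|\psi_k(f,Y)\|_{X(I^{n-1})}$, $\mathcal{R}_k(X,Y)=\{f:\|f\|_{\mathcal{R}_k(X,Y)}<\infty\}$, and $\mathcal{R}(X,Y)=\bigcap_{k=1}^n\mathcal{R}_k(X,Y)$ with norm $\|f\|_{\mathcal{R}(X,Y)}=\sum_{k=1}^n\|f\|_{\mathcal{R}_k(X,Y)}$. In $\mathcal{R}(L^{\infty,n;-1},L^\infty)$ the first space is $L^{\infty,n;-1}(I^{n-1})$ and the second is $L^\infty(I)$. $A\hookrightarrow B$ denotes a continuous embedding: $A\subset B$ and $\|f\|_B\le C\|f\|_A$ for all $f\in A$. *)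

theory Defs
  imports "HOL-Analysis.Analysis" "HOL-Probability.Essential_Supremum"
begin

text \<open>All function norms act on \<open>[0,\<infinity>]\<close>-valued functions and are applied to \<open>\<bar>f\<bar>\<close>.
  The value \<open>\<infinity>\<close> is needed for the inner norm in a mixed norm space,
  which can be infinite on a set of positive measure. A norm takes the measure as an argument, so
  the same functional can be used on \<open>I\<^sup>n\<close>, on \<open>I\<^sup>n\<^sup>-\<^sup>1\<close> and on \<open>I\<close>.\<close>

type_synonym 'a fun_norm = "'a measure \<Rightarrow> ('a \<Rightarrow> ennreal) \<Rightarrow> ennreal"

text \<open>Used for exponents \<open>r > 0\<close> only.\<close>

definition ennpowr :: "ennreal \<Rightarrow> real \<Rightarrow> ennreal" where
  "ennpowr x r = (if x = \<infinity> then \<infinity> else ennreal (enn2real x powr r))"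

definition Lq_norm :: "ennreal \<Rightarrow> 'a fun_norm" where
  "Lq_norm q M g =
     (if q = \<infinity> then esssup M g
      else ennpowr (\<integral>\<^sup>+x. ennpowr (g x) (enn2real q) \<partial>M) (1 / enn2real q))"

definition distribution_fun :: "'a measure \<Rightarrow> ('a \<Rightarrow> ennreal) \<Rightarrow> ennreal \<Rightarrow> ennreal" where
  "distribution_fun M g s = emeasure M {x \<in> space M. s < g x}"

definition rearrangement :: "'a measure \<Rightarrow> ('a \<Rightarrow> ennreal) \<Rightarrow> real \<Rightarrow> ennreal" where
  "rearrangement M g t = Inf {s. distribution_fun M g s \<le> ennreal t}"

text \<open>The functional of \<open>L\<^sup>p\<^sup>,\<^sup>q\<^sup>;\<^sup>\<alpha>\<close>, in terms of the decreasing rearrangement \<open>f\<^sup>*\<close> itself. For some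
  parameters (among them \<open>p = \<infinity>\<close>, \<open>q = n\<close>, \<open>\<alpha> = -1\<close>) it is only a quasi-norm, equivalent to the norm
  built from \<open>f\<^sup>*\<^sup>*\<close>. Here \<open>1 / \<infinity> = 0\<close> holds by the conventions of \<^typ>\<open>ennreal\<close>.\<close>

definition lorentz_zygmund_norm :: "ennreal \<Rightarrow> ennreal \<Rightarrow> real \<Rightarrow> 'a fun_norm" where
  "lorentz_zygmund_norm p q \<alpha> M g =
     Lq_norm q (lebesgue_on {0<..<1})
       (\<lambda>t. ennreal (t powr (enn2real (1 / p) - enn2real (1 / q)) * (1 + ln (1 / t)) powr \<alpha>)
             * rearrangement M g t)"

text \<open>Spaces consist of functions rather than of classes modulo null sets; all of them are invariant
  under changes on null sets.\<close>

definition fun_space :: "'a fun_norm \<Rightarrow> 'a measure \<Rightarrow> ('a \<Rightarrow> real) set" where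
  "fun_space N M = {f \<in> borel_measurable M. N M (\<lambda>x. ennreal \<bar>f x\<bar>) < \<infinity>}"

definition continuous_embedding ::
  "('a \<Rightarrow> real) set \<Rightarrow> (('a \<Rightarrow> real) \<Rightarrow> ennreal) \<Rightarrow> ('a \<Rightarrow> real) set \<Rightarrow> (('a \<Rightarrow> real) \<Rightarrow> ennreal) \<Rightarrow> bool"
  where
  "continuous_embedding A NA B NB \<longleftrightarrow>
     A \<subseteq> B \<and> (\<exists>C::real. 0 \<le> C \<and> (\<forall>f\<in>A. NB f \<le> ennreal C * NA f))"

definition cube :: "real set \<Rightarrow> (real^'n) set" where
  "cube I = {x. \<forall>i. x $ i \<in> I}"

text \<open>The cube \<open>I\<^sup>n\<^sup>-\<^sup>1\<close> in which the point \<open>x\<close> with its \<open>k\<close>th coordinate removed lives is the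
  product of copies of \<open>I\<close> over the index set \<open>UNIV - {k}\<close>; the completion makes its measure the
  Lebesgue (not only Borel) measure.\<close>

definition face_measure :: "'n::finite \<Rightarrow> real set \<Rightarrow> ('n \<Rightarrow> real) measure" where
  "face_measure k I = completion (PiM (UNIV - {k}) (\<lambda>_. restrict_space lborel I))"

definition insert_coord :: "'n::finite \<Rightarrow> ('n \<Rightarrow> real) \<Rightarrow> real \<Rightarrow> real^'n" where
  "insert_coord k y s = (\<chi> i. if i = k then s else y i)"

definition section_norm ::
  "'n::finite \<Rightarrow> real fun_norm \<Rightarrow> real set \<Rightarrow> (real^'n \<Rightarrow> real) \<Rightarrow> ('n \<Rightarrow> real) \<Rightarrow> ennreal" where
  "section_norm k Y I f y = Y (lebesgue_on I) (\<lambda>s. ennreal \<bar>f (insert_coord k y s)\<bar>)"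

definition mixed_norm_k ::
  "'n::finite \<Rightarrow> ('n \<Rightarrow> real) fun_norm \<Rightarrow> real fun_norm \<Rightarrow> real set \<Rightarrow> (real^'n \<Rightarrow> real) \<Rightarrow> ennreal" where
  "mixed_norm_k k X Y I f = X (face_measure k I) (section_norm k Y I f)"

definition mixed_space_k ::
  "'n::finite \<Rightarrow> ('n \<Rightarrow> real) fun_norm \<Rightarrow> real fun_norm \<Rightarrow> real set \<Rightarrow> (real^'n \<Rightarrow> real) set" where
  "mixed_space_k k X Y I =
     {f \<in> borel_measurable (lebesgue_on (cube I)). mixed_norm_k k X Y I f < \<infinity>}"

definition mixed_norm ::
  "('n::finite \<Rightarrow> real) fun_norm \<Rightarrow> real fun_norm \<Rightarrow> real set \<Rightarrow> (real^'n \<Rightarrow> real) \<Rightarrow> ennreal" where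
  "mixed_norm X Y I f = (\<Sum>k\<in>UNIV. mixed_norm_k k X Y I f)"

definition mixed_space ::
  "('n::finite \<Rightarrow> real) fun_norm \<Rightarrow> real fun_norm \<Rightarrow> real set \<Rightarrow> (real^'n \<Rightarrow> real) set" where
  "mixed_space X Y I = (\<Inter>k. mixed_space_k k X Y I)"

definition partial_deriv :: "'n::finite \<Rightarrow> (real^'n \<Rightarrow> real) \<Rightarrow> real^'n \<Rightarrow> real" where
  "partial_deriv i \<phi> x = frechet_derivative \<phi> (at x) (axis i 1)"

primrec C_diff :: "nat \<Rightarrow> (real^'n::finite \<Rightarrow> real) \<Rightarrow> bool" where
  "C_diff 0 \<phi> \<longleftrightarrow> continuous_on UNIV \<phi>"
| "C_diff (Suc m) \<phi> \<longleftrightarrow> (\<forall>x. \<phi> differentiable (at x)) \<and> (\<forall>i. C_diff m (partial_deriv i \<phi>))"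

definition test_function :: "(real^'n::finite) set \<Rightarrow> (real^'n \<Rightarrow> real) \<Rightarrow> bool" where
  "test_function \<Omega> \<phi> \<longleftrightarrow> (\<forall>m. C_diff m \<phi>) \<and>
     compact (closure {x. \<phi> x \<noteq> 0}) \<and> closure {x. \<phi> x \<noteq> 0} \<subseteq> \<Omega>"

definition locally_integrable :: "(real^'n::finite) set \<Rightarrow> (real^'n \<Rightarrow> 'b::euclidean_space) \<Rightarrow> bool" where
  "locally_integrable \<Omega> u \<longleftrightarrow> (\<forall>K. compact K \<and> K \<subseteq> \<Omega> \<longrightarrow> u absolutely_integrable_on K)"

definition weak_gradient :: "(real^'n::finite) set \<Rightarrow> (real^'n \<Rightarrow> real) \<Rightarrow> (real^'n \<Rightarrow> real^'n) \<Rightarrow> bool" where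
  "weak_gradient \<Omega> u g \<longleftrightarrow> locally_integrable \<Omega> u \<and> locally_integrable \<Omega> g \<and>
     (\<forall>\<phi> i. test_function \<Omega> \<phi> \<longrightarrow>
        (LINT x:\<Omega>|lebesgue. u x * partial_deriv i \<phi> x) = - (LINT x:\<Omega>|lebesgue. g x $ i * \<phi> x))"

text \<open>A weak gradient is unique up to null sets, so the choice made here is immaterial.\<close>

definition grad :: "(real^'n::finite) set \<Rightarrow> (real^'n \<Rightarrow> real) \<Rightarrow> real^'n \<Rightarrow> real^'n" where
  "grad \<Omega> u = (SOME g. weak_gradient \<Omega> u g)"

text \<open>The distributional gradient lives on the interior of the cube, which differs from the cube by
  a null set; \<open>I\<close> may be open, closed or half-open.\<close>

definition sobolev_space :: "ennreal \<Rightarrow> real set \<Rightarrow> (real^'n::finite \<Rightarrow> real) set" where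
  "sobolev_space p I =
     {u \<in> fun_space (Lq_norm p) (lebesgue_on (cube I)).
        (\<exists>g. weak_gradient (interior (cube I)) u g) \<and>
        (\<lambda>x. norm (grad (interior (cube I)) u x)) \<in> fun_space (Lq_norm p) (lebesgue_on (cube I))}"

definition sobolev_norm :: "ennreal \<Rightarrow> real set \<Rightarrow> (real^'n::finite \<Rightarrow> real) \<Rightarrow> ennreal" where
  "sobolev_norm p I u =
     Lq_norm p (lebesgue_on (cube I)) (\<lambda>x. ennreal \<bar>u x\<bar>) +
     Lq_norm p (lebesgue_on (cube I)) (\<lambda>x. ennreal (norm (grad (interior (cube I)) u x)))"

end

theory Submission
  imports Defs "HOL-Probability.Infinite_Product_Measure" "HOL-Computational_Algebra.Polynomial"
begin

text \<open>For a function \<open>f\<close> on the cube let \<open>\<psi>\<^sub>k\<close> be the essential supremum of \<open>\<bar>f\<bar>\<close> over the lines of direction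
\<open>k\<close>. The second embedding holds because \<open>\<bar>f x\<bar> \<le> \<psi>\<^sub>k\<close> on the line through \<open>x\<close>, for almost every \<open>x\<close>;
hence \<open>f\<^sup>* \<le> \<psi>\<^sub>k\<^sup>*\<close> for any single \<open>k\<close>. It is strict because a function of one coordinate can be
unbounded and still have exponentially small level sets; then one of the \<open>\<psi>\<^sub>k\<close> is identically \<open>\<infinity>\<close>.

The first embedding is proved with level sets, in the spirit of Maz'ya's truncation method and of
Gagliardo's proof of the Sobolev inequality. For \<open>u\<close> in \<open>W\<^sup>1L\<^sup>n\<close> and \<open>\<theta> \<ge> 0\<close> let \<open>M(\<theta>)\<close> be the sum
over \<open>k\<close> of the measures of \<open>{\<psi>\<^sub>k > \<theta>}\<close>, let \<open>D(\<theta>)\<close> be the measure of \<open>{\<bar>u\<bar> > \<theta>}\<close>, and let \<open>h\<close> be the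
sum of the absolute values of the partial derivatives. Three facts are combined.

\<^item> On almost every line of direction \<open>k\<close> the function \<open>u\<close> is a primitive of its weak partial
  derivative (\<open>primitive_along_of_weak\<close>). So if \<open>\<bar>u\<bar>\<close> exceeds \<open>\<theta> + \<delta>\<close> on a line, either this line carries
  a variation of at least \<open>\<delta>\<close> within the slab \<open>{\<theta> < \<bar>u\<bar> \<le> \<theta> + \<delta>}\<close>, or it runs entirely in
  \<open>{\<bar>u\<bar> > \<theta>}\<close> (\<open>slab_integral_lower_bound\<close>). Integrated over all lines and directions,
  \<open>\<delta> M(\<theta> + \<delta>)\<close> is at most the integral of \<open>h\<close> over the slab plus \<open>n \<delta> D(\<theta>)\<close>.

\<^item> The Loomis--Whitney inequality gives \<open>D(\<theta>)\<^bsup>n-1\<^esup> \<le> M(\<theta>)\<^sup>n\<close>.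

\<^item> Hoelder's inequality bounds the integral of \<open>h\<close> over the slab by \<open>\<gamma> D(\<theta>)\<^bsup>1-1/n\<^esup>\<close>, up to a
  factor \<open>2\<close>, where \<open>\<gamma>\<close> is the \<open>L\<^sup>n\<close> norm of \<open>h\<close> on the slab.

Together they give \<open>M(\<theta> + \<delta>) \<le> M(\<theta>) (2 \<gamma> / \<delta> + n A / \<theta>)\<close> with \<open>A\<close> a bound for the \<open>L\<^sup>n\<close> norms of \<open>u\<close>
and \<open>h\<close> (\<open>level_step\<close>), a recursion that is linear in \<open>M\<close>. If the slab between \<open>l\<close> and \<open>2 l\<close>, with \<open>l\<close> above a
multiple of \<open>A\<close>, is cut into \<open>N\<close> slabs, the inequality of the arithmetic and the geometric mean gives
\<open>M(2 l) \<le> n exp(-N)\<close>, provided that \<open>N\<^bsup>n-1\<^esup>\<close> does not exceed a multiple of \<open>l\<^sup>n / \<Gamma>\<close>, where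
\<open>\<Gamma>\<close> is the integral of \<open>h\<^sup>n\<close> over \<open>{l < \<bar>u\<bar> \<le> 2 l}\<close> (\<open>dyadic_decay\<close>). With the best \<open>N\<close> this says that
\<open>l\<^sup>n (1 + ln (1/M(2 l)))\<^bsup>1-n\<^esup>\<close> is at most a multiple of \<open>\<Gamma>\<close>. Now sum over \<open>l = \<Lambda> 2\<^sup>j\<close>: the \<open>\<Gamma>\<close> add up to at
most the integral of \<open>h\<^sup>n\<close>, and the left-hand sides dominate the \<open>n\<close>th power of the norm of \<open>\<psi>\<^sub>k\<close> in
\<open>L\<^bsup>\<infinity>,n;-1\<^esup>\<close>, because \<open>t\<^sup>-\<^sup>1 (1 + ln (1/t))\<^sup>-\<^sup>n\<close> is the derivative of
\<open>(1 + ln (1/t))\<^bsup>1-n\<^esup> / (n - 1)\<close> (\<open>lorentz_zygmund_dyadic_bound\<close>).\<close>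

section \<open>The Lorentz--Zygmund functional and level sets\<close>

lemma ennpowr_of_nat:
  assumes "n > 0"
  shows "ennpowr x (real n) = x ^ n"
proof (cases x)
  case (real r)
  then have "ennpowr x (real n) = ennreal (r ^ n)"
    using assms by (cases "r = 0") (simp_all add: ennpowr_def powr_realpow)
  then show ?thesis using real by (simp add: ennreal_power)
next
  case top
  then show ?thesis using assms by (simp add: ennpowr_def)
qed

lemma Lq_norm_of_nat:
  assumes "n > 0"
  shows "Lq_norm (of_nat n) M g = ennpowr (\<integral>\<^sup>+x. g x ^ n \<partial>M) (1 / real n)"
proof -
  have "enn2real (of_nat n) = real n"
    by (metis enn2real_ennreal ennreal_of_nat_eq_real_of_nat of_nat_0_le_iff)
  then show ?thesis
    using assms by (simp add: Lq_norm_def ennpowr_of_nat)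
qed

lemma ennpowr_inverse_le_iff:
  assumes "n > 0" "A \<ge> 0"
  shows "ennpowr x (1 / real n) \<le> ennreal A \<longleftrightarrow> x \<le> ennreal (A ^ n)"
proof (cases x)
  case (real r)
  have "r powr (1 / real n) \<le> A \<longleftrightarrow> r \<le> A ^ n"
  proof -
    have "r powr (1 / real n) = root n r"
      using assms real by (cases "r = 0") (auto simp: root_powr_inverse)
    also have "\<dots> \<le> A \<longleftrightarrow> r \<le> A ^ n"
      using assms real real_root_le_iff[of n r "A ^ n"] by (simp add: real_root_power_cancel)
    finally show ?thesis .
  qed
  then show ?thesis
    using real assms by (simp add: ennpowr_def ennreal_le_iff)
qed (use assms in \<open>auto simp: ennpowr_def top_unique\<close>)

lemma ennpowr_less_top_iff: "ennpowr x r < \<infinity> \<longleftrightarrow> x < \<infinity>"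
  by (simp add: ennpowr_def less_top)

lemma lorentz_zygmund_norm_eq:
  assumes "n > 0"
  shows "lorentz_zygmund_norm \<infinity> (of_nat n) (-1) M g =
    ennpowr (\<integral>\<^sup>+t. ennreal (1 / (t * (1 - ln t) ^ n)) * rearrangement M g t ^ n
      * indicator {0<..<1} t \<partial>lborel) (1 / real n)"
proof -
  have e: "enn2real (1 / of_nat n) = 1 / real n"
  proof -
    have "(1 / of_nat n :: ennreal) = ennreal (1 / real n)"
      using assms by (metis divide_ennreal ennreal_1 ennreal_of_nat_eq_real_of_nat of_nat_0_less_iff zero_le_one)
    then show ?thesis by (simp)
  qed
  have w: "(ennreal (t powr (- (1 / real n)) * (1 + ln (1 / t)) powr - 1) * y) ^ n
      = ennreal (1 / (t * (1 - ln t) ^ n)) * y ^ n" if t: "0 < t" "t < 1" for t y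
  proof -
    have l: "1 - ln t > 0" using t by (smt (verit) ln_less_zero)
    have "(t powr (- (1 / real n)) * (1 + ln (1 / t)) powr - 1) ^ n
       = (t powr (- (1 / real n))) ^ n * ((1 - ln t) powr - 1) ^ n"
      using t l by (simp only: power_mult_distrib) (simp add: ln_div)
    also have "(t powr (- (1 / real n))) ^ n = 1 / t"
      using t assms powr_powr[of t "- (1 / real n)" "real n"] by (subst powr_realpow[symmetric]) (simp_all only: powr_gt_zero, auto simp: powr_minus_divide)
    also have "((1 - ln t) powr - 1) ^ n = 1 / (1 - ln t) ^ n"
      using l by (simp add: powr_minus_divide power_one_over)
    finally show ?thesis using t
      by (simp add: power_mult_distrib ennreal_power)
  qed
  let ?h = "\<lambda>t. (ennreal (t powr (- (1 / real n)) * (1 + ln (1 / t)) powr - 1) * rearrangement M g t) ^ n"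
  have "(\<integral>\<^sup>+t. ?h t \<partial>lebesgue_on {0<..<1}) = (\<integral>\<^sup>+t. ?h t * indicator {0<..<1} t \<partial>lborel)"
    by (subst nn_integral_restrict_space) (auto simp only: nn_integral_completion, auto)
  also have "\<dots> = (\<integral>\<^sup>+t. ennreal (1 / (t * (1 - ln t) ^ n)) * rearrangement M g t ^ n
      * indicator {0<..<1} t \<partial>lborel)"
  proof (rule nn_integral_cong)
    fix t :: real
    show "?h t * indicator {0<..<1} t
      = ennreal (1 / (t * (1 - ln t) ^ n)) * rearrangement M g t ^ n * indicator {0<..<1} t"
      by (cases "t \<in> {0<..<1}") (simp_all only: indicator_simps mult_1_right mult_zero_right w greaterThanLessThan_iff not_False_eq_True)
  qed
  finally have "(\<integral>\<^sup>+t. ?h t \<partial>lebesgue_on {0<..<1}) = \<dots>" .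
  then show ?thesis
    unfolding lorentz_zygmund_norm_def
    using assms e by (simp only: Lq_norm_of_nat) simp
qed

text \<open>The weight is the derivative of \<open>(1 - ln t)\<^bsup>1-n\<^esup> / (n - 1)\<close>. This primitive is what turns the
  functional of \<open>L\<^bsup>\<infinity>,n;-1\<^esup>\<close> into a sum over level sets, in which a level set of measure \<open>T\<close> is
  weighted by \<open>(1 + ln (1/T))\<^bsup>1-n\<^esup>\<close>.\<close>

lemma nn_integral_log_weight:
  assumes "n \<ge> 2" "0 < T" "T \<le> 1"
  shows "(\<integral>\<^sup>+t. ennreal (1 / (t * (1 - ln t) ^ n)) * indicator {0<..<T} t \<partial>lborel)
    \<le> ennreal (1 / (1 - ln T) ^ (n - 1))"
proof -
  let ?w = "\<lambda>t::real. 1 / (t * (1 - ln t) ^ n)"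
  let ?F = "\<lambda>t::real. 1 / (real (n - 1) * (1 - ln t) ^ (n - 1))"
  let ?f = "\<lambda>(i::nat) (t::real). ennreal (?w t) * indicator {T / (real i + 2) .. T} t"
  have pos: "1 - ln t > 0" if "0 < t" "t \<le> T" for t
    using that assms by (smt (verit) ln_le_zero_iff)
  have bound: "(\<integral>\<^sup>+t. ?f i t \<partial>lborel) \<le> ennreal (1 / (1 - ln T) ^ (n - 1))" for i
  proof -
    have a0: "0 < T / (real i + 2)" using assms by simp
    have aT: "T / (real i + 2) \<le> T"
      using assms by (simp add: field_simps)
    have "(\<integral>\<^sup>+t. ?f i t \<partial>lborel) = ennreal (?F T - ?F (T / (real i + 2)))"
    proof (rule nn_integral_FTC_Icc)
      show "?w \<in> borel_measurable borel" by measurable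
      fix t assume t: "t \<in> {T / (real i + 2)..T}"
      then have t0: "0 < t" using a0 by auto
      have l: "1 - ln t > 0" using pos t t0 by auto
      obtain m where m: "n = Suc (Suc m)" using assms(1) by (metis Suc_le_D numeral_2_eq_2 Suc_le_mono)
      have "((\<lambda>t. real (Suc m) * (1 - ln t) ^ Suc m) has_real_derivative
          real (Suc m) * (real (Suc m) * (1 - ln t) ^ m * (- (1 / t)))) (at t)"
        using t0 by (auto intro!: derivative_eq_intros simp del: power_Suc)
      from DERIV_inverse'[OF this]
      have "((\<lambda>t. inverse (real (Suc m) * (1 - ln t) ^ Suc m)) has_real_derivative
          1 / (t * (1 - ln t) ^ Suc (Suc m))) (at t)"
      proof (rule DERIV_cong)
        have "- (inverse (c * (p * q)) * (c * (c * q * - (1 / t))) * inverse (c * (p * q))) = 1 / (t * (p * (p * q)))"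
          if "c > 0" "p > 0" "q > 0" for c p q :: real
          using that t0 by (simp add: field_simps)
        from this[of "real (Suc m)" "1 - ln t" "(1 - ln t) ^ m"] l
        show "- (inverse (real (Suc m) * (1 - ln t) ^ Suc m) * (real (Suc m) * (real (Suc m) * (1 - ln t) ^ m * - (1 / t)))
          * inverse (real (Suc m) * (1 - ln t) ^ Suc m)) = 1 / (t * (1 - ln t) ^ Suc (Suc m))"
          by simp
      qed (use l in auto)
      then have "(?F has_vector_derivative ?w t) (at t)"
        unfolding has_real_derivative_iff_has_vector_derivative[symmetric] m
        by (simp add: inverse_eq_divide)
      then show "DERIV ?F t :> ?w t"
        by (simp add: has_real_derivative_iff_has_vector_derivative)
      show "0 \<le> ?w t" using l t0 by simp
    qed (use aT in auto)
    also have "\<dots> \<le> ennreal (?F T)"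
      using pos[of "T / (real i + 2)"] a0 aT assms by (intro ennreal_leI) (auto intro!: mult_nonneg_nonneg)
    also have "?F T \<le> 1 / (1 - ln T) ^ (n - 1)"
    proof -
      have "0 < (1 - ln T) ^ (n - 1)" using pos[of T] assms by simp
      then show ?thesis using assms
        by (intro divide_left_mono) (auto simp: mult_le_cancel_right)
    qed
    finally show ?thesis by (simp add: ennreal_leI)
  qed
  have sup: "(SUP i. ?f i t) \<ge> ennreal (?w t) * indicator {0<..<T} t" for t
  proof (cases "t \<in> {0<..<T}")
    case True
    obtain i where "T / t < real i" using reals_Archimedean2 by blast
    then have "T / (real i + 2) \<le> t" using True by (simp add: field_simps)
    then have "?f i t = ennreal (?w t) * indicator {0<..<T} t" using True by simp
    then show ?thesis by (intro SUP_upper2[of i]) auto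
  qed simp
  have "(\<integral>\<^sup>+t. ennreal (?w t) * indicator {0<..<T} t \<partial>lborel) \<le> (\<integral>\<^sup>+t. (SUP i. ?f i t) \<partial>lborel)"
    by (intro nn_integral_mono sup)
  also have "\<dots> = (SUP i. (\<integral>\<^sup>+t. ?f i t \<partial>lborel))"
  proof (rule nn_integral_monotone_convergence_SUP)
    show "incseq ?f"
    proof (intro incseq_SucI le_funI)
      fix i t
      have "T / (real (Suc i) + 2) \<le> T / (real i + 2)"
        using assms by (intro divide_left_mono) auto
      then show "?f i t \<le> ?f (Suc i) t" by (auto split: split_indicator)
    qed
  qed measurable
  also have "\<dots> \<le> ennreal (1 / (1 - ln T) ^ (n - 1))"
    by (intro SUP_least bound)
  finally show ?thesis .
qed

text \<open>A dyadic layer cake. A finite \<open>y\<close> lies between two consecutive dyadic levels, and the term of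
  the lower one already suffices; for \<open>y = \<infinity>\<close> all terms are present and the sum diverges.\<close>

lemma ennreal_power_le_dyadic_sum:
  fixes y :: ennreal and \<Lambda> :: real
  assumes L: "0 < \<Lambda>" and n: "n > 0"
  shows "y ^ n \<le> ennreal (\<Lambda> ^ n)
    + (\<Sum>j. ennreal ((\<Lambda> * 2 ^ Suc j) ^ n) * (if ennreal (\<Lambda> * 2 ^ j) < y then 1 else 0))"
    (is "_ \<le> _ + suminf ?s")
proof (cases "\<exists>j. y \<le> ennreal (\<Lambda> * 2 ^ j)")
  case True
  define j where "j = (LEAST j. y \<le> ennreal (\<Lambda> * 2 ^ j))"
  have j: "y \<le> ennreal (\<Lambda> * 2 ^ j)" unfolding j_def using True by (rule LeastI_ex)
  show ?thesis
  proof (cases j)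
    case 0
    then have "y ^ n \<le> ennreal \<Lambda> ^ n" using j by (intro power_mono) auto
    also have "\<dots> = ennreal (\<Lambda> ^ n)" using L by (simp add: ennreal_power)
    finally show ?thesis by (rule order_trans) simp
  next
    case (Suc i)
    then have i: "ennreal (\<Lambda> * 2 ^ i) < y"
      using not_less_Least[of i "\<lambda>j. y \<le> ennreal (\<Lambda> * 2 ^ j)"] unfolding j_def by auto
    have "y ^ n \<le> ennreal (\<Lambda> * 2 ^ Suc i) ^ n" using j Suc by (intro power_mono) auto
    also have "\<dots> = ?s i" using L i by (simp add: ennreal_power)
    also have "\<dots> \<le> suminf ?s"
      using sum_le_suminf[of ?s "{i}"] by (simp add: summableI)
    finally show ?thesis by (rule order_trans) simp
  qed
next
  case False
  have *: "ennreal B \<le> suminf ?s" if "B \<ge> 0" for B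
  proof -
    obtain i where i: "max B 1 / \<Lambda> < 2 ^ i" using real_arch_pow[of 2 "max B 1 / \<Lambda>"] by auto
    then have "max B 1 < \<Lambda> * 2 ^ i" using L by (simp add: field_simps)
    then have "max B 1 \<le> \<Lambda> * 2 ^ Suc i" by simp
    then have "max B 1 \<le> (\<Lambda> * 2 ^ Suc i) ^ n"
      using n self_le_power[of "\<Lambda> * 2 ^ Suc i" n] by linarith
    then have "ennreal B \<le> ?s i" using False by (auto simp: not_le intro!: ennreal_leI)
    also have "\<dots> \<le> suminf ?s"
      using sum_le_suminf[of ?s "{i}"] by (simp add: summableI)
    finally show ?thesis .
  qed
  have "suminf ?s = top"
  proof (cases "suminf ?s")
    case (real r)
    with * [of "r + 1"] show ?thesis by (simp add: ennreal_le_iff)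
  qed
  then show ?thesis by simp
qed

text \<open>Writing the bound for the level sets as \<open>exp (1 - X j)\<close> makes \<open>1 - ln t\<close> equal to \<open>X j\<close> at the
  right end point \<open>t\<close> of the interval on which the rearrangement can exceed the level \<open>\<Lambda> * 2^j\<close>.\<close>

lemma lorentz_zygmund_dyadic_bound:
  assumes n: "n \<ge> 2" and L: "0 < \<Lambda>" and X: "\<And>j. 1 \<le> X j"
    and d: "\<And>j. distribution_fun M g (ennreal (\<Lambda> * 2 ^ j)) \<le> ennreal (exp (1 - X j))"
  shows "(\<integral>\<^sup>+t. ennreal (1 / (t * (1 - ln t) ^ n)) * rearrangement M g t ^ n
      * indicator {0<..<1} t \<partial>lborel)
    \<le> ennreal (\<Lambda> ^ n) + (\<Sum>j. ennreal ((\<Lambda> * 2 ^ Suc j) ^ n / X j ^ (n - 1)))"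
proof -
  let ?w = "\<lambda>t::real. ennreal (1 / (t * (1 - ln t) ^ n))"
  let ?T = "\<lambda>j. exp (1 - X j)"
  let ?c = "\<lambda>j. ennreal ((\<Lambda> * 2 ^ Suc j) ^ n)"
  have T: "?T j \<le> 1" "0 < ?T j" for j using X[of j] by auto
  have pt: "?w t * rearrangement M g t ^ n * indicator {0<..<1} t
     \<le> ennreal (\<Lambda> ^ n) * (?w t * indicator {0<..<1} t) + (\<Sum>j. ?c j * (?w t * indicator {0<..<?T j} t))"
    (is "?l \<le> ?r") for t
  proof (cases "t \<in> {0<..<1}")
    case True
    let ?i = "\<lambda>j. if ennreal (\<Lambda> * 2 ^ j) < rearrangement M g t then 1 else 0 :: ennreal"
    have i: "?i j \<le> indicator {0<..<?T j} t" for j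
    proof (cases "ennreal (\<Lambda> * 2 ^ j) < rearrangement M g t")
      case less: True
      have "\<not> distribution_fun M g (ennreal (\<Lambda> * 2 ^ j)) \<le> ennreal t"
      proof
        assume "distribution_fun M g (ennreal (\<Lambda> * 2 ^ j)) \<le> ennreal t"
        then have "rearrangement M g t \<le> ennreal (\<Lambda> * 2 ^ j)"
          unfolding rearrangement_def by (intro Inf_lower) simp
        then show False using less by simp
      qed
      then have "ennreal t < ennreal (?T j)" using d[of j] by (simp add: not_le)
      then show ?thesis using True by (simp add: ennreal_less_iff)
    qed simp
    have "?l = ?w t * rearrangement M g t ^ n" using True by simp
    also have "\<dots> \<le> ?w t * (ennreal (\<Lambda> ^ n) + (\<Sum>j. ?c j * ?i j))"
      using n L by (intro mult_left_mono ennreal_power_le_dyadic_sum) auto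
    also have "\<dots> \<le> ?w t * (ennreal (\<Lambda> ^ n) + (\<Sum>j. ?c j * indicator {0<..<?T j} t))"
      using i by (intro mult_left_mono add_left_mono suminf_le summableI) (auto intro: mult_left_mono)
    also have "\<dots> = ?r"
      using True by (simp add: distrib_left ac_simps flip: ennreal_suminf_cmult)
    finally show ?thesis .
  qed simp
  have w1: "(\<integral>\<^sup>+t. ?w t * indicator {0<..<1} t \<partial>lborel) \<le> 1"
    using nn_integral_log_weight[of n 1] n by simp
  have wT: "(\<integral>\<^sup>+t. ?w t * indicator {0<..<?T j} t \<partial>lborel) \<le> ennreal (1 / X j ^ (n - 1))" for j
    using nn_integral_log_weight[of n "?T j"] n T by simp
  have "(\<integral>\<^sup>+t. ?w t * rearrangement M g t ^ n * indicator {0<..<1} t \<partial>lborel)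
    \<le> (\<integral>\<^sup>+t. ennreal (\<Lambda> ^ n) * (?w t * indicator {0<..<1} t)
          + (\<Sum>j. ?c j * (?w t * indicator {0<..<?T j} t)) \<partial>lborel)"
    by (intro nn_integral_mono pt)
  also have "\<dots> = ennreal (\<Lambda> ^ n) * (\<integral>\<^sup>+t. ?w t * indicator {0<..<1} t \<partial>lborel)
     + (\<Sum>j. ?c j * (\<integral>\<^sup>+t. ?w t * indicator {0<..<?T j} t \<partial>lborel))"
    by (simp add: nn_integral_add nn_integral_cmult nn_integral_suminf)
  also have "\<dots> \<le> ennreal (\<Lambda> ^ n) * 1 + (\<Sum>j. ?c j * ennreal (1 / X j ^ (n - 1)))"
    using w1 wT by (intro add_mono mult_left_mono suminf_le summableI) auto
  also have "\<dots> = ennreal (\<Lambda> ^ n) + (\<Sum>j. ennreal ((\<Lambda> * 2 ^ Suc j) ^ n / X j ^ (n - 1)))"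
    using L by (simp add: ennreal_mult'[symmetric])
  finally show ?thesis .
qed

lemma lorentz_zygmund_norm_mono:
  assumes n: "n > 0" and le: "\<And>s. distribution_fun M f s \<le> distribution_fun N g s"
  shows "lorentz_zygmund_norm \<infinity> (of_nat n) (-1) M f \<le> lorentz_zygmund_norm \<infinity> (of_nat n) (-1) N g"
proof -
  have "rearrangement M f t \<le> rearrangement N g t" for t
    unfolding rearrangement_def by (intro Inf_superset_mono Collect_mono impI) (use le order_trans in blast)
  then have "(\<integral>\<^sup>+t. ennreal (1 / (t * (1 - ln t) ^ n)) * rearrangement M f t ^ n * indicator {0<..<1} t \<partial>lborel)
    \<le> (\<integral>\<^sup>+t. ennreal (1 / (t * (1 - ln t) ^ n)) * rearrangement N g t ^ n * indicator {0<..<1} t \<partial>lborel)"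
    by (intro nn_integral_mono mult_right_mono mult_left_mono power_mono) auto
  moreover have "ennpowr x (1 / real n) \<le> ennpowr y (1 / real n)" if "x \<le> y" for x y
    using that n by (cases x; cases y) (auto simp: ennpowr_def top_unique intro!: ennreal_leI powr_mono2)
  ultimately show ?thesis unfolding lorentz_zygmund_norm_eq[OF n] by blast
qed

section \<open>The Loomis--Whitney inequality\<close>

text \<open>Only the average of the \<open>n\<close>th powers of the factors matters, by the inequality of arithmetic and
  geometric means. It is used in the form \<open>z \<le> exp (z - 1)\<close> with \<open>z = x i ^ n * exp n\<close>.\<close>

lemma geometric_decay_of_average_bound:
  fixes M x :: "nat \<Rightarrow> real"
  assumes n: "n > 0" and M0: "0 \<le> M 0" and x: "\<And>i. i < N \<Longrightarrow> 0 \<le> x i"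
    and step: "\<And>i. i < N \<Longrightarrow> M (Suc i) \<le> M i * x i"
    and sum: "(\<Sum>i<N. x i ^ n) \<le> real N * exp (- real n)"
  shows "M N \<le> M 0 * exp (- real N)"
proof -
  have "M k \<le> M 0 * (\<Prod>i<k. x i)" if "k \<le> N" for k
    using that
  proof (induction k)
    case (Suc k)
    have "M (Suc k) \<le> M k * x k" using step Suc by simp
    also have "\<dots> \<le> (M 0 * (\<Prod>i<k. x i)) * x k"
      using Suc x by (intro mult_right_mono) auto
    finally show ?case by (simp add: mult.assoc)
  qed simp
  then have 1: "M N \<le> M 0 * (\<Prod>i<N. x i)" by simp
  have "(\<Prod>i<N. x i) ^ n = (\<Prod>i<N. x i ^ n)" by (simp add: prod_power_distrib)
  also have "\<dots> \<le> (\<Prod>i<N. exp (- real n) * exp (x i ^ n * exp (real n) - 1))"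
  proof (rule prod_mono)
    fix i assume "i \<in> {..<N}"
    have "x i ^ n = exp (- real n) * (x i ^ n * exp (real n))" by (simp add: exp_minus)
    also have "\<dots> \<le> exp (- real n) * exp (x i ^ n * exp (real n) - 1)"
      using exp_ge_add_one_self[of "x i ^ n * exp (real n) - 1"] by (intro mult_left_mono) auto
    finally show "0 \<le> x i ^ n \<and> x i ^ n \<le> exp (- real n) * exp (x i ^ n * exp (real n) - 1)"
      using x \<open>i \<in> {..<N}\<close> by auto
  qed
  also have "\<dots> = exp (- real n) ^ N * exp (\<Sum>i<N. x i ^ n * exp (real n) - 1)"
    by (simp add: prod.distrib exp_sum)
  also have "\<dots> \<le> exp (- real n) ^ N * 1"
  proof -
    have "(\<Sum>i<N. x i ^ n * exp (real n) - 1) = (\<Sum>i<N. x i ^ n) * exp (real n) - real N"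
      by (simp add: sum_subtractf sum_distrib_right)
    also have "\<dots> \<le> real N * exp (- real n) * exp (real n) - real N"
      using sum by (intro diff_right_mono mult_right_mono) auto
    also have "\<dots> = 0" by (simp add: exp_minus)
    finally show ?thesis by simp
  qed
  also have "\<dots> = exp (- real N) ^ n" by (simp flip: exp_of_nat_mult)
  finally have "(\<Prod>i<N. x i) \<le> exp (- real N)"
    using n x by (subst (asm) power_mono_iff) (auto intro: prod_nonneg)
  then show ?thesis using 1 M0 by (meson mult_left_mono order_trans)
qed

text \<open>Induction on the number of coordinates. The slice of \<open>E\<close> at the value \<open>y\<close> of a new coordinate \<open>l\<close>
  is contained in \<open>F l\<close>, and by the induction hypothesis it is bounded by the slices of the other
  \<open>F k\<close>. A geometric mean of the two bounds is a constant times the sum of the measures of these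
  slices, and that sum can be integrated over \<open>y\<close>. Having the sum of the measures of the projections
  on the right, instead of their product, makes Hoelder's inequality superfluous.\<close>

lemma (in product_prob_space) loomis_whitney:
  assumes "finite J" "J \<noteq> {}"
    and "E \<in> sets (PiM J M)" "E \<noteq> {}"
    and "\<And>k. k \<in> J \<Longrightarrow> F k \<in> sets (PiM (J - {k}) M)"
    and "\<And>x k. x \<in> E \<Longrightarrow> k \<in> J \<Longrightarrow> restrict x (J - {k}) \<in> F k"
  shows "measure (PiM J M) E ^ (card J - 1) \<le> (\<Sum>k\<in>J. measure (PiM (J - {k}) M) (F k)) ^ card J"
  using assms
proof (induction J arbitrary: E F rule: finite_ne_induct)
  case (singleton l)
  interpret S: prob_space "PiM {} M" by (rule prob_space_PiM) (rule prob_space)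
  obtain x where "x \<in> E" using singleton by auto
  then have "restrict x ({l} - {l}) \<in> F l" by (intro singleton) auto
  moreover have "F l \<subseteq> space (PiM {} M)" using singleton(3)[of l] sets.sets_into_space by force
  ultimately have "F l = space (PiM {} M)" by (auto simp: space_PiM)
  then show ?case by (simp add: S.prob_space)
next
  case (insert l J)
  note E[measurable] = insert.prems(1)
  define d where "d = card J"
  have d: "d > 0" "card (insert l J) = Suc d" using insert.hyps by (auto simp: d_def card_gt_0_iff)
  have F: "F k \<in> sets (PiM (insert l (J - {k})) M)" if "k \<in> J" for k
  proof -
    have "insert l J - {k} = insert l (J - {k})" using that insert.hyps by auto
    then show ?thesis using insert.prems(3)[of k] that by auto
  qed
  have Fl[measurable]: "F l \<in> sets (PiM J M)" using insert.prems(3)[of l] insert.hyps by simp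
  interpret PJ: prob_space "PiM J M" by (rule prob_space_PiM) (rule prob_space)
  interpret P1: prob_space "PiM (insert l J) M" by (rule prob_space_PiM) (rule prob_space)
  interpret Pk: prob_space "PiM (J - {k}) M" for k by (rule prob_space_PiM) (rule prob_space)
  interpret Pk1: prob_space "PiM (insert l J - {k}) M" for k by (rule prob_space_PiM) (rule prob_space)
  interpret Pk2: prob_space "PiM (insert l (J - {k})) M" for k by (rule prob_space_PiM) (rule prob_space)
  define S where "S y = {x \<in> space (PiM J M). x(l := y) \<in> E}" for y
  define G where "G k y = {z \<in> space (PiM (J - {k}) M). z(l := y) \<in> F k}" for k y
  define p where "p y = (\<Sum>k\<in>J. measure (PiM (J - {k}) M) (G k y))" for y
  define \<sigma> where "\<sigma> = (\<Sum>k\<in>insert l J. measure (PiM (insert l J - {k}) M) (F k))"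
  have \<sigma>0: "0 \<le> \<sigma>" unfolding \<sigma>_def by (intro sum_nonneg) auto
  have Fk\<sigma>: "(\<Sum>k\<in>J. measure (PiM (insert l J - {k}) M) (F k)) \<le> \<sigma>"
    unfolding \<sigma>_def using insert.hyps by simp
  have Fl\<sigma>: "measure (PiM J M) (F l) \<le> \<sigma>"
    unfolding \<sigma>_def using insert.hyps by (simp add: sum_nonneg)
  have upd: "(\<lambda>x. x(l := y)) \<in> measurable (PiM K M) (PiM (insert l K) M)" if "y \<in> space (M l)" for K y
    using that by (intro measurable_fun_upd[where J=K]) auto
  have S_meas: "S y \<in> sets (PiM J M)" if "y \<in> space (M l)" for y
    unfolding S_def using measurable_sets[OF upd[OF that] E] by (simp add: vimage_def Int_def conj_commute)
  have G_meas: "G k y \<in> sets (PiM (J - {k}) M)" if "y \<in> space (M l)" "k \<in> J" for k y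
    unfolding G_def using measurable_sets[OF upd[OF that(1)] F[OF that(2)]] by (simp add: vimage_def Int_def conj_commute)
  have sl: "measure (PiM J M) (S y) \<le> root d \<sigma> * p y" if y: "y \<in> space (M l)" for y
  proof (cases "S y = {}")
    case True
    then show ?thesis using \<sigma>0 by (auto simp: p_def intro!: mult_nonneg_nonneg sum_nonneg real_root_ge_zero)
  next
    case False
    let ?s = "measure (PiM J M) (S y)"
    have "?s ^ (card J - 1) \<le> (\<Sum>k\<in>J. measure (PiM (J - {k}) M) (G k y)) ^ card J"
    proof (rule insert.IH[OF S_meas[OF y] False])
      show "G k y \<in> sets (PiM (J - {k}) M)" if "k \<in> J" for k using G_meas y that by simp
      fix x k assume x: "x \<in> S y" and k: "k \<in> J"
      have "restrict (x(l := y)) (insert l J - {k}) \<in> F k"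
        by (rule insert.prems(4)[of "x(l := y)" k]) (use x k in \<open>simp_all add: S_def del: fun_upd_apply\<close>)
      also have "restrict (x(l := y)) (insert l J - {k}) = (restrict x (J - {k}))(l := y)"
        using insert.hyps k by (auto simp: fun_eq_iff)
      finally have "(restrict x (J - {k}))(l := y) \<in> F k" .
      moreover have "restrict x (J - {k}) \<in> space (PiM (J - {k}) M)"
        using x by (auto simp: S_def space_PiM)
      ultimately show "restrict x (J - {k}) \<in> G k y" unfolding G_def by blast
    qed
    then have 1: "?s ^ (d - 1) \<le> p y ^ d" by (simp add: p_def d_def)
    have "S y \<subseteq> F l"
    proof
      fix x assume x: "x \<in> S y"
      have "restrict (x(l := y)) (insert l J - {l}) \<in> F l"
        by (rule insert.prems(4)[of "x(l := y)" l]) (use x in \<open>simp_all add: S_def del: fun_upd_apply\<close>)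
      moreover have "restrict (x(l := y)) (insert l J - {l}) = x"
        using x insert.hyps by (auto simp: S_def space_PiM PiE_def extensional_def fun_eq_iff)
      ultimately show "x \<in> F l" by simp
    qed
    then have "?s \<le> \<sigma>" using PJ.finite_measure_mono[of "S y" "F l"] Fl\<sigma> Fl by linarith
    then have "?s * ?s ^ (d - 1) \<le> \<sigma> * p y ^ d" using 1 \<sigma>0 by (intro mult_mono) auto
    also have "?s * ?s ^ (d - 1) = ?s ^ d" using d by (metis power_eq_if less_numeral_extra(3))
    also have "\<sigma> * p y ^ d = (root d \<sigma> * p y) ^ d" using d \<sigma>0 by (simp add: power_mult_distrib)
    finally show ?thesis using \<sigma>0 d
      by (subst (asm) power_mono_iff) (auto simp: p_def intro!: mult_nonneg_nonneg sum_nonneg real_root_ge_zero)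
  qed
  have eE: "emeasure (PiM (insert l K) M) A = (\<integral>\<^sup>+y. emeasure (PiM K M) {x \<in> space (PiM K M). x(l := y) \<in> A} \<partial>M l)"
    if "finite K" "l \<notin> K" and A[measurable]: "A \<in> sets (PiM (insert l K) M)" for K A
  proof -
    have "emeasure (PiM (insert l K) M) A = (\<integral>\<^sup>+x. indicator A x \<partial>PiM (insert l K) M)" by simp
    also have "\<dots> = (\<integral>\<^sup>+y. (\<integral>\<^sup>+x. indicator A (x(l := y)) \<partial>PiM K M) \<partial>M l)"
      using that by (intro product_nn_integral_insert_rev) auto
    also have "\<dots> = (\<integral>\<^sup>+y. emeasure (PiM K M) {x \<in> space (PiM K M). x(l := y) \<in> A} \<partial>M l)"
    proof (intro nn_integral_cong)
      fix y assume y: "y \<in> space (M l)"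
      have s: "{x \<in> space (PiM K M). x(l := y) \<in> A} \<in> sets (PiM K M)"
        using measurable_sets[OF upd[OF y] A] by (simp add: vimage_def Int_def conj_commute)
      show "(\<integral>\<^sup>+x. indicator A (x(l := y)) \<partial>PiM K M) = emeasure (PiM K M) {x \<in> space (PiM K M). x(l := y) \<in> A}"
        unfolding nn_integral_indicator[OF s, symmetric]
        by (intro nn_integral_cong) (simp add: indicator_def del: fun_upd_apply)
    qed
    finally show ?thesis .
  qed
  have eF: "emeasure (PiM (insert l J - {k}) M) (F k) = (\<integral>\<^sup>+y. ennreal (measure (PiM (J - {k}) M) (G k y)) \<partial>M l)"
    if k: "k \<in> J" for k
  proof -
    have "insert l J - {k} = insert l (J - {k})" using k insert.hyps by auto
    then show ?thesis
      using eE[of "J - {k}" "F k"] F[OF k] insert.hyps by (simp add: G_def Pk.emeasure_eq_measure)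
  qed
  have Gm: "(\<lambda>y. ennreal (measure (PiM (J - {k}) M) (G k y))) \<in> borel_measurable (M l)" if k: "k \<in> J" for k
  proof -
    interpret sigma_finite_measure "PiM (J - {k}) M" by unfold_locales
    have F'[measurable]: "F k \<in> sets (PiM (insert l (J - {k})) M)" using F[OF k] .
    have "(\<lambda>y. \<integral>\<^sup>+x. indicator (F k) (x(l := y)) \<partial>PiM (J - {k}) M) \<in> borel_measurable (M l)"
      by measurable
    moreover have "(\<integral>\<^sup>+x. indicator (F k) (x(l := y)) \<partial>PiM (J - {k}) M) = ennreal (measure (PiM (J - {k}) M) (G k y))"
      if y: "y \<in> space (M l)" for y
      unfolding Pk.emeasure_eq_measure[symmetric] nn_integral_indicator[OF G_meas[OF y k], symmetric]
      by (intro nn_integral_cong) (simp add: indicator_def G_def del: fun_upd_apply)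
    ultimately show ?thesis by (simp cong: measurable_cong)
  qed
  have "ennreal (measure (PiM (insert l J) M) E) = (\<integral>\<^sup>+y. ennreal (measure (PiM J M) (S y)) \<partial>M l)"
    using eE[OF insert.hyps(1,3) E] by (simp add: S_def PJ.emeasure_eq_measure P1.emeasure_eq_measure)
  also have "\<dots> \<le> (\<integral>\<^sup>+y. ennreal (root d \<sigma>) * (\<Sum>k\<in>J. ennreal (measure (PiM (J - {k}) M) (G k y))) \<partial>M l)"
    using sl \<sigma>0 by (intro nn_integral_mono) (simp add: p_def sum_nonneg ennreal_leI flip: ennreal_mult'')
  also have "\<dots> = ennreal (root d \<sigma>) * (\<Sum>k\<in>J. (\<integral>\<^sup>+y. ennreal (measure (PiM (J - {k}) M) (G k y)) \<partial>M l))"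
    using Gm by (subst nn_integral_cmult) (auto simp: nn_integral_sum simp del: sum_ennreal intro!: borel_measurable_sum)
  also have "\<dots> = ennreal (root d \<sigma>) * (\<Sum>k\<in>J. ennreal (measure (PiM (insert l J - {k}) M) (F k)))"
    using eF by (simp add: Pk1.emeasure_eq_measure)
  also have "\<dots> \<le> ennreal (root d \<sigma> * \<sigma>)"
    using Fk\<sigma> \<sigma>0 by (simp add: ennreal_mult real_root_ge_zero) (intro mult_left_mono ennreal_leI, auto)
  finally have "measure (PiM (insert l J) M) E \<le> root d \<sigma> * \<sigma>"
    using \<sigma>0 by (subst (asm) ennreal_le_iff) (auto intro!: mult_nonneg_nonneg real_root_ge_zero)
  then have "measure (PiM (insert l J) M) E ^ d \<le> (root d \<sigma> * \<sigma>) ^ d"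
    by (intro power_mono) auto
  also have "\<dots> = \<sigma> ^ Suc d" using d \<sigma>0 by (simp add: power_mult_distrib)
  finally show ?case using d by (simp add: \<sigma>_def)
qed

section \<open>Level crossings of primitives\<close>

lemma level_crossing_increasing:
  fixes w :: "real \<Rightarrow> real"
  assumes w: "continuous_on {s0..s1} w" and s: "s0 \<le> s1" and lo: "w s0 \<le> \<theta>" and hi: "\<mu> \<le> w s1" and "\<theta> < \<mu>"
  shows "\<exists>\<alpha> \<beta>. s0 \<le> \<alpha> \<and> \<alpha> < \<beta> \<and> \<beta> \<le> s1 \<and> w \<alpha> \<le> \<theta> \<and> \<mu> \<le> w \<beta> \<and> (\<forall>s. \<alpha> < s \<and> s < \<beta> \<longrightarrow> \<theta> < w s \<and> w s < \<mu>)"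
proof -
  have "compact ({s0..s1} \<inter> w -` {..\<theta>})"
    using continuous_closed_preimage[OF w, of "{..\<theta>}"]
    by (simp add: compact_eq_bounded_closed bounded_Int)
  then obtain \<alpha> where \<alpha>: "\<alpha> \<in> {s0..s1} \<inter> w -` {..\<theta>}" and \<alpha>max: "\<And>s. s \<in> {s0..s1} \<inter> w -` {..\<theta>} \<Longrightarrow> s \<le> \<alpha>"
    using compact_attains_sup[of "{s0..s1} \<inter> w -` {..\<theta>}"] s lo by force
  have w': "continuous_on {\<alpha>..s1} w" by (rule continuous_on_subset[OF w]) (use \<alpha> in auto)
  have "compact ({\<alpha>..s1} \<inter> w -` {\<mu>..})"
    using continuous_closed_preimage[OF w', of "{\<mu>..}"]
    by (simp add: compact_eq_bounded_closed bounded_Int)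
  then obtain \<beta> where \<beta>: "\<beta> \<in> {\<alpha>..s1} \<inter> w -` {\<mu>..}" and \<beta>min: "\<And>s. s \<in> {\<alpha>..s1} \<inter> w -` {\<mu>..} \<Longrightarrow> \<beta> \<le> s"
    using compact_attains_inf[of "{\<alpha>..s1} \<inter> w -` {\<mu>..}"] \<alpha> hi by force
  have "\<alpha> \<noteq> \<beta>" using \<alpha> \<beta> \<open>\<theta> < \<mu>\<close> by auto
  moreover have "\<theta> < w s \<and> w s < \<mu>" if "\<alpha> < s" "s < \<beta>" for s
    using \<alpha>max[of s] \<beta>min[of s] \<alpha> \<beta> that by force
  ultimately show ?thesis using \<alpha> \<beta> by (intro exI[of _ \<alpha>] exI[of _ \<beta>]) auto
qed

text \<open>The points \<open>\<alpha>\<close>, \<open>\<beta>\<close> are the last point before \<open>\<mu>\<close> is reached at which \<open>w\<close> is at most \<open>\<theta>\<close>, and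
  the next point at which \<open>w\<close> is at least \<open>\<mu>\<close>, or the same read from right to left.\<close>

lemma level_crossing:
  fixes w :: "real \<Rightarrow> real"
  assumes w: "continuous_on UNIV w" and lo: "w s0 \<le> \<theta>" and hi: "\<mu> \<le> w s1" and "\<theta> < \<mu>"
  shows "\<exists>\<alpha> \<beta>. \<alpha> < \<beta> \<and> {\<alpha><..<\<beta>} \<subseteq> closed_segment s0 s1 \<and> \<mu> - \<theta> \<le> \<bar>w \<beta> - w \<alpha>\<bar>
     \<and> (\<forall>s. \<alpha> < s \<and> s < \<beta> \<longrightarrow> \<theta> < w s \<and> w s < \<mu>)"
proof (cases "s0 \<le> s1")
  case True
  obtain \<alpha> \<beta> where "s0 \<le> \<alpha>" "\<alpha> < \<beta>" "\<beta> \<le> s1" "w \<alpha> \<le> \<theta>" "\<mu> \<le> w \<beta>" "\<forall>s. \<alpha> < s \<and> s < \<beta> \<longrightarrow> \<theta> < w s \<and> w s < \<mu>"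
    using level_crossing_increasing[OF continuous_on_subset[OF w] True lo hi] assms(4) by blast
  then show ?thesis using True
    by (intro exI[of _ \<alpha>] exI[of _ \<beta>]) (auto simp: closed_segment_eq_real_ivl)
next
  case False
  have "continuous_on {-s0..-s1} (\<lambda>s. w (- s))"
    by (intro continuous_on_compose2[OF w] continuous_intros) auto
  then obtain \<alpha> \<beta> where *: "-s0 \<le> \<alpha>" "\<alpha> < \<beta>" "\<beta> \<le> -s1" "w (-\<alpha>) \<le> \<theta>" "\<mu> \<le> w (-\<beta>)" 
      "\<forall>s. \<alpha> < s \<and> s < \<beta> \<longrightarrow> \<theta> < w (-s) \<and> w (-s) < \<mu>"
    using level_crossing_increasing[of "-s0" "-s1" "\<lambda>s. w (- s)" \<theta> \<mu>] False lo hi assms(4) by auto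
  have "\<theta> < w s \<and> w s < \<mu>" if "-\<beta> < s" "s < -\<alpha>" for s
    using *(6)[rule_format, of "-s"] that by auto
  then show ?thesis using * False
    by (intro exI[of _ "-\<beta>"] exI[of _ "-\<alpha>"]) (auto simp: closed_segment_eq_real_ivl)
qed

lemma continuous_on_primitive:
  fixes L :: "real measure" and h :: "real \<Rightarrow> real"
  assumes h: "integrable L h" and L: "sets L = sets (restrict_space borel I)" and atom: "\<And>s. emeasure L ({s} \<inter> I) = 0"
  shows "continuous_on UNIV (\<lambda>s. LINT \<sigma>|L. indicator {..<s} \<sigma> * h \<sigma>)"
proof (rule continuous_at_imp_continuous_on, rule ballI)
  fix s :: real
  have ind[measurable]: "(\<lambda>\<sigma>. indicator {..<s} \<sigma> :: real) \<in> borel_measurable L" for s :: real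
    by (subst measurable_cong_sets[OF L refl]) (intro measurable_restrict_space1, simp)
  have [measurable]: "h \<in> borel_measurable L" using h by auto
  show "isCont (\<lambda>s. LINT \<sigma>|L. indicator {..<s} \<sigma> * h \<sigma>) s"
    unfolding continuous_at_sequentially comp_def
  proof (intro allI impI)
    fix X assume X: "X \<longlonglongrightarrow> s"
    show "(\<lambda>n. LINT \<sigma>|L. indicator {..<X n} \<sigma> * h \<sigma>) \<longlonglongrightarrow> (LINT \<sigma>|L. indicator {..<s} \<sigma> * h \<sigma>)"
    proof (rule integral_dominated_convergence[where w="\<lambda>\<sigma>. \<bar>h \<sigma>\<bar>"])
      show "integrable L (\<lambda>\<sigma>. \<bar>h \<sigma>\<bar>)" using h by simp
      have sp: "space L = I" using sets_eq_imp_space_eq[OF L] by (simp add: space_restrict_space)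
      have "{s} \<inter> I \<in> null_sets L" using atom L by (auto simp: null_sets_def sets_restrict_space)
      from AE_not_in[OF this] show "AE \<sigma> in L. (\<lambda>n. indicator {..<X n} \<sigma> * h \<sigma>) \<longlonglongrightarrow> indicator {..<s} \<sigma> * h \<sigma>"
        using AE_space
      proof eventually_elim
        case (elim \<sigma>)
        then consider "\<sigma> < s" | "s < \<sigma>" using sp by force
        then show ?case
        proof cases
          case 1
          with X have "\<forall>\<^sub>F n in sequentially. \<sigma> < X n" by (intro order_tendstoD)
          then show ?thesis using 1 by (intro tendsto_eventually) (auto elim!: eventually_mono split: split_indicator)
        next
          case 2
          with X have "\<forall>\<^sub>F n in sequentially. X n < \<sigma>" by (intro order_tendstoD)
          then show ?thesis using 2 by (intro tendsto_eventually) (auto elim!: eventually_mono split: split_indicator)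
        qed
      qed
    qed (auto split: split_indicator)
  qed
qed

text \<open>One line of the cube. If \<open>u\<close> exceeds \<open>\<theta> + \<delta>\<close> somewhere on the line, then either it drops below
  \<open>\<theta>\<close> elsewhere, so that it crosses the slab and its derivative has integral at least \<open>\<delta>\<close> there, or
  it stays above \<open>\<theta>\<close> on the whole line, and then the last integral is \<open>1\<close>.\<close>

lemma slab_integral_lower_bound:
  fixes L :: "real measure" and u h :: "real \<Rightarrow> real"
  assumes L: "sets L = sets (restrict_space borel I)" and I: "is_interval I"
    and atom: "\<And>s. emeasure L ({s} \<inter> I) = 0" and prob: "emeasure L I = 1"
    and u[measurable]: "u \<in> borel_measurable L" and h: "integrable L h"
    and uv: "AE s in L. u s = c + (LINT \<sigma>|L. indicator {..<s} \<sigma> * h \<sigma>)"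
    and \<delta>: "0 < \<delta>" and pos: "emeasure L {s\<in>I. \<theta> + \<delta> < \<bar>u s\<bar>} > 0"
  shows "ennreal \<delta> \<le> (\<integral>\<^sup>+s. ennreal (\<bar>h s\<bar> * indicator {\<theta><..\<theta>+\<delta>} \<bar>u s\<bar>) \<partial>L)
       + ennreal \<delta> * (\<integral>\<^sup>+s. indicator {\<theta><..} \<bar>u s\<bar> \<partial>L)"
proof -
  define v where "v s = c + (LINT \<sigma>|L. indicator {..<s} \<sigma> * h \<sigma>)" for s
  have sp: "space L = I" using sets_eq_imp_space_eq[OF L] by (simp add: space_restrict_space)
  have [measurable]: "h \<in> borel_measurable L" using h by auto
  have idm: "(\<lambda>x. x) \<in> L \<rightarrow>\<^sub>M borel"
    by (subst measurable_cong_sets[OF L refl]) (intro measurable_restrict_space1, simp)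
  have ind[measurable]: "(\<lambda>\<sigma>. indicator A \<sigma> :: real) \<in> borel_measurable L" if "A \<in> sets borel" for A :: "real set"
    by (subst measurable_cong_sets[OF L refl]) (intro measurable_restrict_space1 borel_measurable_indicator that)
  have cv: "continuous_on UNIV v" unfolding v_def
    by (intro continuous_intros continuous_on_primitive[OF h L atom])
  have cw: "continuous_on UNIV (\<lambda>s. \<bar>v s\<bar>)" by (intro continuous_intros cv)
  have uv': "AE s in L. u s = v s" using uv by (simp add: v_def)
  obtain s1 where s1: "s1 \<in> I" "\<theta> + \<delta> \<le> \<bar>v s1\<bar>"
  proof (rule ccontr)
    assume "\<not> thesis"
    then have *: "\<And>s. s \<in> I \<Longrightarrow> \<bar>v s\<bar> < \<theta> + \<delta>" using that not_less by blast
    from uv' AE_space[of L] have "AE s in L. \<not> \<theta> + \<delta> < \<bar>u s\<bar>"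
    proof eventually_elim
      case (elim s)
      then show ?case using *[of s] by (simp add: sp)
    qed
    then have "emeasure L {s\<in>space L. \<theta> + \<delta> < \<bar>u s\<bar>} = 0"
      by (subst (asm) AE_iff_measurable[OF _ refl]) auto
    then show False using pos sp by simp
  qed
  show ?thesis
  proof (cases "\<exists>s0\<in>I. \<bar>v s0\<bar> \<le> \<theta>")
    case False
    from uv' AE_space[of L] have "AE s in L. indicator {\<theta><..} \<bar>u s\<bar> = (1::ennreal)"
    proof eventually_elim
      case (elim s)
      then show ?case using False by (auto simp: sp not_le split: split_indicator)
    qed
    then have "(\<integral>\<^sup>+s. indicator {\<theta><..} \<bar>u s\<bar> \<partial>L) = (\<integral>\<^sup>+s. 1 \<partial>L)" by (intro nn_integral_cong_AE) auto
    also have "\<dots> = 1" using prob sp by simp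
    finally show ?thesis by simp
  next
    case True
    then obtain s0 where s0: "s0 \<in> I" "\<bar>v s0\<bar> \<le> \<theta>" by auto
    obtain \<alpha> \<beta> where ab: "\<alpha> < \<beta>" "{\<alpha><..<\<beta>} \<subseteq> closed_segment s0 s1" "\<theta> + \<delta> - \<theta> \<le> \<bar>\<bar>v \<beta>\<bar> - \<bar>v \<alpha>\<bar>\<bar>"
       "\<And>s. \<alpha> < s \<Longrightarrow> s < \<beta> \<Longrightarrow> \<theta> < \<bar>v s\<bar> \<and> \<bar>v s\<bar> < \<theta> + \<delta>"
      using level_crossing[OF cw s0(2) s1(2)] \<delta> by auto
    have int: "integrable L (\<lambda>\<sigma>. indicator A \<sigma> * h \<sigma>)" if "A \<in> sets borel" for A
      using h that by (intro Bochner_Integration.integrable_bound[OF h]) (auto split: split_indicator)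
    have "\<delta> \<le> \<bar>v \<beta> - v \<alpha>\<bar>" using ab by simp
    also have "v \<beta> - v \<alpha> = (LINT \<sigma>|L. indicator {\<alpha>..<\<beta>} \<sigma> * h \<sigma>)"
      unfolding v_def using ab(1)
      by (simp add: int flip: Bochner_Integration.integral_diff)
         (intro Bochner_Integration.integral_cong refl, auto split: split_indicator)
    finally have "ennreal \<delta> \<le> ennreal (norm (LINT \<sigma>|L. indicator {\<alpha>..<\<beta>} \<sigma> * h \<sigma>))" by (simp add: ennreal_leI)
    also have "\<dots> \<le> (\<integral>\<^sup>+\<sigma>. ennreal (norm (indicator {\<alpha>..<\<beta>} \<sigma> * h \<sigma>)) \<partial>L)"
      by (intro integral_norm_bound_ennreal int) auto
    also have "\<dots> \<le> (\<integral>\<^sup>+s. ennreal (\<bar>h s\<bar> * indicator {\<theta><..\<theta>+\<delta>} \<bar>u s\<bar>) \<partial>L)"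
    proof (intro nn_integral_mono_AE)
      have "{\<alpha>} \<inter> I \<in> null_sets L" using atom L by (auto simp: null_sets_def sets_restrict_space)
      from AE_not_in[OF this] uv' AE_space
      show "AE \<sigma> in L. ennreal (norm (indicator {\<alpha>..<\<beta>} \<sigma> * h \<sigma>)) \<le> ennreal (\<bar>h \<sigma>\<bar> * indicator {\<theta><..\<theta>+\<delta>} \<bar>u \<sigma>\<bar>)"
      proof eventually_elim
        case (elim \<sigma>)
        show ?case
        proof (cases "\<sigma> \<in> {\<alpha>..<\<beta>}")
          case True
          then have "\<alpha> < \<sigma>" "\<sigma> < \<beta>" using elim sp by (auto simp: order.order_iff_strict)
          then show ?thesis using ab(4)[of \<sigma>] elim(2) by simp
        qed simp
      qed
    qed
    finally show ?thesis by (rule order_trans) simp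
  qed
qed

section \<open>Exponential decay of level sets\<close>

text \<open>\<open>M \<theta>\<close> stands for the total measure of the sets of lines that meet \<open>{\<bar>u\<bar> > \<theta>}\<close>, \<open>D \<theta>\<close> for the measure
  of this level set itself and \<open>\<Gamma> a b\<close> for the integral of the \<open>n\<close>th power of the gradient over
  \<open>{a < \<bar>u\<bar> \<le> b}\<close>. The hypothesis \<open>step\<close> bounds the integral of the gradient over a slab by means of
  \<open>h \<le> \<tau> + h\<^sup>n / \<tau>\<^bsup>n-1\<^esup>\<close>; the optimal \<open>\<tau>\<close> turns it into Hoelder's inequality. Since the
  Loomis--Whitney inequality bounds \<open>D \<theta>\<close> to the power \<open>1 - 1/n\<close> by \<open>M \<theta>\<close>, the result is a recursion that is linear in \<open>M\<close>.\<close>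

lemma level_step:
  fixes M D :: "real \<Rightarrow> real" and \<Gamma> :: "real \<Rightarrow> real \<Rightarrow> real"
  assumes n: "n \<ge> 2" and A: "0 < A"
    and M0: "\<And>\<theta>. 0 \<le> M \<theta>" and D0: "\<And>\<theta>. 0 \<le> D \<theta>"
    and LW: "\<And>\<theta>. 0 \<le> \<theta> \<Longrightarrow> D \<theta> ^ (n - 1) \<le> M \<theta> ^ n"
    and step: "\<And>\<theta> \<delta> \<tau>. 0 \<le> \<theta> \<Longrightarrow> 0 < \<delta> \<Longrightarrow> 0 < \<tau> \<Longrightarrow>
        \<delta> * M (\<theta> + \<delta>) \<le> \<tau> * D \<theta> + \<Gamma> \<theta> (\<theta> + \<delta>) / \<tau> ^ (n - 1) + real n * \<delta> * D \<theta>"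
    and markov: "\<And>\<theta>. 0 < \<theta> \<Longrightarrow> D \<theta> \<le> (A / \<theta>) ^ n"
    and \<theta>: "0 < \<theta>" and \<delta>: "0 < \<delta>" and \<gamma>: "0 < \<gamma>" "\<Gamma> \<theta> (\<theta> + \<delta>) \<le> \<gamma> ^ n"
  shows "M (\<theta> + \<delta>) \<le> M \<theta> * (2 * \<gamma> / \<delta> + real n * A / \<theta>)"
proof (cases "D \<theta> = 0")
  case True
  have "M (\<theta> + \<delta>) \<le> 0"
  proof (rule ccontr)
    assume "\<not> M (\<theta> + \<delta>) \<le> 0"
    then have pos: "0 < \<delta> * M (\<theta> + \<delta>)" using \<delta> by simp
    \<comment> \<open>Without points above \<open>\<theta>\<close> the parameter \<open>\<tau>\<close> costs nothing and may be taken large.\<close>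
    define \<tau> where "\<tau> = max 1 (2 * \<gamma> ^ n / (\<delta> * M (\<theta> + \<delta>)))"
    have \<tau>: "1 \<le> \<tau>" "2 * \<gamma> ^ n / (\<delta> * M (\<theta> + \<delta>)) \<le> \<tau>" by (auto simp: \<tau>_def)
    have "\<tau> \<le> \<tau> ^ (n - 1)" using \<tau> n by (intro self_le_power) auto
    have "\<delta> * M (\<theta> + \<delta>) \<le> \<Gamma> \<theta> (\<theta> + \<delta>) / \<tau> ^ (n - 1)"
      using step[of \<theta> \<delta> \<tau>] True \<theta> \<delta> \<tau> by simp
    also have "\<dots> \<le> \<gamma> ^ n / \<tau> ^ (n - 1)" using \<gamma> \<tau> by (intro divide_right_mono) auto
    also have "\<dots> \<le> \<gamma> ^ n / \<tau>" using \<open>\<tau> \<le> \<tau> ^ (n - 1)\<close> \<tau> \<gamma> by (intro divide_left_mono) auto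
    also have "\<dots> \<le> \<delta> * M (\<theta> + \<delta>) / 2"
      using \<tau> pos by (simp add: field_simps)
    finally show False using pos by simp
  qed
  moreover have "0 \<le> M \<theta> * (2 * \<gamma> / \<delta> + real n * A / \<theta>)"
    using M0 \<gamma> \<delta> \<theta> A by simp
  ultimately show ?thesis by linarith
next
  case False
  \<comment> \<open>The optimal parameter is \<open>\<tau> = \<gamma> / d\<close>, where \<open>d\<^sup>n\<close> is the measure of the level set.\<close>
  define d where "d = root n (D \<theta>)"
  have d: "0 < d" "d ^ n = D \<theta>" using False D0[of \<theta>] n by (auto simp: d_def)
  have "(d ^ (n - 1)) ^ n \<le> M \<theta> ^ n"
    using LW[of \<theta>] \<theta> by (simp add: d(2)[symmetric] power_mult[symmetric] mult.commute)
  then have dM: "d ^ (n - 1) \<le> M \<theta>" using d M0 n by (subst (asm) power_mono_iff) auto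
  have "d ^ n \<le> (A / \<theta>) ^ n" using markov \<theta> d by simp
  then have dA: "d \<le> A / \<theta>" using d A \<theta> n by (subst (asm) power_mono_iff) auto
  have dd: "d ^ n = d * d ^ (n - 1)" and gg: "\<gamma> ^ n = \<gamma> * \<gamma> ^ (n - 1)"
    using n by (metis Suc_diff_1 less_le_trans pos2 power_Suc)+
  have "\<delta> * M (\<theta> + \<delta>) \<le> \<gamma> / d * d ^ n + \<Gamma> \<theta> (\<theta> + \<delta>) / (\<gamma> / d) ^ (n - 1) + real n * \<delta> * d ^ n"
    using step[of \<theta> \<delta> "\<gamma> / d"] \<theta> \<delta> \<gamma> d by simp
  also have "\<dots> \<le> \<gamma> / d * d ^ n + \<gamma> ^ n / (\<gamma> / d) ^ (n - 1) + real n * \<delta> * d ^ n"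
    using \<gamma> d by (intro add_mono divide_right_mono) auto
  also have "\<dots> = d ^ (n - 1) * (2 * \<gamma> + real n * \<delta> * d)"
    unfolding dd gg using d \<gamma> by (simp add: field_simps)
  also have "\<dots> \<le> M \<theta> * (2 * \<gamma> + real n * \<delta> * (A / \<theta>))"
    using dM dA d \<gamma> \<delta> M0 by (intro mult_mono add_mono) auto
  also have "\<dots> = \<delta> * (M \<theta> * (2 * \<gamma> / \<delta> + real n * A / \<theta>))"
    using \<delta> by (simp add: field_simps)
  finally show ?thesis using \<delta> by (subst (asm) mult_le_cancel_left_pos)
qed

lemma add_power_le:
  fixes a b :: real
  assumes "0 \<le> a" "0 \<le> b"
  shows "(a + b) ^ n \<le> 2 ^ n * (a ^ n + b ^ n)"
proof -
  have "(a + b) ^ n \<le> (2 * max a b) ^ n" using assms by (intro power_mono) auto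
  also have "\<dots> \<le> 2 ^ n * (a ^ n + b ^ n)" using assms by (auto simp: power_mult_distrib max_def)
  finally show ?thesis .
qed

text \<open>The slab \<open>{l < \<bar>u\<bar> \<le> 2 l}\<close> is cut into \<open>N\<close> slabs of equal height, and the recursion of
  \<open>level_step\<close> is applied to each of them. The \<open>n\<close>th powers of the factors have average at most
  \<open>exp (- n)\<close> as long as \<open>N\<^bsup>n-1\<^esup>\<close> is at most a constant times \<open>l\<^sup>n / \<Gamma>\<close>, and then the product of
  the factors is at most \<open>exp (- N)\<close>. This is where the exponent \<open>n/(n-1)\<close> of Trudinger's inequality
  comes from. The summand \<open>\<eta>\<close> only serves to keep the quantities \<open>\<gamma>\<close> positive.\<close>

lemma dyadic_decay_step:
  fixes M D :: "real \<Rightarrow> real" and \<Gamma> :: "real \<Rightarrow> real \<Rightarrow> real"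
  assumes n: "n \<ge> 2" and A: "0 < A"
    and M0: "\<And>\<theta>. 0 \<le> M \<theta>" and Mn: "\<And>\<theta>. M \<theta> \<le> real n" and D0: "\<And>\<theta>. 0 \<le> D \<theta>"
    and LW: "\<And>\<theta>. 0 \<le> \<theta> \<Longrightarrow> D \<theta> ^ (n - 1) \<le> M \<theta> ^ n"
    and step: "\<And>\<theta> \<delta> \<tau>. 0 \<le> \<theta> \<Longrightarrow> 0 < \<delta> \<Longrightarrow> 0 < \<tau> \<Longrightarrow>
        \<delta> * M (\<theta> + \<delta>) \<le> \<tau> * D \<theta> + \<Gamma> \<theta> (\<theta> + \<delta>) / \<tau> ^ (n - 1) + real n * \<delta> * D \<theta>"
    and markov: "\<And>\<theta>. 0 < \<theta> \<Longrightarrow> D \<theta> \<le> (A / \<theta>) ^ n"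
    and \<Gamma>0: "\<And>a b. 0 \<le> \<Gamma> a b"
    and \<Gamma>sum: "\<And>a \<delta> N. 0 < \<delta> \<Longrightarrow> (\<Sum>i<N. \<Gamma> (a + real i * \<delta>) (a + real (Suc i) * \<delta>)) \<le> \<Gamma> a (a + real N * \<delta>)"
    and l: "4 * exp 1 * real n * A \<le> l" and N: "0 < N"
    and \<eta>: "0 < \<eta>" and G: "G = \<Gamma> l (2 * l) + \<eta>"
    and NG: "real N ^ (n - 1) * G \<le> l ^ n / (2 * (4 * exp 1) ^ n)"
  shows "M (2 * l) \<le> real n * exp (- real N)"
proof -
  have l0: "0 < l" using l A n by (smt (verit) exp_gt_zero mult_pos_pos of_nat_0_less_iff pos2 zero_less_mult_iff order_less_le_trans)
  define \<delta> where "\<delta> = l / real N"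
  have \<delta>: "0 < \<delta>" "real N * \<delta> = l" using l0 N by (auto simp: \<delta>_def)
  define th where "th i = l + real i * \<delta>" for i
  \<comment> \<open>The summand \<open>\<eta> / N\<close> makes \<open>\<gamma> i\<close> positive; the \<open>N\<close> of them add up to \<open>\<eta>\<close>.\<close>
  define \<gamma> where "\<gamma> i = root n (\<Gamma> (th i) (th (Suc i)) + \<eta> / real N)" for i
  define x where "x i = 2 * \<gamma> i / \<delta> + real n * A / l" for i
  have th0: "l \<le> th i" for i using \<delta> by (simp add: th_def)
  have \<gamma>n: "\<gamma> i ^ n = \<Gamma> (th i) (th (Suc i)) + \<eta> / real N" for i
    unfolding \<gamma>_def using \<Gamma>0[of "th i" "th (Suc i)"] \<eta> n by (intro real_root_pow_pos2) auto
  have \<gamma>0: "0 < \<gamma> i" for i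
    unfolding \<gamma>_def using \<Gamma>0[of "th i" "th (Suc i)"] \<eta> N n by (intro real_root_gt_zero add_nonneg_pos) auto
  have x0: "0 \<le> x i" for i using \<gamma>0[of i] \<delta> A l0 by (simp add: x_def)
  have one: "M (th (Suc i)) \<le> M (th i) * x i" for i
  proof -
    have e: "th (Suc i) = th i + \<delta>" by (simp add: th_def algebra_simps)
    have "M (th i + \<delta>) \<le> M (th i) * (2 * \<gamma> i / \<delta> + real n * A / th i)"
    proof (rule level_step[where M=M and D=D and \<Gamma>=\<Gamma> and n=n and A=A])
      show "\<Gamma> (th i) (th i + \<delta>) \<le> \<gamma> i ^ n" using \<gamma>n[of i] \<eta> by (simp add: e)
      show "0 < th i" using th0[of i] l0 by linarith
    qed (use assms \<delta> \<gamma>0 in auto)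
    also have "\<dots> \<le> M (th i) * x i"
      unfolding x_def using M0 th0[of i] l0 A by (intro mult_left_mono add_left_mono divide_left_mono) auto
    finally show ?thesis by (simp add: e)
  qed
  have small: "real n * A / l \<le> 1 / (4 * exp 1)"
    using l l0 by (simp add: field_simps)
  have "(\<Sum>i<N. x i ^ n) \<le> (\<Sum>i<N. 2 ^ n * ((2 / \<delta>) ^ n * \<gamma> i ^ n + (1 / (4 * exp 1)) ^ n))"
  proof (rule sum_mono)
    fix i
    have "x i ^ n \<le> 2 ^ n * ((2 * \<gamma> i / \<delta>) ^ n + (real n * A / l) ^ n)"
      unfolding x_def using \<gamma>0[of i] \<delta> A l0 by (intro add_power_le) auto
    also have "\<dots> \<le> 2 ^ n * ((2 * \<gamma> i / \<delta>) ^ n + (1 / (4 * exp 1)) ^ n)"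
      using small A l0 by (intro mult_left_mono add_left_mono power_mono) auto
    also have "(2 * \<gamma> i / \<delta>) ^ n = (2 / \<delta>) ^ n * \<gamma> i ^ n" by (simp add: power_mult_distrib power_divide)
    finally show "x i ^ n \<le> 2 ^ n * ((2 / \<delta>) ^ n * \<gamma> i ^ n + (1 / (4 * exp 1)) ^ n)" .
  qed
  also have "\<dots> = 2 ^ n * ((2 / \<delta>) ^ n * (\<Sum>i<N. \<gamma> i ^ n) + real N * (1 / (4 * exp 1)) ^ n)"
    by (simp add: sum.distrib sum_distrib_left[symmetric])
  also have "\<dots> \<le> 2 ^ n * ((2 / \<delta>) ^ n * G + real N * (1 / (4 * exp 1)) ^ n)"
  proof -
    have "(\<Sum>i<N. \<gamma> i ^ n) = (\<Sum>i<N. \<Gamma> (l + real i * \<delta>) (l + real (Suc i) * \<delta>)) + \<eta>"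
      using N by (simp add: \<gamma>n sum.distrib th_def)
    also have "\<dots> \<le> G" using \<Gamma>sum[OF \<delta>(1), of l N] \<delta> G by simp
    finally show ?thesis using \<delta> by (intro mult_left_mono add_right_mono) auto
  qed
  also have "\<dots> \<le> real N * exp (- real n)"
  proof -
    have NN: "real N ^ n = real N * real N ^ (n - 1)"
      using n by (metis Suc_diff_1 less_le_trans pos2 power_Suc)
    have "2 ^ n * ((2 / \<delta>) ^ n * G) = real N * (4 ^ n / l ^ n) * (real N ^ (n - 1) * G)"
      unfolding \<delta>_def by (simp add: power_divide power_mult_distrib NN flip: power_mult_distrib[of 2 2])
    also have "\<dots> \<le> real N * (4 ^ n / l ^ n) * (l ^ n / (2 * (4 * exp 1) ^ n))"
      using NG l0 by (intro mult_left_mono) auto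
    also have "\<dots> = real N * exp (- real n) / 2"
      using l0 by (simp add: power_mult_distrib exp_minus inverse_eq_divide flip: exp_of_nat_mult)
    finally have 1: "2 ^ n * ((2 / \<delta>) ^ n * G) \<le> real N * exp (- real n) / 2" .
    have "2 ^ n * (1 / (4 * exp 1)) ^ n = exp (- real n) / (2::real) ^ n"
    proof -
      have "(2::real) ^ n * (1 / (4 * exp 1)) ^ n = (2 * (1 / (4 * exp 1))) ^ n" by (simp only: power_mult_distrib)
      also have "2 * (1 / (4 * exp 1)) = 1 / (2 * exp (1::real))" by simp
      also have "\<dots> ^ n = exp (- real n) / 2 ^ n"
        by (simp add: power_one_over power_mult_distrib exp_minus inverse_eq_divide flip: exp_of_nat_mult)
      finally show ?thesis .
    qed
    also have "\<dots> \<le> exp (- real n) / 2"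
      using n self_le_power[of "2::real" n] by (intro divide_left_mono) auto
    finally have 2: "2 ^ n * (real N * (1 / (4 * exp 1)) ^ n) \<le> real N * exp (- real n) / 2"
      by (subst mult.left_commute) (use mult_left_mono[of _ _ "real N"] in fastforce)
    show ?thesis using 1 2 by (simp add: distrib_left)
  qed
  finally have sum: "(\<Sum>i<N. x i ^ n) \<le> real N * exp (- real n)" .
  have "M (th N) \<le> M (th 0) * exp (- real N)"
    by (rule geometric_decay_of_average_bound[where n=n and x=x and M="\<lambda>i. M (th i)"])
       (use n M0 x0 one sum in auto)
  also have "\<dots> \<le> real n * exp (- real N)" using Mn by (intro mult_right_mono) auto
  also have "th N = 2 * l" using \<delta> by (simp add: th_def)
  finally show ?thesis .
qed

lemma obtain_nat_power_bracket:
  fixes R :: real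
  assumes "1 \<le> R" "0 < m"
  obtains N :: nat where "0 < N" "real N ^ m \<le> R" "R < real (Suc N) ^ m"
proof -
  define N where "N = nat \<lfloor>root m R\<rfloor>"
  have r: "1 \<le> root m R" using assms by simp
  have N: "real N \<le> root m R" "root m R < real (Suc N)" "0 < N"
    using r unfolding N_def by linarith+
  have R: "root m R ^ m = R" using assms by (simp add: real_root_pow_pos2)
  have "real N ^ m \<le> root m R ^ m" using N by (intro power_mono) auto
  moreover have "root m R ^ m < real (Suc N) ^ m" using N r assms by (intro power_strict_mono) auto
  ultimately show thesis using N R that by auto
qed

text \<open>The largest admissible number \<open>N\<close> of slabs gives decay at the rate that the Lorentz--Zygmund
  functional needs. It is recorded by a number \<open>X\<close> with \<open>X \<le> 1 + ln (1 / m)\<close> for every positive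
  \<open>m \<le> min 1 (M (2 * l))\<close>.\<close>

lemma dyadic_decay:
  fixes M D :: "real \<Rightarrow> real" and \<Gamma> :: "real \<Rightarrow> real \<Rightarrow> real"
  assumes n: "n \<ge> 2" and A: "0 < A"
    and M0: "\<And>\<theta>. 0 \<le> M \<theta>" and Mn: "\<And>\<theta>. M \<theta> \<le> real n" and D0: "\<And>\<theta>. 0 \<le> D \<theta>"
    and LW: "\<And>\<theta>. 0 \<le> \<theta> \<Longrightarrow> D \<theta> ^ (n - 1) \<le> M \<theta> ^ n"
    and step: "\<And>\<theta> \<delta> \<tau>. 0 \<le> \<theta> \<Longrightarrow> 0 < \<delta> \<Longrightarrow> 0 < \<tau> \<Longrightarrow>
        \<delta> * M (\<theta> + \<delta>) \<le> \<tau> * D \<theta> + \<Gamma> \<theta> (\<theta> + \<delta>) / \<tau> ^ (n - 1) + real n * \<delta> * D \<theta>"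
    and markov: "\<And>\<theta>. 0 < \<theta> \<Longrightarrow> D \<theta> \<le> (A / \<theta>) ^ n"
    and \<Gamma>0: "\<And>a b. 0 \<le> \<Gamma> a b" and \<Gamma>A: "\<And>a b. \<Gamma> a b \<le> A ^ n"
    and \<Gamma>sum: "\<And>a \<delta> N. 0 < \<delta> \<Longrightarrow> (\<Sum>i<N. \<Gamma> (a + real i * \<delta>) (a + real (Suc i) * \<delta>)) \<le> \<Gamma> a (a + real N * \<delta>)"
    and l: "4 * exp 1 * real n * A \<le> l" and \<eta>: "0 < \<eta>" "\<eta> \<le> A ^ n"
  shows "\<exists>X\<ge>1. (\<forall>m. m \<le> 1 \<longrightarrow> m \<le> M (2 * l) \<longrightarrow> m \<le> exp (1 - X)) \<and>
     (4 * l) ^ n / X ^ (n - 1) \<le> 2 * (16 * exp 1) ^ n * (2 * real n) ^ (n - 1) * (\<Gamma> l (2 * l) + \<eta>)"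
proof -
  define G where "G = \<Gamma> l (2 * l) + \<eta>"
  define R where "R = l ^ n / (2 * (4 * exp 1) ^ n) / G"
  have l0: "0 < l" using l A n by (smt (verit) exp_gt_zero mult_pos_pos of_nat_0_less_iff pos2 order_less_le_trans)
  have G: "0 < G" "G \<le> 2 * A ^ n" using \<Gamma>0[of l "2*l"] \<Gamma>A[of l "2*l"] \<eta> by (auto simp: G_def)
  have e0: "0 < 2 * (4 * exp (1::real)) ^ n" by simp
  have "2 * (4 * exp 1) ^ n * G \<le> l ^ n"
  proof -
    have "4 \<le> real n ^ n"
    proof -
      have "(2::real) ^ 2 \<le> 2 ^ n" using n by (intro power_increasing) auto
      also have "\<dots> \<le> real n ^ n" using n by (intro power_mono) auto
      finally show ?thesis by simp
    qed
    have "2 * (4 * exp 1) ^ n * G \<le> (4 * exp 1) ^ n * A ^ n * real n ^ n"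
    proof -
      have "2 * G \<le> 4 * A ^ n" using G by simp
      also have "\<dots> \<le> real n ^ n * A ^ n" using \<open>4 \<le> real n ^ n\<close> A by (intro mult_right_mono) auto
      finally have "(4 * exp 1) ^ n * (2 * G) \<le> (4 * exp 1) ^ n * (real n ^ n * A ^ n)"
        by (intro mult_left_mono) auto
      then show ?thesis by (simp add: ac_simps)
    qed
    also have "\<dots> = (4 * exp 1 * real n * A) ^ n" by (simp add: power_mult_distrib ac_simps)
    also have "\<dots> \<le> l ^ n" using l A by (intro power_mono) auto
    finally show ?thesis .
  qed
  then have R1: "1 \<le> R" unfolding R_def using G e0 by (simp add: field_simps)
  then obtain N where N: "0 < N" "real N ^ (n - 1) \<le> R" "R < real (Suc N) ^ (n - 1)"
    using obtain_nat_power_bracket[of R "n - 1"] n by auto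
  have dec: "M (2 * l) \<le> real n * exp (- real N)"
  proof (rule dyadic_decay_step[where D=D and \<Gamma>=\<Gamma> and A=A and G=G and \<eta>=\<eta>])
    show "real N ^ (n - 1) * G \<le> l ^ n / (2 * (4 * exp 1) ^ n)"
      using N(2) G e0 unfolding R_def by (simp only: pos_le_divide_eq)
  qed (use assms N G_def in auto)
  \<comment> \<open>Dividing by \<open>n\<close> absorbs the factor \<open>n\<close> in \<open>dec\<close>; below \<open>1\<close> the bound by \<open>exp (1 - X)\<close> is trivial.\<close>
  define X where "X = max 1 (real N / real n)"
  have X: "1 \<le> X" "real N / real n \<le> X" by (auto simp: X_def)
  show ?thesis
  proof (intro exI[of _ X] conjI allI impI X(1))
    fix m assume m: "m \<le> 1" "m \<le> M (2 * l)"
    show "m \<le> exp (1 - X)"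
    proof (cases "real N \<le> real n")
      case True
      then have "X = 1" using n by (auto simp: X_def)
      then show ?thesis using m by simp
    next
      case False
      then have XN: "X = real N / real n" using n by (auto simp: X_def)
      have "real n - 1 \<le> real N * (1 - 1 / real n)"
      proof -
        have "real n * (1 - 1 / real n) \<le> real N * (1 - 1 / real n)"
          using False n by (intro mult_right_mono) auto
        then show ?thesis using n by (simp add: algebra_simps)
      qed
      then have "real n \<le> 1 + (real N - X)" by (simp add: XN algebra_simps)
      also have "\<dots> \<le> exp (real N - X)" by simp
      also have "\<dots> \<le> exp (1 + real N - X)" by simp
      finally have "real n * exp (- real N) \<le> exp (1 + real N - X) * exp (- real N)"
        by (intro mult_right_mono) auto
      also have "\<dots> = exp (1 - X)" by (simp flip: exp_add)
      finally show ?thesis using m dec by linarith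
    qed
  next
    have "real (Suc N) \<le> 2 * real n * X"
    proof -
      have "real (Suc N) \<le> 2 * real N" using N by simp
      also have "\<dots> \<le> 2 * real n * X" using X n by (simp add: field_simps)
      finally show ?thesis .
    qed
    then have "real (Suc N) ^ (n - 1) \<le> (2 * real n * X) ^ (n - 1)" by (intro power_mono) auto
    then have "R \<le> (2 * real n) ^ (n - 1) * X ^ (n - 1)" using N by (simp add: power_mult_distrib)
    then have "l ^ n \<le> 2 * (4 * exp 1) ^ n * G * ((2 * real n) ^ (n - 1) * X ^ (n - 1))"
      unfolding R_def using G e0 by (simp add: divide_le_eq ac_simps)
    then have "4 ^ n * l ^ n \<le> 4 ^ n * (2 * (4 * exp 1) ^ n * G * ((2 * real n) ^ (n - 1) * X ^ (n - 1)))"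
      by (intro mult_left_mono) auto
    also have "\<dots> = 2 * (4 * (4 * exp 1)) ^ n * (2 * real n) ^ (n - 1) * G * X ^ (n - 1)"
      by (simp only: power_mult_distrib ac_simps)
    finally have "(4 * l) ^ n \<le> 2 * (16 * exp 1) ^ n * (2 * real n) ^ (n - 1) * G * X ^ (n - 1)"
      by (simp add: power_mult_distrib)
    then show "(4 * l) ^ n / X ^ (n - 1) \<le> 2 * (16 * exp 1) ^ n * (2 * real n) ^ (n - 1) * (\<Gamma> l (2 * l) + \<eta>)"
      using X by (simp add: divide_le_eq G_def)
  qed
qed

section \<open>Smooth bumps and product test functions\<close>

text \<open>Smoothness on the line in a recursive form that parallels \<^const>\<open>C_diff\<close>.\<close>

primrec times_diff :: "nat \<Rightarrow> (real \<Rightarrow> real) \<Rightarrow> bool" where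
  "times_diff 0 f \<longleftrightarrow> continuous_on UNIV f"
| "times_diff (Suc m) f \<longleftrightarrow> (\<exists>f'. (\<forall>t. (f has_real_derivative f' t) (at t)) \<and> times_diff m f')"

lemma times_diff_SucD: "times_diff (Suc m) f \<Longrightarrow> times_diff m f"
proof (induction m arbitrary: f)
  case 0
  then obtain f' where f: "\<forall>t. (f has_real_derivative f' t) (at t)" by auto
  then have "isCont f t" for t using DERIV_isCont by blast
  then show ?case by (simp add: continuous_at_imp_continuous_on)
next
  case (Suc m)
  then obtain f' where "\<forall>t. (f has_real_derivative f' t) (at t)" "times_diff (Suc m) f'" by auto
  then show ?case using Suc.IH by auto
qed

lemma times_diff_const: "times_diff m (\<lambda>_. c)"
proof (induction m arbitrary: c)
  case (Suc m)
  show ?case using Suc[of 0] by (auto intro!: exI[of _ "\<lambda>_. 0"])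
qed simp

lemma times_diff_add: "times_diff m f \<Longrightarrow> times_diff m g \<Longrightarrow> times_diff m (\<lambda>t. f t + g t)"
proof (induction m arbitrary: f g)
  case (Suc m)
  then obtain f' g' where "\<forall>t. (f has_real_derivative f' t) (at t)" "times_diff m f'"
    "\<forall>t. (g has_real_derivative g' t) (at t)" "times_diff m g'" by auto
  then show ?case using Suc.IH[of f' g'] by (auto intro!: exI[of _ "\<lambda>t. f' t + g' t"] derivative_intros)
qed (auto intro: continuous_intros)

lemma times_diff_mult: "times_diff m f \<Longrightarrow> times_diff m g \<Longrightarrow> times_diff m (\<lambda>t. f t * g t)"
proof (induction m arbitrary: f g)
  case (Suc m)
  obtain f' where f: "\<And>t. (f has_real_derivative f' t) (at t)" "times_diff m f'" using Suc.prems by auto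
  obtain g' where g: "\<And>t. (g has_real_derivative g' t) (at t)" "times_diff m g'" using Suc.prems by auto
  have "times_diff m (\<lambda>t. f' t * g t + g' t * f t)"
    using f g Suc times_diff_SucD by (intro times_diff_add Suc.IH) blast+
  moreover have "((\<lambda>t. f t * g t) has_real_derivative f' t * g t + g' t * f t) (at t)" for t
    using f(1) g(1) by (rule DERIV_mult)
  ultimately show ?case by (auto intro!: exI[of _ "\<lambda>t. f' t * g t + g' t * f t"])
qed (auto intro: continuous_intros)

lemma times_diff_affine: "times_diff m f \<Longrightarrow> times_diff m (\<lambda>t. f (c * t + d))"
proof (induction m arbitrary: f)
  case 0
  then show ?case by (auto intro!: continuous_on_compose2[of UNIV f] continuous_intros)
next
  case (Suc m)
  obtain f' where f: "\<And>t. (f has_real_derivative f' t) (at t)" "times_diff m f'" using Suc.prems by auto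
  have "((\<lambda>t. f (c * t + d)) has_real_derivative f' (c * t + d) * c) (at t)" for t
    by (rule DERIV_chain2[OF f(1)]) (auto intro!: derivative_eq_intros)
  moreover have "times_diff m (\<lambda>t. f' (c * t + d) * c)"
    by (intro times_diff_mult times_diff_const Suc.IH f)
  ultimately show ?case by (auto intro!: exI[of _ "\<lambda>t. f' (c * t + d) * c"])
qed

text \<open>The derivatives of \<open>exp (-1/t)\<close>, extended by \<open>0\<close>, are all of this form; this makes the family closed
  under differentiation, also at the origin.\<close>

definition flat_exp :: "real poly \<Rightarrow> real \<Rightarrow> real" where
  "flat_exp p t = (if 0 < t then poly p (1 / t) * exp (- (1 / t)) else 0)"

lemma poly_times_exp_minus_tendsto_0:
  fixes p :: "real poly"
  shows "((\<lambda>x. poly p x * exp (- x)) \<longlongrightarrow> 0) at_top"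
proof -
  have "((\<lambda>x. \<Sum>i\<le>degree p. coeff p i * (x ^ i / exp x)) \<longlongrightarrow> 0) at_top"
    by (intro tendsto_null_sum tendsto_mult_right_zero tendsto_power_div_exp_0)
  moreover have "(\<Sum>i\<le>degree p. coeff p i * (x ^ i / exp x)) = poly p x * exp (- x)" for x
    by (simp add: poly_altdef sum_distrib_right exp_minus divide_inverse mult.assoc)
  ultimately show ?thesis by simp
qed

lemma flat_exp_tendsto_0: "(flat_exp p \<longlongrightarrow> 0) (at 0)"
proof -
  have "(flat_exp p \<longlongrightarrow> 0) (at_right 0)"
  proof -
    have "((\<lambda>t. poly p (inverse t) * exp (- inverse t)) \<longlongrightarrow> 0) (at_right 0)"
      by (rule filterlim_compose[OF poly_times_exp_minus_tendsto_0 filterlim_inverse_at_top_right])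
    then show ?thesis
      by (rule Lim_transform_eventually) (auto simp: eventually_at_right_field flat_exp_def inverse_eq_divide intro!: exI[of _ 1])
  qed
  moreover have "(flat_exp p \<longlongrightarrow> 0) (at_left 0)"
    by (rule Lim_transform_eventually[OF tendsto_const]) (auto simp: eventually_at_left_field flat_exp_def intro!: exI[of _ "-1"])
  ultimately show ?thesis by (simp add: filterlim_split_at)
qed

lemma flat_exp_derivative:
  "(flat_exp p has_real_derivative flat_exp ([:0, 0, 1:] * (p - pderiv p)) t) (at t)"
proof -
  consider "t < 0" | "t = 0" | "0 < t" by linarith
  then show ?thesis
  proof cases
    case 1
    have "((\<lambda>_. 0) has_real_derivative 0) (at t)" by simp
    then have "(flat_exp p has_real_derivative 0) (at t)"
      by (rule has_field_derivative_transform_within[where d="-t"]) (use 1 in \<open>auto simp: flat_exp_def dist_real_def\<close>)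
    then show ?thesis using 1 by (simp add: flat_exp_def)
  next
    case 2
    have "((\<lambda>h. flat_exp (pCons 0 p) h) \<longlongrightarrow> 0) (at 0)" by (rule flat_exp_tendsto_0)
    moreover have "flat_exp (pCons 0 p) h = (flat_exp p (0 + h) - flat_exp p 0) / h" for h
      by (simp add: flat_exp_def)
    ultimately have "(flat_exp p has_real_derivative 0) (at 0)" unfolding DERIV_def by simp
    then show ?thesis using 2 by (simp add: flat_exp_def)
  next
    case 3
    have "((\<lambda>t. poly p (1 / t) * exp (- (1 / t))) has_real_derivative
       poly (pderiv p) (1 / t) * (- (1 / t\<^sup>2)) * exp (- (1 / t)) + poly p (1 / t) * (exp (- (1 / t)) * (1 / t\<^sup>2))) (at t)"
      using 3 by (auto intro!: derivative_eq_intros DERIV_chain2[OF poly_DERIV] simp: power2_eq_square field_simps)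
    then have "(flat_exp p has_real_derivative
       poly (pderiv p) (1 / t) * (- (1 / t\<^sup>2)) * exp (- (1 / t)) + poly p (1 / t) * (exp (- (1 / t)) * (1 / t\<^sup>2))) (at t)"
      by (rule has_field_derivative_transform_within[where d=t]) (use 3 in \<open>auto simp: flat_exp_def dist_real_def\<close>)
    then show ?thesis using 3 by (auto simp: flat_exp_def power2_eq_square field_simps elim!: back_subst[of "\<lambda>c. (_ has_real_derivative c) _"])
  qed
qed

lemma times_diff_flat_exp: "times_diff m (flat_exp p)"
proof (induction m arbitrary: p)
  case 0
  show ?case
    using DERIV_isCont[OF flat_exp_derivative] by (auto intro!: continuous_at_imp_continuous_on)
next
  case (Suc m)
  then show ?case using flat_exp_derivative by auto
qed

text \<open>Smooth, positive exactly on \<open>]p,q[\<close>, with values in \<open>[0,1]\<close>, and close to \<open>1\<close> for large \<open>j\<close>.\<close>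

definition bump :: "nat \<Rightarrow> real \<Rightarrow> real \<Rightarrow> real \<Rightarrow> real" where
  "bump j p q t = flat_exp 1 (real (Suc j) * (t - p)) * flat_exp 1 (real (Suc j) * (q - t))"

lemma bump_range: "0 \<le> bump j p q t" "bump j p q t \<le> 1"
proof -
  have "0 \<le> flat_exp 1 t" "flat_exp 1 t \<le> 1" for t by (auto simp: flat_exp_def)
  then show "0 \<le> bump j p q t" "bump j p q t \<le> 1" by (auto simp: bump_def intro!: mult_le_one)
qed

lemma bump_outside: "\<not> (p < t \<and> t < q) \<Longrightarrow> bump j p q t = 0"
  by (auto simp: bump_def flat_exp_def zero_less_mult_iff)

lemma bump_inside: "p < t \<Longrightarrow> t < q \<Longrightarrow> 0 < bump j p q t"
  by (auto simp: bump_def flat_exp_def)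

lemma times_diff_bump: "times_diff m (bump j p q)"
proof -
  have "times_diff m (\<lambda>t. flat_exp 1 (real (Suc j) * t + - real (Suc j) * p) * flat_exp 1 ((- real (Suc j)) * t + real (Suc j) * q))"
    by (intro times_diff_mult times_diff_affine times_diff_flat_exp)
  then show ?thesis by (simp add: bump_def[abs_def] algebra_simps)
qed

lemma flat_exp_tendsto_1:
  assumes "filterlim x at_top F"
  shows "((\<lambda>j. flat_exp 1 (x j)) \<longlongrightarrow> 1) F"
proof -
  have "((\<lambda>j. exp (- inverse (x j))) \<longlongrightarrow> exp (- 0)) F"
    by (intro tendsto_intros filterlim_compose[OF tendsto_inverse_0_at_top[OF filterlim_ident] assms])
  moreover have "\<forall>\<^sub>F j in F. exp (- inverse (x j)) = flat_exp 1 (x j)"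
    using filterlim_at_top_dense[THEN iffD1, OF assms, rule_format, of 0]
    by eventually_elim (simp add: flat_exp_def inverse_eq_divide)
  ultimately show ?thesis by (simp add: Lim_transform_eventually)
qed

text \<open>The supports are closed subintervals of the open interval, so that these functions are admissible
  as factors of test functions even if \<open>]p,q[\<close> reaches the end points of \<open>I\<close>.\<close>

lemma bump_tendsto_indicator:
  assumes "p < q"
  shows "(\<lambda>j. bump j (p + (q - p) / (real j + 3)) (q - (q - p) / (real j + 3)) t) \<longlonglongrightarrow> indicator {p<..<q} t"
proof (cases "t \<in> {p<..<q}")
  case False
  have "(q - p) / (real j + 3) > 0" for j using assms by simp
  then have "bump j (p + (q - p) / (real j + 3)) (q - (q - p) / (real j + 3)) t = 0" for j
    using False by (intro bump_outside) (smt (verit) greaterThanLessThan_iff)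
  then show ?thesis using False by simp
next
  case True
  have lim: "filterlim (\<lambda>j. real (Suc j) * (d - (q - p) / (real j + 3))) at_top sequentially" if "0 < d" for d
  proof -
    have "filterlim (\<lambda>j. real j + 3) at_top sequentially"
      by (rule filterlim_at_top_mono[OF filterlim_real_sequentially]) auto
    then have "(\<lambda>j. d - (q - p) / (real j + 3)) \<longlonglongrightarrow> d - 0"
      by (intro tendsto_intros real_tendsto_divide_at_top[OF tendsto_const])
    then have 1: "(\<lambda>j. d - (q - p) / (real j + 3)) \<longlonglongrightarrow> d" by simp
    have 2: "filterlim (\<lambda>j. real (Suc j)) at_top sequentially"
      by (rule filterlim_compose[OF filterlim_real_sequentially filterlim_Suc])
    show ?thesis
      using filterlim_tendsto_pos_mult_at_top[OF 1 that 2] by (simp only: mult.commute)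
  qed
  have "(\<lambda>j. flat_exp 1 (real (Suc j) * ((t - p) - (q - p) / (real j + 3)))
      * flat_exp 1 (real (Suc j) * ((q - t) - (q - p) / (real j + 3)))) \<longlonglongrightarrow> 1 * 1"
    using True by (intro tendsto_mult flat_exp_tendsto_1 lim) auto
  then show ?thesis using True by (simp add: bump_def diff_diff_eq algebra_simps)
qed

definition smooth :: "(real \<Rightarrow> real) \<Rightarrow> bool" where
  "smooth f \<longleftrightarrow> (\<forall>m. times_diff m f)"

lemma smooth_bump: "smooth (bump j p q)"
  by (simp add: smooth_def times_diff_bump)

lemma smooth_continuous: "smooth f \<Longrightarrow> continuous_on UNIV f"
  unfolding smooth_def by (metis times_diff.simps(1))

lemma smooth_linear: "smooth f \<Longrightarrow> smooth g \<Longrightarrow> smooth (\<lambda>t. f t - c * g t)"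
  unfolding smooth_def
proof
  fix m assume "\<forall>m. times_diff m f" "\<forall>m. times_diff m g"
  then have "times_diff m (\<lambda>t. f t + (- c) * g t)"
    by (intro times_diff_add times_diff_mult times_diff_const) auto
  then show "times_diff m (\<lambda>t. f t - c * g t)" by simp
qed

lemma smooth_antiderivative:
  assumes \<rho>: "smooth \<rho>" and "p \<le> q" and out: "\<And>t. t \<notin> {p..q} \<Longrightarrow> \<rho> t = 0"
    and int: "(LINT t|lborel. \<rho> t * indicator {p..q} t) = 0"
  obtains F where "\<And>t. (F has_real_derivative \<rho> t) (at t)" "smooth F" "\<And>t. t \<notin> {p..q} \<Longrightarrow> F t = 0"
proof -
  have cont: "isCont \<rho> t" for t
    using smooth_continuous[OF \<rho>] by (simp add: continuous_on_eq_continuous_at)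
  obtain G where G: "\<And>t. (G has_real_derivative \<rho> t) (at t)"
    using einterval_antiderivative[of "-\<infinity>" \<infinity> \<rho>] cont
    by (auto simp: has_real_derivative_iff_has_vector_derivative)
  define F where "F t = G t - G p" for t
  have F: "(F has_real_derivative \<rho> t) (at t)" for t
    unfolding F_def using G by (auto intro!: derivative_eq_intros)
  have left: "F t = 0" if "t < p" for t
  proof -
    obtain z where "t < z" "z < p" "F p - F t = (p - t) * \<rho> z"
      using MVT2[OF \<open>t < p\<close>, of F \<rho>] F by metis
    then show ?thesis using out[of z] by (simp add: F_def)
  qed
  have "F q - F p = 0"
    using integral_FTC_Icc_real[OF \<open>p \<le> q\<close>, of F \<rho>] F cont int by simp
  then have Fq: "F q = 0" by (simp add: F_def)
  have right: "F t = 0" if "q < t" for t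
  proof -
    obtain z where "q < z" "z < t" "F t - F q = (t - q) * \<rho> z"
      using MVT2[OF \<open>q < t\<close>, of F \<rho>] F by metis
    then show ?thesis using out[of z] Fq by simp
  qed
  have "times_diff m F" for m
  proof (cases m)
    case 0
    then show ?thesis using DERIV_isCont[OF F] by (auto intro!: continuous_at_imp_continuous_on)
  next
    case (Suc m')
    then show ?thesis using F \<rho> by (auto simp: smooth_def)
  qed
  then show thesis using that[of F] F left right by (auto simp: smooth_def not_le)
qed

lemma partial_deriv_prod:
  fixes x :: "real^'n::finite"
  assumes "\<And>i. (g i has_real_derivative g' i) (at (x $ i))"
  shows "(\<lambda>x. \<Prod>i\<in>UNIV. g i (x $ i)) differentiable (at x)"
    and "partial_deriv k (\<lambda>x. \<Prod>i\<in>UNIV. g i (x $ i)) x = g' k * (\<Prod>i\<in>UNIV - {k}. g i (x $ i))"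
proof -
  have "((\<lambda>x. g i (x $ i)) has_derivative (\<lambda>y. g' i * (y $ i))) (at x)" for i
    using has_derivative_compose[OF bounded_linear.has_derivative[OF bounded_linear_vec_nth has_derivative_ident]
      assms[of i, unfolded has_field_derivative_def]] by (simp add: o_def)
  then have D: "((\<lambda>x. \<Prod>i\<in>UNIV. g i (x $ i)) has_derivative
      (\<lambda>y. \<Sum>i\<in>UNIV. (g' i * (y $ i)) * (\<Prod>j\<in>UNIV - {i}. g j (x $ j)))) (at x)"
    by (intro has_derivative_prod) auto
  then show "(\<lambda>x. \<Prod>i\<in>UNIV. g i (x $ i)) differentiable (at x)" by (rule differentiableI)
  have "partial_deriv k (\<lambda>x. \<Prod>i\<in>UNIV. g i (x $ i)) x
     = (\<Sum>i\<in>UNIV. (g' i * (axis k 1 $ i)) * (\<Prod>j\<in>UNIV - {i}. g j (x $ j)))"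
    unfolding partial_deriv_def by (simp add: frechet_derivative_at[OF D, symmetric])
  also have "\<dots> = (\<Sum>i\<in>UNIV. if i = k then g' i * (\<Prod>j\<in>UNIV - {i}. g j (x $ j)) else 0)"
    by (intro sum.cong) (auto simp: axis_def)
  finally show "partial_deriv k (\<lambda>x. \<Prod>i\<in>UNIV. g i (x $ i)) x = g' k * (\<Prod>i\<in>UNIV - {k}. g i (x $ i))"
    by simp
qed

text \<open>A partial derivative of a product of functions of one coordinate each is a product of the same
  kind, with one factor replaced by its derivative.\<close>

lemma C_diff_prod:
  fixes g :: "'n::finite \<Rightarrow> real \<Rightarrow> real"
  assumes "\<And>i. times_diff m (g i)"
  shows "C_diff m (\<lambda>x. \<Prod>i\<in>UNIV. g i (x $ i))"
  using assms
proof (induction m arbitrary: g)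
  case 0
  have "continuous_on UNIV (\<lambda>x::real^'n. g i (x $ i))" for i
    using 0[of i] by (intro continuous_on_compose2[OF _ linear_continuous_on[OF bounded_linear_vec_nth], of UNIV "g i"]) auto
  then show ?case by (simp add: continuous_on_prod)
next
  case (Suc m)
  then have "\<forall>i. \<exists>g'. (\<forall>t. (g i has_real_derivative g' t) (at t)) \<and> times_diff m g'" by auto
  then obtain g' where g': "\<And>i t. (g i has_real_derivative g' i t) (at t)" "\<And>i. times_diff m (g' i)" by metis
  have "partial_deriv k (\<lambda>x. \<Prod>i\<in>UNIV. g i (x $ i)) = (\<lambda>x. \<Prod>i\<in>UNIV. (g(k := g' k)) i (x $ i))" for k
  proof
    fix x :: "real^'n"
    have "(\<Prod>i\<in>UNIV. (g(k := g' k)) i (x $ i)) = g' k (x $ k) * (\<Prod>i\<in>UNIV - {k}. g i (x $ i))"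
      by (subst prod.remove[of _ k]) auto
    then show "partial_deriv k (\<lambda>x. \<Prod>i\<in>UNIV. g i (x $ i)) x = (\<Prod>i\<in>UNIV. (g(k := g' k)) i (x $ i))"
      using partial_deriv_prod(2)[of g "\<lambda>i. g' i (x $ i)" x k] g'(1) by simp
  qed
  moreover have "C_diff m (\<lambda>x. \<Prod>i\<in>UNIV. (g(k := g' k)) i (x $ i))" for k
    by (rule Suc.IH) (use Suc.prems g'(2) times_diff_SucD in auto)
  moreover have "(\<lambda>x. \<Prod>i\<in>UNIV. g i (x $ i)) differentiable (at x)" for x
    by (rule partial_deriv_prod(1)[of g "\<lambda>i. g' i (x $ i)"]) (rule g'(1))
  ultimately show ?case by simp
qed

lemma test_function_prod:
  fixes g :: "'n::finite \<Rightarrow> real \<Rightarrow> real"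
  assumes "\<And>i. smooth (g i)" and out: "\<And>i t. t \<notin> {p $ i..q $ i} \<Longrightarrow> g i t = 0" and sub: "cbox p q \<subseteq> \<Omega>"
  shows "test_function \<Omega> (\<lambda>x. \<Prod>i\<in>UNIV. g i (x $ i))"
proof -
  let ?\<phi> = "\<lambda>x. \<Prod>i\<in>UNIV. g i (x $ i)"
  have "{x. ?\<phi> x \<noteq> 0} \<subseteq> cbox p q"
  proof
    fix x assume "x \<in> {x. ?\<phi> x \<noteq> 0}"
    then have "g i (x $ i) \<noteq> 0" for i by auto
    then have "x $ i \<in> {p $ i..q $ i}" for i using out by blast
    then show "x \<in> cbox p q" by (auto simp: mem_box_cart)
  qed
  then have c: "closure {x. ?\<phi> x \<noteq> 0} \<subseteq> cbox p q" by (intro closure_minimal) (auto intro: closed_cbox)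
  then have "bounded (closure {x. ?\<phi> x \<noteq> 0})" using bounded_cbox bounded_subset by blast
  then have "compact (closure {x. ?\<phi> x \<noteq> 0})" by (simp add: compact_eq_bounded_closed)
  then show ?thesis using c sub assms(1) C_diff_prod unfolding test_function_def smooth_def by blast
qed

lemma smooth_compact_support_bounded:
  assumes F: "smooth F" and out: "\<And>t. t \<notin> {p..q} \<Longrightarrow> F t = 0"
  obtains C where "\<And>t. \<bar>F t\<bar> \<le> C"
proof -
  have "continuous_on {p..q} F" by (rule continuous_on_subset[OF smooth_continuous[OF F]]) simp
  then have "bounded (F ` {p..q})" by (intro compact_imp_bounded compact_continuous_image compact_Icc)
  then obtain C where C: "\<And>t. t \<in> {p..q} \<Longrightarrow> \<bar>F t\<bar> \<le> C" unfolding bounded_iff by force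
  have "\<bar>F t\<bar> \<le> max C 0" for t using C[of t] out[of t] by (cases "t \<in> {p..q}") auto
  then show thesis using that by blast
qed

section \<open>Measurability and integrability up to null sets\<close>

lemma integrable_bounded_mult:
  fixes X g :: "'a \<Rightarrow> real"
  assumes X: "integrable M X" and g[measurable]: "g \<in> borel_measurable M" and b: "\<And>x. \<bar>g x\<bar> \<le> C"
  shows "integrable M (\<lambda>x. g x * X x)"
proof (rule Bochner_Integration.integrable_bound)
  show "integrable M (\<lambda>x. C * X x)" using X by simp
  have "0 \<le> C" using b[of undefined] by linarith
  then show "AE x in M. norm (g x * X x) \<le> norm (C * X x)"
    using b by (auto simp: abs_mult intro!: AE_I2 mult_right_mono)
  show "(\<lambda>x. g x * X x) \<in> borel_measurable M" using X by auto
qed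

lemma integrable_of_power:
  fixes U :: "'a \<Rightarrow> real"
  assumes "prob_space M" and U[measurable]: "U \<in> borel_measurable M" and fin: "(\<integral>\<^sup>+x. ennreal (\<bar>U x\<bar> ^ n) \<partial>M) < \<infinity>" and n: "n > 0"
  shows "integrable M U"
  unfolding integrable_iff_bounded
proof
  interpret prob_space M by fact
  have "(\<integral>\<^sup>+x. ennreal (norm (U x)) \<partial>M) \<le> (\<integral>\<^sup>+x. 1 + ennreal (\<bar>U x\<bar> ^ n) \<partial>M)"
  proof (intro nn_integral_mono)
    fix x
    have "norm (U x) \<le> 1 + \<bar>U x\<bar> ^ n"
    proof (cases "\<bar>U x\<bar> \<le> 1")
      case False
      then show ?thesis using self_le_power[of "\<bar>U x\<bar>" n] n by simp
    qed (simp add: add_increasing2)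
    then have "ennreal (norm (U x)) \<le> ennreal (1 + \<bar>U x\<bar> ^ n)" by (rule ennreal_leI)
    then show "ennreal (norm (U x)) \<le> 1 + ennreal (\<bar>U x\<bar> ^ n)" by (simp flip: ennreal_1)
  qed
  also have "\<dots> < \<infinity>" using fin by (simp add: nn_integral_add emeasure_space_1)
  finally show "(\<integral>\<^sup>+x. ennreal (norm (U x)) \<partial>M) < \<infinity>" .
qed (rule U)

lemma sum_indicator_Ioc:
  fixes t :: "nat \<Rightarrow> real"
  assumes "mono t"
  shows "(\<Sum>i<N. indicator {t i<..t (Suc i)} x :: real) = indicator {t 0<..t N} x"
proof (induction N)
  case (Suc N)
  have "t 0 \<le> t N" "t N \<le> t (Suc N)" using assms by (auto simp: mono_def)
  then show ?case using Suc by (auto split: split_indicator)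
qed simp

lemma AE_lebesgue_on_iff:
  assumes "S \<in> sets borel"
  shows "(AE x in lebesgue_on S. Q x) \<longleftrightarrow> (AE x in lborel. x \<in> S \<longrightarrow> Q x)"
  using assms by (subst AE_restrict_space_iff) (auto simp: AE_completion_iff)

lemma complete_measure_lebesgue_on:
  assumes "S \<in> sets lebesgue"
  shows "complete_measure (lebesgue_on S)"
proof
  fix A B assume "B \<subseteq> A" "A \<in> null_sets (lebesgue_on S)"
  then have "B \<subseteq> S" "B \<in> null_sets lebesgue"
    using assms null_sets_completion_subset by (auto simp: null_sets_restrict_space)
  then show "B \<in> sets (lebesgue_on S)"
    using assms by (auto simp: sets_restrict_space_iff)
qed

lemma measurable_lebesgue_on_AE_eq:
  fixes f g :: "'a::euclidean_space \<Rightarrow> real"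
  assumes S: "S \<in> sets borel" and g: "g \<in> borel_measurable borel" and eq: "AE x in lborel. x \<in> S \<longrightarrow> f x = g x"
  shows "f \<in> borel_measurable (lebesgue_on S)"
proof -
  have S': "S \<in> sets lebesgue" using S by auto
  interpret complete_measure "lebesgue_on S" by (rule complete_measure_lebesgue_on[OF S'])
  show ?thesis
  proof (rule measurableI)
    fix A :: "real set" assume A: "A \<in> sets borel"
    have "g \<in> borel_measurable (lebesgue_on S)"
      using g by (intro measurable_restrict_space1) (simp add: measurable_completion)
    then have gA: "g -` A \<inter> space (lebesgue_on S) \<in> sets (lebesgue_on S)"
      using A by (rule measurable_sets)
    show "f -` A \<inter> space (lebesgue_on S) \<in> sets (lebesgue_on S)"
    proof (rule in_sets_AE[OF _ gA])
      have "AE x in lebesgue_on S. f x = g x" using eq by (simp add: AE_lebesgue_on_iff[OF S])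
      then show "AE x in lebesgue_on S. x \<in> g -` A \<inter> space (lebesgue_on S) \<longleftrightarrow> x \<in> f -` A \<inter> space (lebesgue_on S)"
        by eventually_elim auto
    qed auto
  qed simp
qed

lemma borel_representative:
  fixes f :: "'a::euclidean_space \<Rightarrow> real"
  assumes S: "S \<in> sets borel" and f: "f \<in> borel_measurable (lebesgue_on S)"
  obtains g where "g \<in> borel_measurable borel" "AE x in lborel. x \<in> S \<longrightarrow> f x = g x"
proof -
  have "(\<lambda>x. indicator S x *\<^sub>R f x) \<in> borel_measurable (completion lborel)"
    using S f by (subst (asm) borel_measurable_restrict_space_iff) auto
  from completion_ex_borel_measurable_real[OF this]
  obtain g where "g \<in> borel_measurable lborel" "AE x in lborel. indicator S x *\<^sub>R f x = g x" by blast
  moreover from this(2) have "AE x in lborel. x \<in> S \<longrightarrow> f x = g x" by eventually_elim auto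
  ultimately show thesis using that by simp
qed

lemma locally_integrable_measurable:
  fixes g :: "real^'n::finite \<Rightarrow> 'b::euclidean_space"
  assumes g: "locally_integrable \<Omega> g" and \<Omega>: "open \<Omega>"
  shows "(\<lambda>x. indicator \<Omega> x *\<^sub>R g x) \<in> borel_measurable lebesgue"
proof -
  obtain C :: "nat \<Rightarrow> (real^'n) set" where C: "\<And>n. compact (C n)" "\<And>n. C n \<subseteq> \<Omega>"
    "\<And>n. C n \<subseteq> interior (C (Suc n))" "\<Union> (range C) = \<Omega>"
    using open_Union_compact_subsets[OF \<Omega>] by metis
  have mono: "C m \<subseteq> C n" if "m \<le> n" for m n
    by (rule lift_Suc_mono_le[OF _ that]) (use C(3) interior_subset in blast)
  have "(\<lambda>x. indicator (C n) x *\<^sub>R g x) \<in> borel_measurable lebesgue" for n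
  proof -
    have "g absolutely_integrable_on C n" using g C by (simp add: locally_integrable_def)
    then show ?thesis unfolding set_integrable_def by (rule borel_measurable_integrable)
  qed
  then show ?thesis
  proof (rule borel_measurable_LIMSEQ_metric)
    fix x
    show "(\<lambda>n. indicator (C n) x *\<^sub>R g x) \<longlonglongrightarrow> indicator \<Omega> x *\<^sub>R g x"
    proof (cases "x \<in> \<Omega>")
      case True
      then obtain m where "x \<in> C m" using C(4) by auto
      then have "\<forall>\<^sub>F n in sequentially. x \<in> C n"
        using mono by (auto simp: eventually_sequentially intro!: exI[of _ m])
      then have "\<forall>\<^sub>F n in sequentially. indicator (C n) x *\<^sub>R g x = indicator \<Omega> x *\<^sub>R g x"
        by eventually_elim (simp add: True)
      then show ?thesis by (rule tendsto_eventually)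
    next
      case False
      then have "x \<notin> C n" for n using C(2) by auto
      then show ?thesis using False by simp
    qed
  qed
qed

section \<open>Euclidean space as a product of lines\<close>

lemma measurable_vec_lambda:
  fixes f :: "'a \<Rightarrow> 'n::finite \<Rightarrow> real"
  assumes "\<And>i. (\<lambda>x. f x i) \<in> borel_measurable M"
  shows "(\<lambda>x. \<chi> i. f x i) \<in> borel_measurable M"
proof -
  have "(\<lambda>x. (\<chi> i. f x i) \<bullet> b) \<in> borel_measurable M" if b: "b \<in> Basis" for b :: "real^'n"
  proof -
    obtain i where "b = axis i 1" using b by (auto simp: Basis_vec_def)
    then show ?thesis using assms[of i] by (simp add: inner_axis)
  qed
  then show ?thesis by (subst borel_measurable_euclidean_space) auto
qed

lemma prod_Basis_vec:
  fixes f :: "real^'n \<Rightarrow> 'b::comm_monoid_mult"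
  shows "(\<Prod>b\<in>Basis. f b) = (\<Prod>i\<in>(UNIV::'n set). f (axis i 1))"
proof -
  have B: "(Basis :: (real^'n) set) = (\<lambda>i. axis i 1) ` (UNIV :: 'n set)" by (auto simp: Basis_vec_def)
  have "inj (\<lambda>i::'n. axis i (1::real))" by (auto intro!: injI simp: axis_eq_axis)
  then show ?thesis unfolding B by (simp add: prod.reindex o_def)
qed

lemma product_sigma_finite_lborel: "product_sigma_finite (\<lambda>_::'n. lborel :: real measure)"
  by unfold_locales

lemma measurable_vec_lambda_lborel:
  "vec_lambda \<in> measurable (PiM UNIV (\<lambda>_::'n::finite. lborel)) (borel :: (real^'n) measure)"
  by (rule measurable_vec_lambda[where f="\<lambda>x. x", simplified]) measurable

lemma distr_vec_lambda_lborel: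
  "distr (PiM UNIV (\<lambda>_::'n::finite. lborel)) borel vec_lambda = (lborel :: (real^'n) measure)"
proof (rule lborel_eqI[symmetric])
  interpret product_sigma_finite "\<lambda>_::'n. lborel :: real measure" by (rule product_sigma_finite_lborel)
  note m = measurable_vec_lambda_lborel[where 'n='n]
  fix l u :: "real^'n" assume le: "\<And>b. b \<in> Basis \<Longrightarrow> l \<bullet> b \<le> u \<bullet> b"
  then have le': "l $ i \<le> u $ i" for i using le[of "axis i 1"] by (auto simp: inner_axis Basis_vec_def)
  have "vec_lambda -` box l u \<inter> space (PiM UNIV (\<lambda>_::'n. lborel)) = (\<Pi>\<^sub>E i\<in>UNIV. {l $ i<..<u $ i})"
    by (auto simp: space_PiM mem_box_cart PiE_def Pi_def)
  then have "emeasure (distr (PiM UNIV (\<lambda>_::'n. lborel)) borel vec_lambda) (box l u)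
    = (\<Prod>i\<in>UNIV. emeasure lborel {l $ i<..<u $ i})"
    by (simp add: emeasure_distr[OF m] emeasure_PiM)
  also have "\<dots> = (\<Prod>i\<in>UNIV. ennreal (u $ i - l $ i))" using le' by simp
  also have "\<dots> = ennreal (\<Prod>i\<in>UNIV. u $ i - l $ i)" using le' by (simp add: prod_ennreal)
  also have "(\<Prod>i\<in>UNIV. u $ i - l $ i) = (\<Prod>b\<in>Basis. (u - l) \<bullet> b)"
    by (simp add: prod_Basis_vec inner_axis)
  finally show "emeasure (distr (PiM UNIV (\<lambda>_::'n. lborel)) borel vec_lambda) (box l u) = ennreal (\<Prod>b\<in>Basis. (u - l) \<bullet> b)"
    by simp
qed simp

section \<open>The unit cube as a product probability space\<close>

locale unit_interval =
  fixes I :: "real set"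
  assumes interval: "is_interval I" and length_1: "emeasure lborel I = 1"
begin

lemma borel_I [measurable]: "I \<in> sets borel"
  using interval real_interval_borel_measurable by blast

lemma obtain_left_end:
  obtains a where "{a<..<a+1} \<subseteq> I" "I \<subseteq> {a..a+1}"
proof -
  have sub: "\<not> {c..c+2} \<subseteq> I" for c
    using emeasure_mono[of "{c..c+2}" I lborel] length_1 by auto
  consider "I = {}" | "I = UNIV" | a where "I = {..<a}" | a where "I = {..a}" | a where "I = {a<..}" | a where "I = {a..}"
    | a b where "I = {a<..<b}" | a b where "I = {a<..b}" | a b where "I = {a..<b}" | a b where "I = {a..b}"
    using is_real_interval[OF interval] by blast
  then show thesis
  proof cases
    case 1 then show ?thesis using length_1 by simp
  next
    case 2 then show ?thesis using sub[of 0] by auto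
  next
    case (3 a) then show ?thesis using sub[of "a - 3"] by auto
  next
    case (4 a) then show ?thesis using sub[of "a - 2"] by auto
  next
    case (5 a) then show ?thesis using sub[of "a + 1"] by auto
  next
    case (6 a) then show ?thesis using sub[of "a"] by auto
  next
    case (7 a b)
    then have "b = a + 1" using length_1 by (cases "a \<le> b") auto
    then show ?thesis using 7 that[of a] by force
  next
    case (8 a b)
    then have "b = a + 1" using length_1 by (cases "a \<le> b") auto
    then show ?thesis using 8 that[of a] by force
  next
    case (9 a b)
    then have "b = a + 1" using length_1 by (cases "a \<le> b") auto
    then show ?thesis using 9 that[of a] by force
  next
    case (10 a b)
    then have "b = a + 1" using length_1 by (cases "a \<le> b") auto
    then show ?thesis using 10 that[of a] by force
  qed
qed

abbreviation "L \<equiv> restrict_space lborel I"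
abbreviation "cubeM J \<equiv> PiM J (\<lambda>_. restrict_space lborel I)"

lemma space_L [simp]: "space L = I" by (simp add: space_restrict_space)

lemma prob_L: "prob_space L"
  by (rule prob_spaceI) (simp add: emeasure_restrict_space length_1)

lemma sets_L: "sets L = sets (restrict_space borel I)"
  by (simp add: sets_restrict_space)

lemma atomless_L: "emeasure L ({s} \<inter> I) = 0"
proof -
  have "emeasure lborel ({s} \<inter> I) \<le> emeasure lborel {s}" by (intro emeasure_mono) auto
  then show ?thesis by (simp add: emeasure_restrict_space)
qed

lemma product_prob_space_L: "product_prob_space (\<lambda>_::'n. L)"
proof -
  interpret prob_space L by (rule prob_L)
  show ?thesis by unfold_locales
qed

lemma prob_cubeM: "prob_space (cubeM J)"
  by (rule prob_space_PiM) (rule prob_L)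

lemma measurable_upd:
  "(\<lambda>(y, s). y(k := s)) \<in> measurable (cubeM (UNIV - {k}) \<Otimes>\<^sub>M L) (cubeM (UNIV::'n set))"
proof -
  have *: "insert k (UNIV - {k}) = (UNIV::'n set)" by auto
  show ?thesis using measurable_add_dim[of k "UNIV - {k}" "\<lambda>_::'n. L"] unfolding * .
qed

lemma measurable_upd' [measurable]:
  assumes [measurable]: "f \<in> measurable N (cubeM (UNIV - {k}))" "g \<in> measurable N L"
  shows "(\<lambda>x. (f x)(k := g x)) \<in> measurable N (cubeM (UNIV::'n set))"
  using measurable_compose[OF measurable_Pair[OF assms] measurable_upd] by simp

lemma measurable_upd_section:
  assumes "y \<in> space (cubeM (UNIV - {k}))"
  shows "(\<lambda>s. y(k := s)) \<in> measurable L (cubeM (UNIV::'n set))"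
  using assms by (intro measurable_upd') auto

lemma nn_integral_split:
  fixes f :: "('n::finite \<Rightarrow> real) \<Rightarrow> ennreal"
  assumes "f \<in> borel_measurable (cubeM UNIV)"
  shows "(\<integral>\<^sup>+x. f x \<partial>cubeM UNIV) = (\<integral>\<^sup>+y. (\<integral>\<^sup>+s. f (y(k := s)) \<partial>L) \<partial>cubeM (UNIV - {k}))"
proof -
  interpret product_prob_space "\<lambda>_::'n. L" UNIV by (rule product_prob_space_L)
  have *: "insert k (UNIV - {k}) = (UNIV::'n set)" by auto
  show ?thesis
    using product_nn_integral_insert[of "UNIV - {k}" k f] assms unfolding * by simp
qed

lemma distr_upd:
  "distr (cubeM (UNIV - {k}) \<Otimes>\<^sub>M L) (cubeM UNIV) (\<lambda>(y, s). y(k := s)) = cubeM (UNIV::'n::finite set)"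
proof (rule measure_eqI)
  interpret prob_space L by (rule prob_L)
  fix A :: "('n \<Rightarrow> real) set"
  assume "A \<in> sets (distr (cubeM (UNIV - {k}) \<Otimes>\<^sub>M L) (cubeM UNIV) (\<lambda>(y, s). y(k := s)))"
  then have A[measurable]: "A \<in> sets (cubeM UNIV)" by simp
  note measurable_upd[measurable]
  have "emeasure (distr (cubeM (UNIV - {k}) \<Otimes>\<^sub>M L) (cubeM UNIV) (\<lambda>(y, s). y(k := s))) A
    = (\<integral>\<^sup>+z. indicator A ((\<lambda>(y, s). y(k := s)) z) \<partial>(cubeM (UNIV - {k}) \<Otimes>\<^sub>M L))"
    by (simp add: nn_integral_distr flip: nn_integral_indicator)
  also have "\<dots> = (\<integral>\<^sup>+y. (\<integral>\<^sup>+s. indicator A (y(k := s)) \<partial>L) \<partial>cubeM (UNIV - {k}))"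
    by (subst nn_integral_fst[symmetric]) (simp_all del: fun_upd_apply)
  also have "\<dots> = emeasure (cubeM UNIV) A"
    using nn_integral_split[of "indicator A" k] by simp
  finally show "emeasure (distr (cubeM (UNIV - {k}) \<Otimes>\<^sub>M L) (cubeM UNIV) (\<lambda>(y, s). y(k := s))) A
    = emeasure (cubeM UNIV) A" .
qed simp

lemma pair_sigma_finite_cube: "pair_sigma_finite (cubeM J) L"
proof -
  interpret prob_space L by (rule prob_L)
  interpret P: prob_space "cubeM J" by (rule prob_cubeM)
  show ?thesis by unfold_locales
qed

lemma AE_split:
  fixes k :: "'n::finite"
  assumes "AE x in cubeM UNIV. Q x"
  shows "AE y in cubeM (UNIV - {k}). AE s in L. Q (y(k := s))"
proof -
  interpret pair_sigma_finite "cubeM (UNIV - {k})" L by (rule pair_sigma_finite_cube)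
  have "AE z in cubeM (UNIV - {k}) \<Otimes>\<^sub>M L. Q ((\<lambda>(y, s). y(k := s)) z)"
    by (rule AE_distrD[OF measurable_upd]) (simp only: distr_upd assms)
  from AE_pair[OF this] show ?thesis by simp
qed

lemma AE_unsplit:
  fixes k :: "'n::finite"
  assumes Q: "{x \<in> space (cubeM UNIV). Q x} \<in> sets (cubeM UNIV)"
    and ae: "AE y in cubeM (UNIV - {k}). AE s in L. Q (y(k := s))"
  shows "AE x in cubeM UNIV. Q x"
proof -
  interpret pair_sigma_finite "cubeM (UNIV - {k})" L by (rule pair_sigma_finite_cube)
  note Q[measurable]
  have "AE z in cubeM (UNIV - {k}) \<Otimes>\<^sub>M L. Q ((\<lambda>(y, s). y(k := s)) z)"
  proof (rule AE_pair_measure)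
    show "{z \<in> space (cubeM (UNIV - {k}) \<Otimes>\<^sub>M L). Q ((\<lambda>(y, s). y(k := s)) z)} \<in> sets (cubeM (UNIV - {k}) \<Otimes>\<^sub>M L)"
    proof -
      have "{z \<in> space (cubeM (UNIV - {k}) \<Otimes>\<^sub>M L). Q ((\<lambda>(y, s). y(k := s)) z)}
        = (\<lambda>(y, s). y(k := s)) -` {x \<in> space (cubeM UNIV). Q x} \<inter> space (cubeM (UNIV - {k}) \<Otimes>\<^sub>M L)"
        using measurable_space[OF measurable_upd, of _ k] by auto
      then show ?thesis using measurable_sets[OF measurable_upd Q, of k] by simp
    qed
    show "AE x in cubeM (UNIV - {k}). AE y in L. Q ((\<lambda>(y, s). y(k := s)) (x, y))" using ae by simp
  qed
  then have "AE x in distr (cubeM (UNIV - {k}) \<Otimes>\<^sub>M L) (cubeM UNIV) (\<lambda>(y, s). y(k := s)). Q x"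
    by (subst AE_distr_iff[OF measurable_upd Q])
  then show ?thesis by (simp only: distr_upd)
qed

text \<open>The lines of direction \<open>k\<close> that meet \<open>{\<bar>U\<bar> > \<theta>}\<close> in a set of positive length. This is the set
  where the essential supremum of \<open>\<bar>U\<bar>\<close> over the line exceeds \<open>\<theta>\<close>.\<close>

definition wide :: "'n \<Rightarrow> (('n \<Rightarrow> real) \<Rightarrow> real) \<Rightarrow> real \<Rightarrow> ('n \<Rightarrow> real) set" where
  "wide k U \<theta> = {y \<in> space (cubeM (UNIV - {k})). 0 < (\<integral>\<^sup>+s. indicator {\<theta><..} \<bar>U (y(k := s))\<bar> \<partial>L)}"

lemma wide_measurable [measurable]:
  assumes [measurable]: "U \<in> borel_measurable (cubeM (UNIV::'n set))"
  shows "wide k U \<theta> \<in> sets (cubeM (UNIV - {k}))"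
proof -
  interpret prob_space L by (rule prob_L)
  have "(\<lambda>(y, s). indicator {\<theta><..} \<bar>U (y(k := s))\<bar> :: ennreal) \<in> borel_measurable (cubeM (UNIV - {k}) \<Otimes>\<^sub>M L)"
    by measurable
  then show ?thesis unfolding wide_def by measurable
qed

lemma AE_in_wide:
  fixes U :: "('n::finite \<Rightarrow> real) \<Rightarrow> real"
  assumes [measurable]: "U \<in> borel_measurable (cubeM UNIV)"
  shows "AE x in cubeM UNIV. \<theta> < \<bar>U x\<bar> \<longrightarrow> restrict x (UNIV - {k}) \<in> wide k U \<theta>"
proof (rule AE_unsplit[where k=k])
  have [measurable]: "(\<lambda>x. restrict x (UNIV - {k})) \<in> measurable (cubeM UNIV) (cubeM (UNIV - {k}))"
    by (rule measurable_restrict_subset) auto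
  have w: "wide k U \<theta> \<in> sets (cubeM (UNIV - {k}))" by measurable
  show "{x \<in> space (cubeM UNIV). \<theta> < \<bar>U x\<bar> \<longrightarrow> restrict x (UNIV - {k}) \<in> wide k U \<theta>} \<in> sets (cubeM UNIV)"
    using w by measurable
  show "AE y in cubeM (UNIV - {k}). AE s in L. \<theta> < \<bar>U (y(k := s))\<bar> \<longrightarrow> restrict (y(k := s)) (UNIV - {k}) \<in> wide k U \<theta>"
  proof (rule AE_I2)
    fix y assume y: "y \<in> space (cubeM (UNIV - {k}))"
    have r: "restrict (y(k := s)) (UNIV - {k}) = y" for s
      using y by (auto simp: space_PiM PiE_def extensional_def fun_eq_iff)
    have [measurable]: "(\<lambda>s. U (y(k := s))) \<in> borel_measurable L"
      using measurable_compose[OF measurable_upd_section[OF y] assms] .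
    show "AE s in L. \<theta> < \<bar>U (y(k := s))\<bar> \<longrightarrow> restrict (y(k := s)) (UNIV - {k}) \<in> wide k U \<theta>"
    proof (cases "y \<in> wide k U \<theta>")
      case False
      then have "(\<integral>\<^sup>+s. indicator {\<theta><..} \<bar>U (y(k := s))\<bar> \<partial>L) = 0"
        using y unfolding wide_def by (simp add: not_less del: fun_upd_apply)
      then have "AE s in L. (indicator {\<theta><..} \<bar>U (y(k := s))\<bar> :: ennreal) = 0"
        by (subst (asm) nn_integral_0_iff_AE) (simp_all del: fun_upd_apply)
      then show ?thesis by eventually_elim (simp del: fun_upd_apply split: split_indicator_asm)
    qed (simp add: r del: fun_upd_apply)
  qed
qed

lemma measurable_vec_lambda_cubeM [measurable]:
  "vec_lambda \<in> measurable (cubeM (UNIV::'n::finite set)) (borel :: (real^'n) measure)"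
proof (rule measurable_vec_lambda[where f="\<lambda>x. x", simplified])
  fix i :: 'n
  have "(\<lambda>x. x i) \<in> measurable (cubeM UNIV) L" by measurable
  then show "(\<lambda>x. x i) \<in> borel_measurable (cubeM UNIV)"
    by (rule measurable_compose) (simp add: measurable_restrict_space1)
qed

lemma measurable_coord:
  "(\<lambda>x. x i) \<in> borel_measurable (cubeM (UNIV::'n set))"
proof -
  have "(\<lambda>x. x i) \<in> measurable (cubeM UNIV) L" by measurable
  then show "(\<lambda>x. x i) \<in> borel_measurable (cubeM UNIV)"
    by (rule measurable_compose) (simp add: measurable_restrict_space1)
qed

lemma measurable_vec_nth_cubeM:
  "vec_nth \<in> measurable (restrict_space borel (cube I :: (real^'n::finite) set)) (cubeM UNIV)"
proof (rule measurable_PiM_single'[where f="\<lambda>i x. x $ i", simplified])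
  fix i :: 'n
  have "(\<lambda>x::real^'n. x $ i) \<in> borel_measurable borel" by measurable
  then show "(\<lambda>x. x $ i) \<in> restrict_space borel (cube I) \<rightarrow>\<^sub>M L"
    by (intro measurable_restrict_space2 measurable_restrict_space1)
       (auto simp: cube_def space_restrict_space)
qed (auto simp: cube_def space_restrict_space)

lemma cube_measurable [measurable]: "cube I \<in> sets (borel :: (real^'n::finite) measure)"
proof -
  have "cube I = (\<Inter>i. (\<lambda>x::real^'n. x $ i) -` I \<inter> space borel)" by (auto simp: cube_def)
  also have "\<dots> \<in> sets borel" by (intro sets.countable_INT'' measurable_sets[OF _ borel_I]) measurable
  finally show ?thesis .
qed

lemma vec_lambda_in_cube: "f \<in> space (cubeM UNIV) \<Longrightarrow> vec_lambda f \<in> cube I"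
  by (auto simp: cube_def space_PiM PiE_def Pi_def)

text \<open>Borel functions on the cube in \<open>real^'n\<close> become functions on the product space; the passage is by
  uniqueness of measures on boxes.\<close>

lemma distr_cubeM:
  "distr (cubeM UNIV) borel vec_lambda = density lborel (indicator (cube I :: (real^'n::finite) set))"
proof (rule measure_eqI_generator_eq)
  interpret product_sigma_finite "\<lambda>_::'n. lborel :: real measure" by (rule product_sigma_finite_lborel)
  interpret L: product_prob_space "\<lambda>_::'n. L" UNIV by (rule product_prob_space_L)
  interpret P: prob_space "cubeM (UNIV::'n set)" by (rule prob_cubeM)
  note m = measurable_vec_lambda_lborel[where 'n='n]
  let ?E = "range (\<lambda>(a, b). box a b::(real^'n) set)"
  show "Int_stable ?E"
    by (auto simp: Int_stable_def box_Int_box)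
  show "?E \<subseteq> Pow UNIV" "sets (distr (cubeM UNIV) borel vec_lambda) = sigma_sets UNIV ?E"
    "sets (density lborel (indicator (cube I :: (real^'n::finite) set))) = sigma_sets UNIV ?E"
    by (simp_all add: borel_eq_box)
  let ?A = "\<lambda>n::nat. box (- (real n *\<^sub>R One)) (real n *\<^sub>R One) :: (real^'n) set"
  show "range ?A \<subseteq> ?E" "(\<Union>i. ?A i) = UNIV"
    unfolding UN_box_eq_UNIV by auto
  show "emeasure (distr (cubeM UNIV) borel vec_lambda) (?A i) \<noteq> \<infinity>" for i
    by (simp add: emeasure_distr)
  fix X assume "X \<in> ?E"
  then obtain l u where X: "X = box l u" by auto
  have "vec_lambda -` X \<inter> space (cubeM UNIV) = (\<Pi>\<^sub>E i\<in>UNIV. {l $ i<..<u $ i} \<inter> I)"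
    unfolding X by (auto simp: space_PiM mem_box_cart PiE_def Pi_def)
  then have 1: "emeasure (distr (cubeM UNIV) borel vec_lambda) X = (\<Prod>i\<in>UNIV. emeasure L ({l $ i<..<u $ i} \<inter> I))"
  proof -
    have "emeasure (cubeM UNIV) (\<Pi>\<^sub>E i\<in>UNIV. {l $ i<..<u $ i} \<inter> I) = (\<Prod>i\<in>UNIV. emeasure L ({l $ i<..<u $ i} \<inter> I))"
      by (rule L.emeasure_PiM) (auto simp: sets_restrict_space)
    then show ?thesis using X \<open>vec_lambda -` X \<inter> _ = _\<close> by (simp add: emeasure_distr)
  qed
  have "emeasure (density lborel (indicator (cube I))) X = emeasure lborel (X \<inter> cube I)"
    using X by (simp add: emeasure_density ac_simps flip: indicator_inter_arith)
  also have "\<dots> = emeasure (distr (PiM UNIV (\<lambda>_::'n::finite. lborel)) borel vec_lambda) (X \<inter> cube I)"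
    by (simp add: distr_vec_lambda_lborel)
  also have "\<dots> = emeasure (PiM UNIV (\<lambda>_::'n. lborel)) (\<Pi>\<^sub>E i\<in>UNIV. {l $ i<..<u $ i} \<inter> I)"
  proof -
    have "vec_lambda -` (X \<inter> cube I) \<inter> space (PiM UNIV (\<lambda>_::'n. lborel)) = (\<Pi>\<^sub>E i\<in>UNIV. {l $ i<..<u $ i} \<inter> I)"
      unfolding X by (auto simp: space_PiM mem_box_cart cube_def PiE_def Pi_def)
    moreover have "X \<inter> cube I \<in> sets borel" unfolding X by (intro sets.Int cube_measurable) auto
    ultimately show ?thesis by (simp add: emeasure_distr[OF m])
  qed
  also have "\<dots> = (\<Prod>i\<in>UNIV. emeasure lborel ({l $ i<..<u $ i} \<inter> I))"
    by (rule emeasure_PiM) auto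
  also have "\<dots> = (\<Prod>i\<in>UNIV. emeasure L ({l $ i<..<u $ i} \<inter> I))"
    by (simp add: emeasure_restrict_space)
  finally show "emeasure (distr (cubeM UNIV) borel vec_lambda) X = emeasure (density lborel (indicator (cube I))) X"
    using 1 by simp
qed

lemma nn_integral_cubeM:
  fixes F :: "real^'n::finite \<Rightarrow> ennreal"
  assumes "F \<in> borel_measurable borel"
  shows "(\<integral>\<^sup>+x. F (vec_lambda x) \<partial>cubeM UNIV) = (\<integral>\<^sup>+x. F x * indicator (cube I) x \<partial>lborel)"
proof -
  have "(\<integral>\<^sup>+x. F (vec_lambda x) \<partial>cubeM UNIV) = (\<integral>\<^sup>+x. F x \<partial>distr (cubeM UNIV) borel vec_lambda)"
    using assms by (simp add: nn_integral_distr)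
  also have "\<dots> = (\<integral>\<^sup>+x. F x * indicator (cube I) x \<partial>lborel)"
    using assms by (simp add: distr_cubeM nn_integral_density mult.commute)
  finally show ?thesis .
qed

lemma AE_cubeM:
  fixes Q :: "real^'n::finite \<Rightarrow> bool"
  assumes "AE x in lborel. x \<in> cube I \<longrightarrow> Q x"
  shows "AE f in cubeM UNIV. Q (vec_lambda f)"
proof -
  have "AE x in density lborel (indicator (cube I)). Q x"
    using assms by (subst AE_density) (auto elim!: eventually_mono split: split_indicator_asm)
  then have "AE x in distr (cubeM UNIV) borel vec_lambda. Q x" by (simp only: distr_cubeM)
  then show ?thesis by (rule AE_distrD[OF measurable_vec_lambda_cubeM])
qed

lemma integral_cubeM:
  fixes F :: "real^'n::finite \<Rightarrow> real"
  assumes [measurable]: "F \<in> borel_measurable borel"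
  shows "(LINT f|cubeM UNIV. F (vec_lambda f)) = (LINT x|lborel. indicator (cube I) x * F x)"
proof -
  have "(LINT f|cubeM UNIV. F (vec_lambda f)) = (LINT x|distr (cubeM UNIV) borel vec_lambda. F x)"
    by (simp add: integral_distr)
  also have "\<dots> = (LINT x|density lborel (\<lambda>x. ennreal (indicator (cube I) x)). F x)"
    by (simp add: distr_cubeM ennreal_indicator)
  also have "\<dots> = (LINT x|lborel. indicator (cube I) x * F x)"
    by (subst integral_density) auto
  finally show ?thesis .
qed

lemma integrable_upd:
  fixes f :: "('n::finite \<Rightarrow> real) \<Rightarrow> real"
  assumes "integrable (cubeM UNIV) f"
  shows "integrable (cubeM (UNIV - {k}) \<Otimes>\<^sub>M L) (\<lambda>(y, s). f (y(k := s)))"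
proof -
  have "integrable (distr (cubeM (UNIV - {k}) \<Otimes>\<^sub>M L) (cubeM UNIV) (\<lambda>(y, s). y(k := s))) f"
    by (simp only: distr_upd assms)
  from integrable_distr[OF measurable_upd this] show ?thesis by (simp add: case_prod_beta')
qed

lemma AE_integrable_section:
  fixes f :: "('n::finite \<Rightarrow> real) \<Rightarrow> real"
  assumes "integrable (cubeM UNIV) f"
  shows "AE y in cubeM (UNIV - {k}). integrable L (\<lambda>s. f (y(k := s)))"
proof -
  interpret pair_sigma_finite "cubeM (UNIV - {k})" L by (rule pair_sigma_finite_cube)
  from AE_integrable_fst'[OF integrable_upd[OF assms]] show ?thesis by simp
qed

lemma integral_split:
  fixes f :: "('n::finite \<Rightarrow> real) \<Rightarrow> real"
  assumes "integrable (cubeM UNIV) f"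
  shows "(LINT x|cubeM UNIV. f x) = (LINT y|cubeM (UNIV - {k}). LINT s|L. f (y(k := s)))"
proof -
  interpret product_prob_space "\<lambda>_::'n. L" UNIV by (rule product_prob_space_L)
  have *: "insert k (UNIV - {k}) = (UNIV::'n set)" by auto
  show ?thesis
    using product_integral_insert[of "UNIV - {k}" k f] assms unfolding * by simp
qed

lemma measurable_upd_full [measurable]:
  assumes "f \<in> measurable N (cubeM (UNIV::'n set))" "g \<in> measurable N L"
  shows "(\<lambda>x. (f x)(k := g x)) \<in> measurable N (cubeM (UNIV::'n set))"
  using assms by (intro measurable_fun_upd[where J=UNIV]) auto

text \<open>Two operators of this form occur: the primitive along the lines of direction \<open>k\<close>, with kernel
  \<open>w s \<sigma> = indicator {..<s} \<sigma>\<close>, and the weighted mean over these lines, with a kernel that depends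
  on \<open>\<sigma>\<close> only. The second statement moves the operator to the test function.\<close>

lemma section_kernel:
  fixes H :: "('n::finite \<Rightarrow> real) \<Rightarrow> real" and w :: "real \<Rightarrow> real \<Rightarrow> real" and k :: 'n
  assumes H: "integrable (cubeM UNIV) H"
    and w[measurable]: "(\<lambda>(s, \<sigma>). w s \<sigma>) \<in> borel_measurable (L \<Otimes>\<^sub>M L)" and wC: "\<And>s \<sigma>. \<bar>w s \<sigma>\<bar> \<le> C"
  defines "K \<equiv> \<lambda>f. LINT \<sigma>|L. w (f k) \<sigma> * H (f(k := \<sigma>))"
  shows section_kernel_integrable: "integrable (cubeM UNIV) K"
    and section_kernel_Fubini: "\<And>\<alpha> \<theta> C1 C2. \<alpha> \<in> borel_measurable (cubeM UNIV) \<Longrightarrow> (\<And>f s. \<alpha> (f(k := s)) = \<alpha> f) \<Longrightarrow>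
       (\<And>f. \<bar>\<alpha> f\<bar> \<le> C1) \<Longrightarrow> \<theta> \<in> borel_measurable L \<Longrightarrow> (\<And>s. \<bar>\<theta> s\<bar> \<le> C2) \<Longrightarrow>
       (LINT f|cubeM UNIV. \<alpha> f * \<theta> (f k) * K f)
       = (LINT f|cubeM UNIV. \<alpha> f * (LINT s|L. \<theta> s * w s (f k)) * H f)"
proof -
  interpret L: prob_space L by (rule prob_L)
  interpret P: prob_space "cubeM (UNIV::'n set)" by (rule prob_cubeM)
  interpret LL: pair_prob_space L L by unfold_locales
  have Hm[measurable]: "H \<in> borel_measurable (cubeM UNIV)" using H by auto
  have C0: "0 \<le> C" using wC[of 0 0] by linarith
  have wm: "(\<lambda>x. w (f x) (g x)) \<in> borel_measurable N" if "f \<in> measurable N L" "g \<in> measurable N L" for f g N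
    using measurable_compose[OF measurable_Pair[OF that] w] by simp
  have Km[measurable]: "K \<in> borel_measurable (cubeM UNIV)"
    unfolding K_def
    by (intro L.borel_measurable_lebesgue_integral) (unfold split_beta', intro borel_measurable_times wm, measurable)
  show intK: "integrable (cubeM UNIV) K"
    unfolding integrable_iff_bounded
  proof
    have "(\<integral>\<^sup>+f. ennreal (norm (K f)) \<partial>cubeM UNIV)
      \<le> (\<integral>\<^sup>+f. (\<integral>\<^sup>+\<sigma>. ennreal C * ennreal \<bar>H (f(k := \<sigma>))\<bar> \<partial>L) \<partial>cubeM UNIV)"
    proof (rule nn_integral_mono)
      fix f assume f: "f \<in> space (cubeM (UNIV::'n set))"
      show "ennreal (norm (K f)) \<le> (\<integral>\<^sup>+\<sigma>. ennreal C * ennreal \<bar>H (f(k := \<sigma>))\<bar> \<partial>L)"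
      proof (cases "integrable L (\<lambda>\<sigma>. w (f k) \<sigma> * H (f(k := \<sigma>)))")
        case True
        have "ennreal (norm (K f)) \<le> (\<integral>\<^sup>+\<sigma>. ennreal (norm (w (f k) \<sigma> * H (f(k := \<sigma>)))) \<partial>L)"
          unfolding K_def by (rule integral_norm_bound_ennreal[OF True])
        also have "\<dots> \<le> (\<integral>\<^sup>+\<sigma>. ennreal C * ennreal \<bar>H (f(k := \<sigma>))\<bar> \<partial>L)"
          using wC C0 by (intro nn_integral_mono)
            (auto simp: abs_mult ennreal_mult[symmetric] simp del: fun_upd_apply intro!: ennreal_leI mult_right_mono)
        finally show ?thesis .
      next
        case False
        then have "K f = 0" unfolding K_def by (rule not_integrable_integral_eq)
        then show ?thesis by simp
      qed
    qed
    also have "\<dots> = (\<integral>\<^sup>+y. (\<integral>\<^sup>+s. (\<integral>\<^sup>+\<sigma>. ennreal C * ennreal \<bar>H (y(k := s, k := \<sigma>))\<bar> \<partial>L) \<partial>L) \<partial>cubeM (UNIV - {k}))"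
      by (rule nn_integral_split) measurable
    also have "\<dots> = (\<integral>\<^sup>+y. (\<integral>\<^sup>+\<sigma>. ennreal C * ennreal \<bar>H (y(k := \<sigma>))\<bar> \<partial>L) \<partial>cubeM (UNIV - {k}))"
      using length_1 by (simp add: emeasure_restrict_space del: fun_upd_apply)
    also have "\<dots> = (\<integral>\<^sup>+f. ennreal C * ennreal \<bar>H f\<bar> \<partial>cubeM UNIV)"
      by (rule nn_integral_split[symmetric]) measurable
    also have "\<dots> < \<infinity>"
      using H unfolding integrable_iff_bounded by (simp add: nn_integral_cmult ennreal_mult_less_top)
    finally show "(\<integral>\<^sup>+f. ennreal (norm (K f)) \<partial>cubeM UNIV) < \<infinity>" .
  qed measurable
  fix \<alpha> :: "('n \<Rightarrow> real) \<Rightarrow> real" and \<theta> :: "real \<Rightarrow> real" and C1 C2 :: real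
  assume \<alpha>[measurable]: "\<alpha> \<in> borel_measurable (cubeM UNIV)" and \<alpha>k: "\<And>f s. \<alpha> (f(k := s)) = \<alpha> f" and \<alpha>C: "\<And>f. \<bar>\<alpha> f\<bar> \<le> C1"
    and \<theta>[measurable]: "\<theta> \<in> borel_measurable L" and \<theta>C: "\<And>s. \<bar>\<theta> s\<bar> \<le> C2"
  have C1: "0 \<le> C1" "0 \<le> C2" using \<alpha>C[of undefined] \<theta>C[of 0] by linarith+
  define T where "T \<sigma> = (LINT s|L. \<theta> s * w s \<sigma>)" for \<sigma>
  have Tm[measurable]: "T \<in> borel_measurable L" unfolding T_def
    by (intro L.borel_measurable_lebesgue_integral) (unfold split_beta', intro borel_measurable_times wm, measurable)
  have TC: "\<bar>T \<sigma>\<bar> \<le> C2 * C" for \<sigma>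
  proof (cases "integrable L (\<lambda>s. \<theta> s * w s \<sigma>)")
    case True
    have "\<bar>T \<sigma>\<bar> \<le> (LINT s|L. \<bar>\<theta> s * w s \<sigma>\<bar>)" unfolding T_def by (rule integral_abs_bound)
    also have "\<dots> \<le> (LINT s|L. C2 * C)"
      using C0 C1 \<theta>C wC
      by (intro Bochner_Integration.integral_mono integrable_abs True) (auto simp: abs_mult intro!: mult_mono)
    finally show ?thesis by (simp add: L.prob_space[simplified])
  next
    case False
    then show ?thesis unfolding T_def using C0 C1 by (simp add: not_integrable_integral_eq)
  qed
  have coordL: "(\<lambda>f. f k) \<in> measurable (cubeM (UNIV::'n set)) L" by measurable
  note [measurable] = measurable_compose[OF coordL \<theta>] measurable_compose[OF coordL Tm]
  have secm: "(\<lambda>y. LINT s|L. f (y(k := s))) \<in> borel_measurable (cubeM (UNIV - {k}))"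
    if [measurable]: "f \<in> borel_measurable (cubeM UNIV)" for f :: "('n \<Rightarrow> real) \<Rightarrow> real"
    by (intro L.borel_measurable_lebesgue_integral) measurable
  have int1: "integrable (cubeM UNIV) (\<lambda>f. \<alpha> f * \<theta> (f k) * K f)"
  proof (rule Bochner_Integration.integrable_bound)
    show "integrable (cubeM UNIV) (\<lambda>f. C1 * C2 * K f)" using intK by simp
    show "AE f in cubeM UNIV. norm (\<alpha> f * \<theta> (f k) * K f) \<le> norm (C1 * C2 * K f)"
      using \<alpha>C \<theta>C C1 by (auto simp: abs_mult intro!: AE_I2 mult_mono mult_right_mono)
  qed measurable
  have int2: "integrable (cubeM UNIV) (\<lambda>f. \<alpha> f * T (f k) * H f)"
  proof (rule Bochner_Integration.integrable_bound)
    show "integrable (cubeM UNIV) (\<lambda>f. C1 * (C2 * C) * H f)" using H by simp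
    show "AE f in cubeM UNIV. norm (\<alpha> f * T (f k) * H f) \<le> norm (C1 * (C2 * C) * H f)"
      using \<alpha>C TC C1 C0 by (auto simp: abs_mult intro!: AE_I2 mult_mono mult_right_mono)
  qed measurable
  have "(LINT f|cubeM UNIV. \<alpha> f * \<theta> (f k) * K f)
      = (LINT y|cubeM (UNIV - {k}). LINT s|L. \<alpha> (y(k := s)) * \<theta> ((y(k := s)) k) * K (y(k := s)))"
    by (rule integral_split[OF int1])
  also have "\<dots> = (LINT y|cubeM (UNIV - {k}). LINT s|L. \<alpha> (y(k := s)) * T ((y(k := s)) k) * H (y(k := s)))"
  proof (rule integral_cong_AE)
    show "AE y in cubeM (UNIV - {k}). (LINT s|L. \<alpha> (y(k := s)) * \<theta> ((y(k := s)) k) * K (y(k := s)))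
      = (LINT s|L. \<alpha> (y(k := s)) * T ((y(k := s)) k) * H (y(k := s)))"
      using AE_integrable_section[OF H, of k] AE_space
    proof eventually_elim
      case (elim y)
      define h where "h \<sigma> = H (y(k := \<sigma>))" for \<sigma>
      have h: "integrable L h" using elim by (simp add: h_def[abs_def])
      then have [measurable]: "h \<in> borel_measurable L" by auto
      have Ky: "K (y(k := s)) = (LINT \<sigma>|L. w s \<sigma> * h \<sigma>)" for s by (simp add: K_def h_def)
      have hh: "integrable (L \<Otimes>\<^sub>M L) (\<lambda>(s, \<sigma>). h \<sigma>)"
        unfolding integrable_iff_bounded
      proof
        have "(\<integral>\<^sup>+z. ennreal (norm (case z of (s, \<sigma>) \<Rightarrow> h \<sigma>)) \<partial>(L \<Otimes>\<^sub>M L))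
          = (\<integral>\<^sup>+s. (\<integral>\<^sup>+\<sigma>. ennreal (norm (h \<sigma>)) \<partial>L) \<partial>L)"
          by (subst L.nn_integral_fst[symmetric]) auto
        also have "\<dots> < \<infinity>" using h unfolding integrable_iff_bounded by (simp add: L.emeasure_space_1[simplified])
        finally show "(\<integral>\<^sup>+z. ennreal (norm (case z of (s, \<sigma>) \<Rightarrow> h \<sigma>)) \<partial>(L \<Otimes>\<^sub>M L)) < \<infinity>" .
      qed measurable
      have wf: "(\<lambda>z. w (fst z) (snd z)) \<in> borel_measurable (L \<Otimes>\<^sub>M L)" by (intro wm) measurable
      have int: "integrable (L \<Otimes>\<^sub>M L) (\<lambda>(s, \<sigma>). \<theta> s * w s \<sigma> * h \<sigma>)"
      proof (rule Bochner_Integration.integrable_bound)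
        show "integrable (L \<Otimes>\<^sub>M L) (\<lambda>z. C2 * C * (case z of (s, \<sigma>) \<Rightarrow> h \<sigma>))" using hh by simp
        show "AE z in L \<Otimes>\<^sub>M L. norm (case z of (s, \<sigma>) \<Rightarrow> \<theta> s * w s \<sigma> * h \<sigma>) \<le> norm (C2 * C * (case z of (s, \<sigma>) \<Rightarrow> h \<sigma>))"
          using \<theta>C wC C1 C0 by (auto simp: abs_mult intro!: AE_I2 mult_mono mult_right_mono)
        show "(\<lambda>(s, \<sigma>). \<theta> s * w s \<sigma> * h \<sigma>) \<in> borel_measurable (L \<Otimes>\<^sub>M L)"
          unfolding split_beta' using wf by measurable
      qed
      have "(LINT s|L. \<alpha> (y(k := s)) * \<theta> ((y(k := s)) k) * K (y(k := s)))
        = \<alpha> y * (LINT s|L. LINT \<sigma>|L. \<theta> s * w s \<sigma> * h \<sigma>)"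
        by (simp add: \<alpha>k Ky mult.assoc)
      also have "(LINT s|L. LINT \<sigma>|L. \<theta> s * w s \<sigma> * h \<sigma>) = (LINT \<sigma>|L. LINT s|L. \<theta> s * w s \<sigma> * h \<sigma>)"
        using LL.Fubini_integral[OF int] by simp
      also have "\<dots> = (LINT \<sigma>|L. T \<sigma> * h \<sigma>)" by (simp add: T_def)
      also have "\<alpha> y * \<dots> = (LINT s|L. \<alpha> (y(k := s)) * T ((y(k := s)) k) * H (y(k := s)))"
        by (simp add: \<alpha>k h_def[symmetric] mult.assoc)
      finally show ?case .
    qed
    show "(\<lambda>y. LINT s|L. \<alpha> (y(k := s)) * \<theta> ((y(k := s)) k) * K (y(k := s))) \<in> borel_measurable (cubeM (UNIV - {k}))"
      by (rule secm) measurable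
    show "(\<lambda>y. LINT s|L. \<alpha> (y(k := s)) * T ((y(k := s)) k) * H (y(k := s))) \<in> borel_measurable (cubeM (UNIV - {k}))"
      by (rule secm) measurable
  qed
  also have "\<dots> = (LINT f|cubeM UNIV. \<alpha> f * T (f k) * H f)"
    by (rule integral_split[OF int2, symmetric])
  finally show "(LINT f|cubeM UNIV. \<alpha> f * \<theta> (f k) * K f) = (LINT f|cubeM UNIV. \<alpha> f * (LINT s|L. \<theta> s * w s (f k)) * H f)"
    by (simp add: T_def)
qed

section \<open>Lines on which a function is large\<close>

text \<open>The absolutely continuous representative that a Sobolev function has on almost every line; the
  representative may depend on the direction \<open>k\<close>.\<close>

definition primitive_along :: "'n \<Rightarrow> (('n \<Rightarrow> real) \<Rightarrow> real) \<Rightarrow> (('n \<Rightarrow> real) \<Rightarrow> real) \<Rightarrow> bool" where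
  "primitive_along k U h \<longleftrightarrow> (AE y in cubeM (UNIV - {k}). integrable L (\<lambda>s. h (y(k := s))) \<and>
     (\<exists>c. AE s in L. U (y(k := s)) = c + (LINT \<sigma>|L. indicator {..<s} \<sigma> * h (y(k := \<sigma>)))))"

text \<open>The inequality on one line, integrated over all lines of direction \<open>k\<close>.\<close>

lemma wide_step:
  fixes U h :: "('n::finite \<Rightarrow> real) \<Rightarrow> real"
  assumes [measurable]: "U \<in> borel_measurable (cubeM UNIV)" "h \<in> borel_measurable (cubeM UNIV)"
    and ac: "primitive_along k U h" and \<delta>: "0 < \<delta>"
  shows "ennreal \<delta> * emeasure (cubeM (UNIV - {k})) (wide k U (\<theta> + \<delta>))
    \<le> (\<integral>\<^sup>+x. ennreal (\<bar>h x\<bar> * indicator {\<theta><..\<theta>+\<delta>} \<bar>U x\<bar>) \<partial>cubeM UNIV)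
      + ennreal \<delta> * emeasure (cubeM UNIV) {x \<in> space (cubeM UNIV). \<theta> < \<bar>U x\<bar>}"
proof -
  interpret prob_space L by (rule prob_L)
  have w: "wide k U (\<theta> + \<delta>) \<in> sets (cubeM (UNIV - {k}))" by measurable
  let ?f = "\<lambda>y. \<integral>\<^sup>+s. ennreal (\<bar>h (y(k := s))\<bar> * indicator {\<theta><..\<theta>+\<delta>} \<bar>U (y(k := s))\<bar>) \<partial>L"
  let ?g = "\<lambda>y. \<integral>\<^sup>+s. indicator {\<theta><..} \<bar>U (y(k := s))\<bar> \<partial>L"
  have fm: "?f \<in> borel_measurable (cubeM (UNIV - {k}))" "?g \<in> borel_measurable (cubeM (UNIV - {k}))"
    by measurable
  have "ennreal \<delta> * emeasure (cubeM (UNIV - {k})) (wide k U (\<theta> + \<delta>))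
    = (\<integral>\<^sup>+y. ennreal \<delta> * indicator (wide k U (\<theta> + \<delta>)) y \<partial>cubeM (UNIV - {k}))"
    using w by (simp add: nn_integral_cmult)
  also have "\<dots> \<le> (\<integral>\<^sup>+y. ?f y + ennreal \<delta> * ?g y \<partial>cubeM (UNIV - {k}))"
  proof (rule nn_integral_mono_AE)
    from ac[unfolded primitive_along_def] AE_space
    show "AE y in cubeM (UNIV - {k}). ennreal \<delta> * indicator (wide k U (\<theta> + \<delta>)) y \<le> ?f y + ennreal \<delta> * ?g y"
    proof eventually_elim
      case (elim y)
      then obtain c where c: "AE s in L. U (y(k := s)) = c + (LINT \<sigma>|L. indicator {..<s} \<sigma> * h (y(k := \<sigma>)))"
        and int: "integrable L (\<lambda>s. h (y(k := s)))" by blast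
      have um: "(\<lambda>s. U (y(k := s))) \<in> borel_measurable L"
        using measurable_compose[OF measurable_upd_section[OF elim(2)] assms(1)] .
      show ?case
      proof (cases "y \<in> wide k U (\<theta> + \<delta>)")
        case True
        have "(\<integral>\<^sup>+s. indicator {\<theta>+\<delta><..} \<bar>U (y(k := s))\<bar> \<partial>L) = emeasure L {s\<in>I. \<theta> + \<delta> < \<bar>U (y(k := s))\<bar>}"
        proof -
          have "{s\<in>space L. \<theta> + \<delta> < \<bar>U (y(k := s))\<bar>} \<in> sets L" using um by measurable
          then have s: "{s\<in>I. \<theta> + \<delta> < \<bar>U (y(k := s))\<bar>} \<in> sets L" by simp
          show ?thesis unfolding nn_integral_indicator[OF s, symmetric]
            by (intro nn_integral_cong) (simp add: indicator_def del: fun_upd_apply)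
        qed
        with True have pos: "0 < emeasure L {s\<in>I. \<theta> + \<delta> < \<bar>U (y(k := s))\<bar>}"
          unfolding wide_def by (simp del: fun_upd_apply)
        have "emeasure L I = 1" using emeasure_space_1 by simp
        from slab_integral_lower_bound[OF sets_L interval atomless_L this um int c \<delta> pos]
        show ?thesis using True by simp
      qed simp
    qed
  qed
  also have "\<dots> = (\<integral>\<^sup>+y. ?f y \<partial>cubeM (UNIV - {k})) + ennreal \<delta> * (\<integral>\<^sup>+y. ?g y \<partial>cubeM (UNIV - {k}))"
    using fm by (simp add: nn_integral_add nn_integral_cmult del: fun_upd_apply)
  also have "(\<integral>\<^sup>+y. ?f y \<partial>cubeM (UNIV - {k})) = (\<integral>\<^sup>+x. ennreal (\<bar>h x\<bar> * indicator {\<theta><..\<theta>+\<delta>} \<bar>U x\<bar>) \<partial>cubeM UNIV)"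
    by (rule nn_integral_split[symmetric]) measurable
  also have "(\<integral>\<^sup>+y. ?g y \<partial>cubeM (UNIV - {k})) = (\<integral>\<^sup>+x. indicator {\<theta><..} \<bar>U x\<bar> \<partial>cubeM UNIV)"
    by (rule nn_integral_split[symmetric]) measurable
  also have "\<dots> = emeasure (cubeM UNIV) {x \<in> space (cubeM UNIV). \<theta> < \<bar>U x\<bar>}"
  proof -
    have s: "{x \<in> space (cubeM UNIV). \<theta> < \<bar>U x\<bar>} \<in> sets (cubeM UNIV)" by measurable
    show ?thesis unfolding nn_integral_indicator[OF s, symmetric]
      by (intro nn_integral_cong) (simp add: indicator_def)
  qed
  finally show ?thesis .
qed

text \<open>Almost every point of the level set lies on a wide line in each of the directions, so this is the
  Loomis--Whitney inequality.\<close>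

lemma level_set_le_wide:
  fixes U :: "('n::finite \<Rightarrow> real) \<Rightarrow> real"
  assumes [measurable]: "U \<in> borel_measurable (cubeM UNIV)" and n: "CARD('n) \<ge> 2"
  shows "measure (cubeM UNIV) {x \<in> space (cubeM UNIV). \<theta> < \<bar>U x\<bar>} ^ (CARD('n) - 1)
     \<le> (\<Sum>k\<in>UNIV. measure (cubeM (UNIV - {k})) (wide k U \<theta>)) ^ CARD('n)"
proof -
  interpret product_prob_space "\<lambda>_::'n. L" UNIV by (rule product_prob_space_L)
  interpret C: prob_space "cubeM (UNIV::'n set)" by (rule prob_cubeM)
  let ?E = "{x \<in> space (cubeM (UNIV::'n set)). \<theta> < \<bar>U x\<bar>}"
  \<comment> \<open>The projections are controlled at every point only after removal of a null set.\<close>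
  define E where "E = {x \<in> space (cubeM (UNIV::'n set)). \<theta> < \<bar>U x\<bar> \<and> (\<forall>k. restrict x (UNIV - {k}) \<in> wide k U \<theta>)}"
  have [measurable]: "(\<lambda>x. restrict x (UNIV - {k})) \<in> measurable (cubeM UNIV) (cubeM (UNIV - {k}))" for k :: 'n
    by (rule measurable_restrict_subset) auto
  have w: "wide k U \<theta> \<in> sets (cubeM (UNIV - {k}))" for k by measurable
  have E: "E \<in> sets (cubeM UNIV)" unfolding E_def using w by measurable
  have "AE x in cubeM UNIV. \<forall>k. \<theta> < \<bar>U x\<bar> \<longrightarrow> restrict x (UNIV - {k}) \<in> wide k U \<theta>"
    by (intro AE_all_countable[THEN iffD2] allI AE_in_wide) measurable
  then have "AE x in cubeM UNIV. x \<in> ?E \<longleftrightarrow> x \<in> E"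
    by eventually_elim (auto simp: E_def)
  then have eq: "measure (cubeM UNIV) ?E = measure (cubeM UNIV) E"
    using E by (intro measure_eq_AE) auto
  show ?thesis
  proof (cases "E = {}")
    case True
    then show ?thesis using eq n by (simp add: power_0_left sum_nonneg)
  next
    case False
    have "measure (cubeM UNIV) E ^ (card (UNIV::'n set) - 1)
      \<le> (\<Sum>k\<in>UNIV. measure (cubeM (UNIV - {k})) (wide k U \<theta>)) ^ card (UNIV::'n set)"
      by (rule loomis_whitney) (use E False w in \<open>auto simp: E_def\<close>)
    then show ?thesis by (simp only: eq)
  qed
qed

text \<open>The heart of the first embedding. The exponents \<open>X j\<close> are large where the gradient has a small
  integral over the slab between two dyadic levels, and these integrals add up to at most \<open>A ^ n\<close>.
  The starting level \<open>\<Lambda>\<close> has to be a large multiple of \<open>A\<close>, because on lower levels the lines on which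
  \<open>\<bar>U\<bar>\<close> is large throughout cannot be absorbed.\<close>

theorem wide_decay:
  fixes U :: "('n::finite \<Rightarrow> real) \<Rightarrow> real" and h :: "'n \<Rightarrow> ('n \<Rightarrow> real) \<Rightarrow> real"
  assumes U[measurable]: "U \<in> borel_measurable (cubeM UNIV)" and h[measurable]: "\<And>k. h k \<in> borel_measurable (cubeM UNIV)"
    and n: "n = CARD('n)" "n \<ge> 2"
    and ac: "\<And>k. primitive_along k U (h k)" and A: "0 < A"
    and UA: "(\<integral>\<^sup>+x. ennreal (\<bar>U x\<bar> ^ n) \<partial>cubeM UNIV) \<le> ennreal (A ^ n)"
    and hA: "(\<integral>\<^sup>+x. ennreal ((\<Sum>k\<in>UNIV. \<bar>h k x\<bar>) ^ n) \<partial>cubeM UNIV) \<le> ennreal (A ^ n)"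
  defines "\<Lambda> \<equiv> 4 * exp 1 * real n * A"
  shows "\<exists>X. (\<forall>j. 1 \<le> X j) \<and>
     (\<forall>j k. emeasure (cubeM (UNIV - {k})) (wide k U (\<Lambda> * 2 ^ j)) \<le> ennreal (exp (1 - X j))) \<and>
     (\<Sum>j. ennreal ((\<Lambda> * 2 ^ Suc j) ^ n / X j ^ (n - 1)))
       \<le> ennreal (((8 * exp 1 * real n) ^ n + 6 * (16 * exp 1) ^ n * (2 * real n) ^ (n - 1)) * A ^ n)"
proof -
  let ?P = "cubeM (UNIV::'n set)"
  interpret C: prob_space ?P by (rule prob_cubeM)
  interpret Ck: prob_space "cubeM (UNIV - {k})" for k :: 'n by (rule prob_cubeM)
  define H where "H x = (\<Sum>k\<in>UNIV. \<bar>h k x\<bar>)" for x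
  have [measurable]: "H \<in> borel_measurable ?P" unfolding H_def by measurable
  have H0: "0 \<le> H x" and hH: "\<bar>h k x\<bar> \<le> H x" for k x
    unfolding H_def by (auto intro: sum_nonneg member_le_sum)
  have intHn: "integrable ?P (\<lambda>x. H x ^ n)"
    using hA H0 by (intro integrableI_nonneg) (auto simp: H_def order_le_less_trans)
  have HA: "(LINT x|?P. H x ^ n) \<le> A ^ n"
    using hA A nn_integral_eq_integral[OF intHn] H0 by (simp add: H_def Bochner_Integration.integral_nonneg)
  have Hle: "H x \<le> 1 + H x ^ n" for x
  proof (cases "H x \<le> 1")
    case False
    then show ?thesis using self_le_power[of "H x" n] n by simp
  qed (use H0 in \<open>simp add: add_increasing2\<close>)
  have intH: "integrable ?P H"
    using H0 Hle by (intro Bochner_Integration.integrable_bound[OF Bochner_Integration.integrable_add[OF C.integrable_const[of 1] intHn]])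
      (auto simp: abs_of_nonneg add_nonneg_nonneg)
  have inth: "integrable ?P (h k)" for k
    using hH H0 by (intro Bochner_Integration.integrable_bound[OF intH]) auto
  define M where "M \<theta> = (\<Sum>k\<in>UNIV. measure (cubeM (UNIV - {k})) (wide k U \<theta>))" for \<theta>
  define D where "D \<theta> = measure ?P {x \<in> space ?P. \<theta> < \<bar>U x\<bar>}" for \<theta>
  define \<Gamma> where "\<Gamma> a b = (LINT x|?P. H x ^ n * indicator {a<..b} \<bar>U x\<bar>)" for a b
  have int\<Gamma>: "integrable ?P (\<lambda>x. H x ^ n * indicator {a<..b} \<bar>U x\<bar>)" for a b
    using H0 by (intro Bochner_Integration.integrable_bound[OF intHn]) (auto split: split_indicator)
  have \<Gamma>0: "0 \<le> \<Gamma> a b" for a b unfolding \<Gamma>_def using H0 by (intro Bochner_Integration.integral_nonneg) auto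
  have \<Gamma>A: "\<Gamma> a b \<le> A ^ n" for a b
  proof -
    have "\<Gamma> a b \<le> (LINT x|?P. H x ^ n)" unfolding \<Gamma>_def
      using H0 by (intro Bochner_Integration.integral_mono int\<Gamma> intHn) (auto split: split_indicator)
    then show ?thesis using HA by simp
  qed
  have \<Gamma>tel: "(\<Sum>i<N. \<Gamma> (t i) (t (Suc i))) = \<Gamma> (t 0) (t N)" if "mono t" for t N
    unfolding \<Gamma>_def using int\<Gamma> sum_indicator_Ioc[OF that]
    by (simp add: Bochner_Integration.integral_sum[symmetric] sum_distrib_left[symmetric])
  have LW: "D \<theta> ^ (n - 1) \<le> M \<theta> ^ n" for \<theta>
    using level_set_le_wide[OF U, of \<theta>] n by (simp add: D_def M_def)
  have markov: "D \<theta> \<le> (A / \<theta>) ^ n" if "0 < \<theta>" for \<theta>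
  proof -
    have "ennreal (\<theta> ^ n * D \<theta>) = ennreal (\<theta> ^ n) * emeasure ?P {x \<in> space ?P. \<theta> < \<bar>U x\<bar>}"
      using that by (simp add: D_def ennreal_mult C.emeasure_eq_measure)
    also have "\<dots> = (\<integral>\<^sup>+x. ennreal (\<theta> ^ n) * indicator {x \<in> space ?P. \<theta> < \<bar>U x\<bar>} x \<partial>?P)"
      by (simp add: nn_integral_cmult)
    also have "\<dots> \<le> (\<integral>\<^sup>+x. ennreal (\<bar>U x\<bar> ^ n) \<partial>?P)"
      using that by (intro nn_integral_mono) (auto split: split_indicator intro!: ennreal_leI power_mono)
    also have "\<dots> \<le> ennreal (A ^ n)" by (rule UA)
    finally have "\<theta> ^ n * D \<theta> \<le> A ^ n" using A by (subst (asm) ennreal_le_iff) auto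
    then show ?thesis using that by (simp add: power_divide field_simps)
  qed
  have step: "\<delta> * M (\<theta> + \<delta>) \<le> \<tau> * D \<theta> + \<Gamma> \<theta> (\<theta> + \<delta>) / \<tau> ^ (n - 1) + real n * \<delta> * D \<theta>"
    if \<delta>: "0 < \<delta>" and \<tau>: "0 < \<tau>" for \<theta> \<delta> \<tau>
  proof -
    let ?i = "\<lambda>x. indicator {\<theta><..\<theta>+\<delta>} \<bar>U x\<bar> :: real"
    have intk: "integrable ?P (\<lambda>x. \<bar>h k x\<bar> * ?i x)" for k
      by (intro Bochner_Integration.integrable_bound[OF inth[of k]]) (auto split: split_indicator)
    have intHi: "integrable ?P (\<lambda>x. H x * ?i x)"
      by (intro Bochner_Integration.integrable_bound[OF intH]) (auto split: split_indicator)
    have one: "\<delta> * measure (cubeM (UNIV - {k})) (wide k U (\<theta> + \<delta>)) \<le> (LINT x|?P. \<bar>h k x\<bar> * ?i x) + \<delta> * D \<theta>" for k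
    proof -
      have "ennreal (\<delta> * measure (cubeM (UNIV - {k})) (wide k U (\<theta> + \<delta>)))
        = ennreal \<delta> * emeasure (cubeM (UNIV - {k})) (wide k U (\<theta> + \<delta>))"
        using \<delta> by (simp add: ennreal_mult Ck.emeasure_eq_measure)
      also have "\<dots> \<le> (\<integral>\<^sup>+x. ennreal (\<bar>h k x\<bar> * ?i x) \<partial>?P) + ennreal \<delta> * emeasure ?P {x \<in> space ?P. \<theta> < \<bar>U x\<bar>}"
        by (rule wide_step[OF U h ac \<delta>])
      also have "(\<integral>\<^sup>+x. ennreal (\<bar>h k x\<bar> * ?i x) \<partial>?P) = ennreal (LINT x|?P. \<bar>h k x\<bar> * ?i x)"
        by (intro nn_integral_eq_integral intk) auto
      also have "ennreal \<delta> * emeasure ?P {x \<in> space ?P. \<theta> < \<bar>U x\<bar>} = ennreal (\<delta> * D \<theta>)"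
        using \<delta> by (simp add: D_def ennreal_mult C.emeasure_eq_measure)
      also have "ennreal (LINT x|?P. \<bar>h k x\<bar> * ?i x) + ennreal (\<delta> * D \<theta>) = ennreal ((LINT x|?P. \<bar>h k x\<bar> * ?i x) + \<delta> * D \<theta>)"
        using \<delta> by (intro ennreal_plus[symmetric]) (auto simp: D_def intro!: Bochner_Integration.integral_nonneg)
      finally show ?thesis
        using \<delta> by (subst (asm) ennreal_le_iff) (auto simp: D_def intro!: add_nonneg_nonneg Bochner_Integration.integral_nonneg)
    qed
    have "\<delta> * M (\<theta> + \<delta>) \<le> (\<Sum>k\<in>UNIV. (LINT x|?P. \<bar>h k x\<bar> * ?i x) + \<delta> * D \<theta>)"
      unfolding M_def sum_distrib_left by (intro sum_mono one)
    also have "\<dots> = (\<Sum>k\<in>UNIV. (LINT x|?P. \<bar>h k x\<bar> * ?i x)) + real n * \<delta> * D \<theta>"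
      using n by (simp add: sum.distrib)
    also have "(\<Sum>k\<in>UNIV. (LINT x|?P. \<bar>h k x\<bar> * ?i x)) = (LINT x|?P. H x * ?i x)"
      unfolding H_def sum_distrib_right by (rule Bochner_Integration.integral_sum[symmetric]) (rule intk)
    also have "(LINT x|?P. H x * ?i x) \<le> (LINT x|?P. \<tau> * indicator {x \<in> space ?P. \<theta> < \<bar>U x\<bar>} x + H x ^ n * ?i x / \<tau> ^ (n - 1))"
    proof (intro Bochner_Integration.integral_mono intHi Bochner_Integration.integrable_add integrable_divide int\<Gamma> integrable_mult_right)
      fix x assume x: "x \<in> space ?P"
      have "H x \<le> \<tau> + H x ^ n / \<tau> ^ (n - 1)"
      proof (cases "H x \<le> \<tau>")
        case True
        then show ?thesis using H0 \<tau> by (simp add: add_increasing2)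
      next
        case False
        have "H x * \<tau> ^ (n - 1) \<le> H x * H x ^ (n - 1)"
          using False \<tau> by (intro mult_left_mono power_mono) auto
        also have "\<dots> = H x ^ n" using n by (metis Suc_diff_1 less_le_trans pos2 power_Suc)
        finally have "H x \<le> H x ^ n / \<tau> ^ (n - 1)" using \<tau> by (simp add: pos_le_divide_eq)
        then show ?thesis using \<tau> by simp
      qed
      then show "H x * ?i x \<le> \<tau> * indicator {x \<in> space ?P. \<theta> < \<bar>U x\<bar>} x + H x ^ n * ?i x / \<tau> ^ (n - 1)"
        using x H0[of x] \<tau> by (auto split: split_indicator)
    qed (auto simp: C.emeasure_eq_measure)
    also have "\<dots> = \<tau> * D \<theta> + \<Gamma> \<theta> (\<theta> + \<delta>) / \<tau> ^ (n - 1)"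
      unfolding D_def \<Gamma>_def
      by (subst Bochner_Integration.integral_add) (auto intro!: integrable_divide int\<Gamma> simp: C.emeasure_eq_measure)
    finally show ?thesis by simp
  qed
  have Mn: "M \<theta> \<le> real n" for \<theta>
  proof -
    have "M \<theta> \<le> (\<Sum>k\<in>(UNIV::'n set). 1)" unfolding M_def by (intro sum_mono Ck.prob_le_1)
    then show ?thesis using n by simp
  qed
  have M0: "0 \<le> M \<theta>" for \<theta> unfolding M_def by (intro sum_nonneg) auto
  let ?K = "2 * (16 * exp 1) ^ n * (2 * real n) ^ (n - 1)"
  have \<Lambda>0: "0 < \<Lambda>" unfolding \<Lambda>_def using A n by simp
  \<comment> \<open>The summand \<open>A ^ n / 2 ^ j\<close> keeps the bound positive on slabs without gradient and is summable.\<close>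
  have "\<exists>X\<ge>1. (\<forall>m. m \<le> 1 \<longrightarrow> m \<le> M (2 * (\<Lambda> * 2 ^ j)) \<longrightarrow> m \<le> exp (1 - X)) \<and>
     (4 * (\<Lambda> * 2 ^ j)) ^ n / X ^ (n - 1) \<le> ?K * (\<Gamma> (\<Lambda> * 2 ^ j) (2 * (\<Lambda> * 2 ^ j)) + A ^ n / 2 ^ j)" for j
  proof (rule dyadic_decay[where D=D and A=A])
    show "(\<Sum>i<N. \<Gamma> (a + real i * \<delta>) (a + real (Suc i) * \<delta>)) \<le> \<Gamma> a (a + real N * \<delta>)" if "0 < \<delta>" for a \<delta> N
    proof -
      have "mono (\<lambda>i. a + real i * \<delta>)" using that by (intro monoI) (auto intro: mult_right_mono)
      from \<Gamma>tel[OF this, of N] show ?thesis by simp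
    qed
    show "4 * exp 1 * real n * A \<le> \<Lambda> * 2 ^ j"
      using \<Lambda>0 mult_left_mono[of 1 "2 ^ j" \<Lambda>] by (simp add: \<Lambda>_def)
    show "A ^ n / 2 ^ j \<le> A ^ n" using A by (simp add: field_simps)
  qed (use n A M0 Mn LW step markov \<Gamma>0 \<Gamma>A in \<open>auto simp: D_def\<close>)
  then obtain Y where Y: "\<And>j. 1 \<le> Y j" "\<And>j m. m \<le> 1 \<Longrightarrow> m \<le> M (2 * (\<Lambda> * 2 ^ j)) \<Longrightarrow> m \<le> exp (1 - Y j)"
    "\<And>j. (4 * (\<Lambda> * 2 ^ j)) ^ n / Y j ^ (n - 1) \<le> ?K * (\<Gamma> (\<Lambda> * 2 ^ j) (2 * (\<Lambda> * 2 ^ j)) + A ^ n / 2 ^ j)"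
    by metis
  \<comment> \<open>No decay is known at the lowest level.\<close>
  define X where "X j = (case j of 0 \<Rightarrow> 1 | Suc i \<Rightarrow> Y i)" for j
  show ?thesis
  proof (intro exI[of _ X] conjI allI)
    show "1 \<le> X j" for j using Y(1) by (simp add: X_def split: nat.split)
    show "emeasure (cubeM (UNIV - {k})) (wide k U (\<Lambda> * 2 ^ j)) \<le> ennreal (exp (1 - X j))" for j k
    proof (cases j)
      case 0
      then show ?thesis using Ck.emeasure_le_1 by (simp add: X_def)
    next
      case (Suc i)
      have "measure (cubeM (UNIV - {k})) (wide k U (\<Lambda> * 2 ^ j)) \<le> M (2 * (\<Lambda> * 2 ^ i))"
        unfolding M_def Suc by (subst mult.left_commute) (auto intro!: member_le_sum)
      then have "measure (cubeM (UNIV - {k})) (wide k U (\<Lambda> * 2 ^ j)) \<le> exp (1 - Y i)"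
        by (intro Y(2) Ck.prob_le_1)
      then show ?thesis using Suc by (simp add: X_def Ck.emeasure_eq_measure)
    qed
    have "(\<Sum>j<J. ennreal ((\<Lambda> * 2 ^ Suc j) ^ n / X j ^ (n - 1))) \<le> ennreal (((8 * exp 1 * real n) ^ n + 3 * ?K) * A ^ n)" for J
    proof -
      have "(\<Sum>j<J. (\<Lambda> * 2 ^ Suc j) ^ n / X j ^ (n - 1)) \<le> (\<Sum>j<Suc J. (\<Lambda> * 2 ^ Suc j) ^ n / X j ^ (n - 1))"
        using \<Lambda>0 Y(1)[THEN order_trans[OF zero_le_one]] by (auto simp: X_def split: nat.split)
      also have "\<dots> = (\<Lambda> * 2) ^ n + (\<Sum>j<J. (4 * (\<Lambda> * 2 ^ j)) ^ n / Y j ^ (n - 1))"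
        by (simp only: sum.lessThan_Suc_shift) (simp add: X_def ac_simps)
      also have "(\<Sum>j<J. (4 * (\<Lambda> * 2 ^ j)) ^ n / Y j ^ (n - 1))
         \<le> (\<Sum>j<J. ?K * (\<Gamma> (\<Lambda> * 2 ^ j) (\<Lambda> * 2 ^ Suc j) + A ^ n / 2 ^ j))"
        using Y(3) by (intro sum_mono) (simp add: mult.left_commute)
      also have "\<dots> = ?K * ((\<Sum>j<J. \<Gamma> (\<Lambda> * 2 ^ j) (\<Lambda> * 2 ^ Suc j)) + A ^ n * (\<Sum>j<J. (1 / 2) ^ j))"
        by (simp only: sum_distrib_left[symmetric] sum.distrib) (simp add: sum_distrib_left power_one_over)
      also have "\<dots> \<le> ?K * (A ^ n + A ^ n * 2)"
      proof -
        have "mono (\<lambda>j. \<Lambda> * 2 ^ j)" using \<Lambda>0 by (intro monoI) (auto intro!: power_increasing)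
        from \<Gamma>tel[OF this, of J] have 1: "(\<Sum>j<J. \<Gamma> (\<Lambda> * 2 ^ j) (\<Lambda> * 2 ^ Suc j)) \<le> A ^ n" using \<Gamma>A by simp
        have 2: "(\<Sum>j<J. (1 / 2 :: real) ^ j) \<le> 2"
          using sum_le_suminf[of "\<lambda>j. (1 / 2 :: real) ^ j" "{..<J}"] suminf_geometric[of "1/2::real"] by (simp add: summable_geometric)
        show ?thesis using 1 2 A n by (intro mult_left_mono add_mono) auto
      qed
      also have "(\<Lambda> * 2) ^ n + ?K * (A ^ n + A ^ n * 2) = ((8 * exp 1 * real n) ^ n + 3 * ?K) * A ^ n"
        by (simp add: \<Lambda>_def power_mult_distrib algebra_simps flip: power_mult_distrib[of 4 2])
      finally have *: "(\<Sum>j<J. (\<Lambda> * 2 ^ Suc j) ^ n / X j ^ (n - 1)) \<le> ((8 * exp 1 * real n) ^ n + 3 * ?K) * A ^ n" by simp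
      have X0: "0 \<le> X j" for j using Y(1)[THEN order_trans[OF zero_le_one]] by (simp add: X_def split: nat.split)
      show ?thesis using * \<Lambda>0 X0 by (subst sum_ennreal) (auto intro!: ennreal_leI)
    qed
    then have "(\<Sum>j. ennreal ((\<Lambda> * 2 ^ Suc j) ^ n / X j ^ (n - 1))) \<le> ennreal (((8 * exp 1 * real n) ^ n + 3 * ?K) * A ^ n)"
      by (intro suminf_le_const summableI)
    then show "(\<Sum>j. ennreal ((\<Lambda> * 2 ^ Suc j) ^ n / X j ^ (n - 1)))
       \<le> ennreal (((8 * exp 1 * real n) ^ n + 6 * (16 * exp 1) ^ n * (2 * real n) ^ (n - 1)) * A ^ n)"
      by (simp add: mult.assoc)
  qed
qed

section \<open>Functions orthogonal to all product bumps\<close>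

lemma AE_coord_avoids:
  fixes i :: "'n::finite"
  shows "AE f in cubeM UNIV. f i \<noteq> c"
proof (rule AE_unsplit[where k=i])
  note measurable_coord[measurable]
  show "{f \<in> space (cubeM (UNIV::'n set)). f i \<noteq> c} \<in> sets (cubeM UNIV)" by measurable
  have "{c} \<inter> I \<in> null_sets L" using atomless_L by (auto simp: null_sets_def sets_restrict_space)
  from AE_not_in[OF this] have "AE s in L. s \<noteq> c" using AE_space by eventually_elim auto
  then show "AE y in cubeM (UNIV - {i}). AE s in L. (y(i := s)) i \<noteq> c" by simp
qed

lemma integral_box_eq_0_of_bumps:
  fixes R :: "('n::finite \<Rightarrow> real) \<Rightarrow> real"
  assumes R: "integrable (cubeM UNIV) R" and I: "I \<subseteq> {a..a+1}"
    and zero: "\<And>p q j. (\<And>i. a < p i \<and> p i < q i \<and> q i < a + 1) \<Longrightarrow>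
       (LINT f|cubeM UNIV. R f * (\<Prod>i\<in>UNIV. bump j (p i) (q i) (f i))) = 0"
  shows "(LINT f|cubeM UNIV. R f * (\<Prod>i\<in>UNIV. indicator {l i<..<u i} (f i))) = 0"
proof -
  define p where "p i = max (l i) a" for i
  define q where "q i = min (u i) (a + 1)" for i
  have ae: "AE f in cubeM UNIV. \<forall>i::'n. f i \<in> I \<and> f i \<noteq> a \<and> f i \<noteq> a + 1"
  proof -
    have 1: "AE f in cubeM UNIV. \<forall>i::'n. f i \<noteq> c" for c
      by (intro AE_all_countable[THEN iffD2] allI AE_coord_avoids)
    from AE_space 1[of a] 1[of "a + 1"] show ?thesis
    proof eventually_elim
      case (elim f)
      then show ?case by (auto simp: space_PiM)
    qed
  qed
  have Rm[measurable]: "R \<in> borel_measurable (cubeM UNIV)" using R by auto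
  note measurable_coord[measurable]
  have bm[measurable]: "(\<lambda>f. bump j c d (f i)) \<in> borel_measurable (cubeM (UNIV::'n set))" for j c d i
    using smooth_continuous[OF smooth_bump, THEN borel_measurable_continuous_onI]
    by (rule measurable_compose[OF measurable_coord])
  have "(LINT f|cubeM UNIV. R f * (\<Prod>i\<in>UNIV. indicator {l i<..<u i} (f i)))
      = (LINT f|cubeM UNIV. R f * (\<Prod>i\<in>UNIV. indicator {p i<..<q i} (f i)))"
  proof (rule integral_cong_AE)
    show "AE f in cubeM UNIV. R f * (\<Prod>i\<in>UNIV. indicator {l i<..<u i} (f i))
       = R f * (\<Prod>i\<in>UNIV. indicator {p i<..<q i} (f i))"
      using ae
    proof eventually_elim
      case (elim f)
      have "indicator {l i<..<u i} (f i) = (indicator {p i<..<q i} (f i) :: real)" for i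
        using elim[rule_format, of i] I by (force simp: p_def q_def indicator_def)
      then show ?case by simp
    qed
  qed measurable
  also have "\<dots> = 0"
  proof (cases "\<forall>i. p i < q i")
    case False
    then obtain i where "\<not> p i < q i" by auto
    then have *: "(\<Prod>i\<in>UNIV. indicator {p i<..<q i} (f i)) = (0::real)" for f
      by (intro prod_zero bexI[of _ i]) auto
    show ?thesis unfolding * by simp
  next
    case True
    \<comment> \<open>The intervals \<open>]p i,q i[\<close> may reach the end points of \<open>I\<close>; those of the bumps must not.\<close>
    define P where "P j i = p i + (q i - p i) / (real j + 3)" for j i
    define Q where "Q j i = q i - (q i - p i) / (real j + 3)" for j i
    have "(\<lambda>j. LINT f|cubeM UNIV. R f * (\<Prod>i\<in>UNIV. bump j (P j i) (Q j i) (f i)))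
       \<longlonglongrightarrow> (LINT f|cubeM UNIV. R f * (\<Prod>i\<in>UNIV. indicator {p i<..<q i} (f i)))"
    proof (rule integral_dominated_convergence[where w="\<lambda>f. \<bar>R f\<bar>"])
      show "integrable (cubeM UNIV) (\<lambda>f. \<bar>R f\<bar>)" using R by simp
      show "AE f in cubeM UNIV. (\<lambda>j. R f * (\<Prod>i\<in>UNIV. bump j (P j i) (Q j i) (f i)))
          \<longlonglongrightarrow> R f * (\<Prod>i\<in>UNIV. indicator {p i<..<q i} (f i))"
        unfolding P_def Q_def using True
        by (intro AE_I2 tendsto_mult tendsto_const tendsto_prod bump_tendsto_indicator) auto
      show "AE f in cubeM UNIV. norm (R f * (\<Prod>i\<in>UNIV. bump j (P j i) (Q j i) (f i))) \<le> \<bar>R f\<bar>" for j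
      proof (rule AE_I2)
        fix f
        have "0 \<le> (\<Prod>i\<in>UNIV. bump j (P j i) (Q j i) (f i))" "(\<Prod>i\<in>UNIV. bump j (P j i) (Q j i) (f i)) \<le> 1"
          by (auto intro!: prod_nonneg prod_le_1 bump_range)
        then show "norm (R f * (\<Prod>i\<in>UNIV. bump j (P j i) (Q j i) (f i))) \<le> \<bar>R f\<bar>"
          by (simp add: abs_mult mult_left_le)
      qed
    qed measurable
    moreover have "(LINT f|cubeM UNIV. R f * (\<Prod>i\<in>UNIV. bump j (P j i) (Q j i) (f i))) = 0" for j
    proof (rule zero)
      fix i
      have d: "0 < q i - p i" using True by simp
      define e where "e = (q i - p i) / (real j + 3)"
      have "0 < e" using d by (simp add: e_def)
      moreover have "e \<le> (q i - p i) / 3"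
        unfolding e_def using d by (intro divide_left_mono) auto
      moreover have "a \<le> p i" "q i \<le> a + 1" by (auto simp: p_def q_def)
      ultimately show "a < P j i \<and> P j i < Q j i \<and> Q j i < a + 1"
        unfolding P_def Q_def e_def[symmetric] using d by auto
    qed
    ultimately show ?thesis by (simp add: LIMSEQ_const_iff)
  qed
  finally show ?thesis .
qed

text \<open>The positive and the negative part of \<open>R\<close> are densities of two finite measures that agree on boxes.\<close>

lemma AE_eq_0_of_boxes:
  fixes R :: "('n::finite \<Rightarrow> real) \<Rightarrow> real"
  assumes R: "integrable (cubeM UNIV) R"
    and zero: "\<And>l u :: 'n \<Rightarrow> real. (LINT f|cubeM UNIV. R f * (\<Prod>i\<in>UNIV. indicator {l i<..<u i} (f i))) = 0"
  shows "AE f in cubeM UNIV. R f = 0"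
proof -
  note measurable_coord[measurable]
  have Rm[measurable]: "R \<in> borel_measurable (cubeM UNIV)" using R by auto
  define N where "N s = distr (density (cubeM UNIV) (\<lambda>f. ennreal (s * R f))) borel (vec_lambda :: _ \<Rightarrow> real^'n)" for s :: real
  have m[measurable]: "vec_lambda \<in> measurable (density (cubeM (UNIV::'n set)) g) borel" for g by simp
  have emN: "emeasure (N s) X = (\<integral>\<^sup>+f. ennreal (s * R f) * indicator X (vec_lambda f) \<partial>cubeM UNIV)"
    if "X \<in> sets borel" for s X
  proof -
    have "vec_lambda -` X \<inter> space (cubeM UNIV) \<in> sets (cubeM (UNIV::'n set))"
      using that by (intro measurable_sets[OF measurable_vec_lambda_cubeM])
    then show ?thesis using that unfolding N_def
      by (simp add: emeasure_distr emeasure_density) (auto intro!: nn_integral_cong split: split_indicator)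
  qed
  have fin: "(\<integral>\<^sup>+f. ennreal (s * R f) * indicator X (vec_lambda f) \<partial>cubeM UNIV) \<noteq> \<infinity>" for s and X :: "(real^'n) set"
  proof -
    have "(\<integral>\<^sup>+f. ennreal (s * R f) * indicator X (vec_lambda f) \<partial>cubeM UNIV) \<le> (\<integral>\<^sup>+f. ennreal (norm (s * R f)) \<partial>cubeM UNIV)"
      by (intro nn_integral_mono) (auto split: split_indicator intro!: ennreal_leI)
    also have "\<dots> < \<infinity>" using integrable_mult_right[OF R, of s] unfolding integrable_iff_bounded by auto
    finally show ?thesis by simp
  qed
  have "N 1 = N (-1)"
  proof (rule measure_eqI_generator_eq)
    let ?E = "range (\<lambda>(a, b). box a b::(real^'n) set)"
    show "Int_stable ?E"
      by (auto simp: Int_stable_def box_Int_box)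
    show "?E \<subseteq> Pow UNIV" "sets (N 1) = sigma_sets UNIV ?E" "sets (N (-1)) = sigma_sets UNIV ?E"
      by (simp_all add: borel_eq_box N_def)
    let ?A = "\<lambda>n::nat. box (- (real n *\<^sub>R One)) (real n *\<^sub>R One) :: (real^'n) set"
    show "range ?A \<subseteq> ?E" "(\<Union>i. ?A i) = UNIV"
      unfolding UN_box_eq_UNIV by auto
    show "emeasure (N 1) (?A i) \<noteq> \<infinity>" for i using fin[of 1] by (simp add: emN)
    fix X assume "X \<in> ?E"
    then obtain l u where X: "X = box l u" by auto
    have ind: "indicator X (vec_lambda f) = (\<Prod>i\<in>UNIV. indicator {l $ i<..<u $ i} (f i) :: real)" for f
    proof (cases "vec_lambda f \<in> X")
      case True then show ?thesis by (simp add: X mem_box_cart)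
    next
      case False
      then obtain i where "\<not> (l $ i < f i \<and> f i < u $ i)" by (auto simp: X mem_box_cart)
      then have "(\<Prod>i\<in>UNIV. indicator {l $ i<..<u $ i} (f i) :: real) = 0"
        by (intro prod_zero) (auto intro!: bexI[of _ i] simp: indicator_def)
      then show ?thesis using False by simp
    qed
    let ?g = "\<lambda>f. R f * indicator X (vec_lambda f)"
    have "(\<lambda>f. indicator X (vec_lambda f)) = (\<lambda>f. \<Prod>i\<in>UNIV. indicator {l $ i<..<u $ i} (f i) :: real)"
      by (rule ext) (rule ind)
    then have [measurable]: "(\<lambda>f. indicator X (vec_lambda f) :: real) \<in> borel_measurable (cubeM (UNIV::'n set))" by simp
    have g: "integrable (cubeM UNIV) ?g"
      by (rule Bochner_Integration.integrable_bound[OF R]) (auto split: split_indicator)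
    have "(LINT f|cubeM UNIV. ?g f) = 0" unfolding ind by (rule zero)
    then have "enn2real (\<integral>\<^sup>+f. ennreal (?g f) \<partial>cubeM UNIV) = enn2real (\<integral>\<^sup>+f. ennreal (- ?g f) \<partial>cubeM UNIV)"
      using real_lebesgue_integral_def[OF g] by simp
    moreover have "(\<integral>\<^sup>+f. ennreal (s * ?g f) \<partial>cubeM UNIV) = emeasure (N s) X" if "s \<in> {1, -1}" for s
      using that X by (auto simp: emN intro!: nn_integral_cong split: split_indicator)
    ultimately have "enn2real (emeasure (N 1) X) = enn2real (emeasure (N (-1)) X)" by fastforce
    moreover have "emeasure (N s) X \<noteq> \<infinity>" for s using fin X by (simp add: emN)
    ultimately show "emeasure (N 1) X = emeasure (N (-1)) X"
      by (metis ennreal_enn2real infinity_ennreal_def less_top)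
  qed
  have sgn: "AE f in cubeM UNIV. s * R f \<le> 0" if s: "s \<in> {1, -1}" for s
  proof -
    define B where "B = vec_nth -` {f \<in> space (cubeM (UNIV::'n set)). 0 < s * R f} \<inter> space (restrict_space borel (cube I :: (real^'n) set))"
    have "B \<in> sets (restrict_space borel (cube I :: (real^'n) set))"
      unfolding B_def by (intro measurable_sets[OF measurable_vec_nth_cubeM]) measurable
    then have B: "B \<in> sets borel" using cube_measurable by (subst (asm) sets_restrict_space_iff) auto
    have inB: "vec_lambda f \<in> B \<longleftrightarrow> 0 < s * R f" if "f \<in> space (cubeM UNIV)" for f
      using that vec_lambda_in_cube[OF that] by (simp add: B_def space_restrict_space vec_lambda_inverse)
    have "(\<integral>\<^sup>+f. ennreal (s * R f) * indicator B (vec_lambda f) \<partial>cubeM UNIV)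
      = (\<integral>\<^sup>+f. ennreal (- s * R f) * indicator B (vec_lambda f) \<partial>cubeM UNIV)"
      using \<open>N 1 = N (-1)\<close> s emN[OF B, of s] emN[OF B, of "-s"] by auto
    also have "\<dots> = (\<integral>\<^sup>+f. 0 \<partial>cubeM (UNIV::'n set))"
      using inB by (intro nn_integral_cong) (auto split: split_indicator simp: ennreal_neg)
    also have "(\<integral>\<^sup>+f. ennreal (s * R f) * indicator B (vec_lambda f) \<partial>cubeM UNIV) = (\<integral>\<^sup>+f. ennreal (s * R f) \<partial>cubeM UNIV)"
      using inB by (intro nn_integral_cong) (auto split: split_indicator simp: ennreal_neg)
    finally have "(\<integral>\<^sup>+f. ennreal (s * R f) \<partial>cubeM UNIV) = 0" by simp
    then have "AE f in cubeM UNIV. ennreal (s * R f) = 0" by (subst (asm) nn_integral_0_iff_AE) auto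
    then show ?thesis by eventually_elim (simp add: ennreal_eq_0_iff)
  qed
  have "AE f in cubeM UNIV. R f \<le> 0" "AE f in cubeM UNIV. 0 \<le> R f"
    using sgn[of 1] sgn[of "-1"] by simp_all
  then show ?thesis by eventually_elim simp
qed

section \<open>Weak derivatives and primitives along lines\<close>

lemma smooth_measurable_L: "smooth f \<Longrightarrow> f \<in> borel_measurable L"
  using borel_measurable_continuous_onI[OF smooth_continuous, of f]
  by (simp add: measurable_restrict_space1)

lemma smooth_measurable_coord: "smooth f \<Longrightarrow> (\<lambda>x. f (x i)) \<in> borel_measurable (cubeM (UNIV::'n set))"
  by (rule measurable_compose[OF measurable_coord]) (rule borel_measurable_continuous_onI[OF smooth_continuous])

lemma integral_L_eq:
  fixes g :: "real \<Rightarrow> real"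
  shows "(LINT s|L. g s) = (LINT s|lborel. indicator I s * g s)"
  by (subst integral_restrict_space) auto

text \<open>Du Bois-Reymond's lemma along the lines of direction \<open>k\<close>. Let \<open>V\<close> be the primitive of \<open>H\<close> along
  these lines and \<open>c\<close> the mean of \<open>U - V\<close> over each line with respect to a fixed weight \<open>b / c0\<close>.
  For a product bump with factor \<open>\<beta>\<close> in direction \<open>k\<close>, the function
  \<open>\<rho> = \<beta> - (\<integral>\<beta>) * b / c0\<close> has integral \<open>0\<close>, so it is the derivative of a smooth function with
  compact support. Testing with the product in which \<open>\<beta>\<close> is replaced by this antiderivative shows
  that \<open>R = U - V - c\<close> is orthogonal to the bump. As the bumps are arbitrary, \<open>R\<close> vanishes almost
  everywhere, and \<open>c\<close> is constant on each line.\<close>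

lemma primitive_along_of_weak:
  fixes U H :: "('n::finite \<Rightarrow> real) \<Rightarrow> real" and k :: 'n
  assumes ends: "{a<..<a+1} \<subseteq> I" "I \<subseteq> {a..a+1}"
    and U: "integrable (cubeM UNIV) U" and H: "integrable (cubeM UNIV) H"
    and weak: "\<And>g \<rho> p q. (\<And>i. smooth (g i)) \<Longrightarrow> (\<And>t. (g k has_real_derivative \<rho> t) (at t)) \<Longrightarrow>
      (\<And>i. a < p i \<and> p i \<le> q i \<and> q i < a + 1) \<Longrightarrow> (\<And>i t. t \<notin> {p i..q i} \<Longrightarrow> g i t = 0) \<Longrightarrow>
      (\<And>t. t \<notin> {p k..q k} \<Longrightarrow> \<rho> t = 0) \<Longrightarrow>
      (LINT f|cubeM UNIV. U f * (\<rho> (f k) * (\<Prod>i\<in>UNIV-{k}. g i (f i))))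
      = - (LINT f|cubeM UNIV. H f * (\<Prod>i\<in>UNIV. g i (f i)))"
  shows "primitive_along k U H"
proof -
  interpret L: prob_space L by (rule prob_L)
  define b where "b = bump 0 (a + 1/4) (a + 3/4)"
  have b: "smooth b" "\<And>t. 0 \<le> b t" "\<And>t. b t \<le> 1" by (auto simp: b_def smooth_bump bump_range)
  have bm[measurable]: "b \<in> borel_measurable L" using b by (intro smooth_measurable_L)
  have bint: "integrable L b" using b by (intro L.integrable_const_bound[of _ 1]) auto
  define c0 where "c0 = (LINT s|L. b s)"
  have c0: "0 < c0"
  proof -
    have "c0 \<noteq> 0"
    proof
      assume "c0 = 0"
      then have "AE s in L. b s = 0"
        using integral_nonneg_eq_0_iff_AE[OF bint] b by (simp add: c0_def)
      then have "AE s in L. s \<notin> {a+1/4<..<a+3/4}"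
        by eventually_elim (metis b_def bump_inside greaterThanLessThan_iff less_irrefl)
      moreover have "{a+1/4<..<a+3/4} \<subseteq> I" using ends by auto
      then have "{a+1/4<..<a+3/4} \<in> sets L" by (auto simp: sets_restrict_space)
      ultimately have "{a+1/4<..<a+3/4} \<in> null_sets L" by (subst (asm) AE_iff_null_sets[symmetric]) auto
      then show False using \<open>{a+1/4<..<a+3/4} \<subseteq> I\<close> by (auto simp: null_sets_def emeasure_restrict_space)
    qed
    moreover have "0 \<le> c0" unfolding c0_def using b by (intro Bochner_Integration.integral_nonneg) auto
    ultimately show ?thesis by simp
  qed
  have idm: "(\<lambda>x. x) \<in> L \<rightarrow>\<^sub>M borel" by (simp add: measurable_restrict_space1)
  have w1: "(\<lambda>(s, \<sigma>). indicator {..<s} \<sigma> :: real) \<in> borel_measurable (L \<Otimes>\<^sub>M L)"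
  proof -
    have [measurable]: "(\<lambda>z. fst z) \<in> borel_measurable (L \<Otimes>\<^sub>M L)" "(\<lambda>z. snd z) \<in> borel_measurable (L \<Otimes>\<^sub>M L)"
      by (intro measurable_compose[OF measurable_fst idm] measurable_compose[OF measurable_snd idm])+
    have "(\<lambda>z. if snd z < fst z then 1 else 0 :: real) \<in> borel_measurable (L \<Otimes>\<^sub>M L)" by measurable
    then show ?thesis by (simp add: indicator_def split_beta' of_bool_def)
  qed
  have w2: "(\<lambda>(s, \<sigma>). b \<sigma> / c0) \<in> borel_measurable (L \<Otimes>\<^sub>M L)" by measurable
  have b2: "\<bar>b \<sigma> / c0\<bar> \<le> 1 / c0" for \<sigma> using b c0 by (simp add: divide_right_mono abs_of_nonneg)
  define V where "V f = (LINT \<sigma>|L. indicator {..<f k} \<sigma> * H (f(k := \<sigma>)))" for f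
  have V: "integrable (cubeM UNIV) V"
    unfolding V_def by (rule section_kernel_integrable[OF H w1, of 1]) (auto simp: indicator_def)
  define W where "W f = U f - V f" for f
  have W: "integrable (cubeM UNIV) W" unfolding W_def using U V by simp
  define c where "c f = (LINT \<sigma>|L. (b \<sigma> / c0) * W (f(k := \<sigma>)))" for f
  have c: "integrable (cubeM UNIV) c"
    unfolding c_def by (rule section_kernel_integrable[OF W w2 b2])
  define R where "R f = W f - c f" for f
  have R: "integrable (cubeM UNIV) R" unfolding R_def using W c by simp
  have "AE f in cubeM UNIV. R f = 0"
  proof (rule AE_eq_0_of_boxes[OF R integral_box_eq_0_of_bumps[OF R ends(2)]])
    fix p q :: "'n \<Rightarrow> real" and j
    assume pq: "\<And>i. a < p i \<and> p i < q i \<and> q i < a + 1"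
    define g where "g i = bump j (p i) (q i)" for i
    have g: "smooth (g i)" "\<bar>g i t\<bar> \<le> 1" "t \<notin> {p i..q i} \<Longrightarrow> g i t = 0" for i t
      by (auto simp: g_def smooth_bump bump_range bump_outside)
    define \<alpha> where "\<alpha> f = (\<Prod>i\<in>UNIV-{k}. g i (f i))" for f :: "'n \<Rightarrow> real"
    have \<alpha>m[measurable]: "\<alpha> \<in> borel_measurable (cubeM UNIV)"
      unfolding \<alpha>_def by (intro borel_measurable_prod smooth_measurable_coord g)
    have \<alpha>k: "\<alpha> (f(k := s)) = \<alpha> f" for f s unfolding \<alpha>_def by (intro prod.cong) auto
    have \<alpha>1: "\<bar>\<alpha> f\<bar> \<le> 1" for f
      unfolding \<alpha>_def abs_prod using g by (intro prod_le_1) auto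
    define \<beta> where "\<beta> = (LINT s|L. g k s)"
    define \<rho> where "\<rho> t = g k t - \<beta> / c0 * b t" for t
    have gkm[measurable]: "g k \<in> borel_measurable L" by (intro smooth_measurable_L g)
    have gint: "integrable L (g k)" using g by (intro L.integrable_const_bound[of _ 1]) auto
    have \<rho>: "smooth \<rho>" unfolding \<rho>_def by (intro smooth_linear g b)
    \<comment> \<open>The support of \<open>\<rho>\<close> contains those of both \<open>g k\<close> and \<open>b\<close>.\<close>
    define p0 where "p0 = min (p k) (a + 1/4)"
    define q0 where "q0 = max (q k) (a + 3/4)"
    have pq0: "a < p0" "p0 \<le> q0" "q0 < a + 1" using pq[of k] by (auto simp: p0_def q0_def)
    have \<rho>out: "\<rho> t = 0" if "t \<notin> {p0..q0}" for t
    proof -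
      have "t \<notin> {p k..q k}" "\<not> (a + 1/4 < t \<and> t < a + 3/4)" using that by (auto simp: p0_def q0_def)
      then show ?thesis by (simp add: \<rho>_def g b_def bump_outside)
    qed
    have "(LINT s|L. \<rho> s) = 0"
      unfolding \<rho>_def using gint bint c0 by (simp add: \<beta>_def c0_def)
    moreover have "{p0..q0} \<subseteq> I" using pq0 ends by force
    then have "indicator I t * \<rho> t = \<rho> t * indicator {p0..q0} t" for t
      using \<rho>out[of t] by (cases "t \<in> {p0..q0}") (auto simp: indicator_def)
    ultimately have "(LINT t|lborel. \<rho> t * indicator {p0..q0} t) = 0"
      by (simp add: integral_L_eq)
    then obtain F where F: "\<And>t. (F has_real_derivative \<rho> t) (at t)" "smooth F" "\<And>t. t \<notin> {p0..q0} \<Longrightarrow> F t = 0"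
      using smooth_antiderivative[OF \<rho> pq0(2) \<rho>out] by blast
    obtain C\<rho> where C\<rho>: "\<And>t. \<bar>\<rho> t\<bar> \<le> C\<rho>" using smooth_compact_support_bounded[OF \<rho> \<rho>out] by blast
    note [measurable] = smooth_measurable_coord[OF F(2), of k] smooth_measurable_coord[OF \<rho>, of k]
      smooth_measurable_coord[OF g(1), of k k] smooth_measurable_coord[OF b(1), of k]
    have i0: "integrable (cubeM UNIV) (\<lambda>f. (\<alpha> f * \<theta> (f k)) * X f)"
      if "integrable (cubeM UNIV) X" "smooth \<theta>" "\<And>t. \<bar>\<theta> t\<bar> \<le> C" for X \<theta> C
    proof (rule integrable_bounded_mult[OF that(1), where C="1 * C"])
      show "(\<lambda>f. \<alpha> f * \<theta> (f k)) \<in> borel_measurable (cubeM UNIV)"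
        using smooth_measurable_coord[OF that(2), of k] by measurable
      show "\<bar>\<alpha> f * \<theta> (f k)\<bar> \<le> 1 * C" for f
        unfolding abs_mult using \<alpha>1 that(3) by (intro mult_mono) auto
    qed
    have one: "(LINT f|cubeM UNIV. \<alpha> f * \<rho> (f k) * U f) = - (LINT f|cubeM UNIV. \<alpha> f * F (f k) * H f)"
    proof -
      have 1: "(\<Prod>i\<in>UNIV-{k}. (g(k := F)) i (f i)) = \<alpha> f" for f
        unfolding \<alpha>_def by (intro prod.cong) auto
      have 2: "(\<Prod>i\<in>UNIV. (g(k := F)) i (f i)) = F (f k) * \<alpha> f" for f
        using 1[of f] by (subst prod.remove[of _ k]) auto
      have "(LINT f|cubeM UNIV. U f * (\<rho> (f k) * (\<Prod>i\<in>UNIV-{k}. (g(k := F)) i (f i))))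
        = - (LINT f|cubeM UNIV. H f * (\<Prod>i\<in>UNIV. (g(k := F)) i (f i)))"
      proof (rule weak[of "g(k := F)" \<rho> "p(k := p0)" "q(k := q0)"])
        show "smooth ((g(k := F)) i)" for i using g F by simp
        show "((g(k := F)) k has_real_derivative \<rho> t) (at t)" for t using F by simp
        show "a < (p(k := p0)) i \<and> (p(k := p0)) i \<le> (q(k := q0)) i \<and> (q(k := q0)) i < a + 1" for i
          using pq[of i] pq0 by auto
        show "t \<notin> {(p(k := p0)) i..(q(k := q0)) i} \<Longrightarrow> (g(k := F)) i t = 0" for i t
          using g(3)[of t i] F(3)[of t] by (cases "i = k") auto
        show "t \<notin> {(p(k := p0)) k..(q(k := q0)) k} \<Longrightarrow> \<rho> t = 0" for t
          using \<rho>out[of t] by simp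
      qed
      then show ?thesis unfolding 1 2 by (simp only: ac_simps)
    qed
    have two: "(LINT f|cubeM UNIV. \<alpha> f * \<rho> (f k) * V f) = - (LINT f|cubeM UNIV. \<alpha> f * F (f k) * H f)"
    proof -
      have "(LINT f|cubeM UNIV. \<alpha> f * \<rho> (f k) * V f)
        = (LINT f|cubeM UNIV. \<alpha> f * (LINT s|L. \<rho> s * indicator {..<s} (f k)) * H f)"
        unfolding V_def
        by (rule section_kernel_Fubini[OF H w1, of 1]) (use \<alpha>k \<alpha>1 C\<rho> \<rho> smooth_measurable_L in \<open>auto simp: indicator_def\<close>)
      also have "\<dots> = (LINT f|cubeM UNIV. - (\<alpha> f * F (f k) * H f))"
      proof (rule Bochner_Integration.integral_cong[OF refl])
        fix f assume f: "f \<in> space (cubeM (UNIV::'n set))"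
        define \<sigma> where "\<sigma> = f k"
        have "\<sigma> \<in> I" using f by (auto simp: \<sigma>_def space_PiM)
        then have \<sigma>: "\<sigma> \<in> I" "a \<le> \<sigma>" "\<sigma> \<le> a + 1" using ends by auto
        have cont: "isCont \<rho> t" for t
          using smooth_continuous[OF \<rho>] by (simp add: continuous_on_eq_continuous_at)
        have "(LINT s|L. \<rho> s * indicator {..<s} \<sigma>) = (LINT s|lborel. indicator I s * (\<rho> s * indicator {..<s} \<sigma>))"
          by (rule integral_L_eq)
        also have "\<dots> = (LINT s|lborel. \<rho> s * indicator {\<sigma>..a+1} s)"
        proof (rule integral_cong_AE)
          have \<rho>b: "\<rho> \<in> borel_measurable lborel"
            using borel_measurable_continuous_onI[OF smooth_continuous[OF \<rho>]] by simp
          have e: "indicator {..<s} \<sigma> = (indicator {\<sigma><..} s :: real)" for s by (auto simp: indicator_def)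
          show "(\<lambda>s. indicator I s * (\<rho> s * indicator {..<s} \<sigma>)) \<in> borel_measurable lborel"
            unfolding e by (intro borel_measurable_times borel_measurable_indicator \<rho>b) auto
          show "(\<lambda>s. \<rho> s * indicator {\<sigma>..a+1} s) \<in> borel_measurable lborel"
            by (intro borel_measurable_times borel_measurable_indicator \<rho>b) auto
          show "AE s in lborel. indicator I s * (\<rho> s * indicator {..<s} \<sigma>) = \<rho> s * indicator {\<sigma>..a+1} s"
            using AE_lborel_singleton[of \<sigma>]
          proof eventually_elim
            case (elim s)
            show ?case
            proof (cases "s \<in> {p0..q0}")
              case True
              then have "s \<in> I" "s \<le> a + 1" using pq0 ends by auto
              then show ?thesis using elim by (auto simp: indicator_def)
            qed (simp add: \<rho>out)
          qed
        qed
        also have "\<dots> = F (a + 1) - F \<sigma>"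
          by (rule integral_FTC_Icc_real[OF \<sigma>(3)]) (use F cont in auto)
        also have "F (a + 1) = 0" using F(3)[of "a + 1"] pq0 by auto
        finally show "\<alpha> f * (LINT s|L. \<rho> s * indicator {..<s} (f k)) * H f = - (\<alpha> f * F (f k) * H f)"
          by (simp add: \<sigma>_def)
      qed
      finally show ?thesis by simp
    qed
    have three: "(LINT f|cubeM UNIV. \<alpha> f * g k (f k) * c f) = (LINT f|cubeM UNIV. \<alpha> f * (\<beta> / c0 * b (f k)) * W f)"
    proof -
      have "(LINT f|cubeM UNIV. \<alpha> f * g k (f k) * c f)
        = (LINT f|cubeM UNIV. \<alpha> f * (LINT s|L. g k s * (b (f k) / c0)) * W f)"
        unfolding c_def
        by (rule section_kernel_Fubini[OF W w2 b2]) (use \<alpha>k \<alpha>1 g in auto)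
      then show ?thesis by (simp add: \<beta>_def mult.commute)
    qed
    have ib: "integrable (cubeM UNIV) (\<lambda>f. \<alpha> f * (\<beta> / c0 * b (f k)) * W f)"
    proof (rule integrable_bounded_mult[OF W, where C="1 * (\<bar>\<beta> / c0\<bar> * 1)"])
      show "\<bar>\<alpha> f * (\<beta> / c0 * b (f k))\<bar> \<le> 1 * (\<bar>\<beta> / c0\<bar> * 1)" for f
        unfolding abs_mult using \<alpha>1 b by (intro mult_mono) auto
    qed measurable
    have "(LINT f|cubeM UNIV. R f * (\<Prod>i\<in>UNIV. bump j (p i) (q i) (f i)))
       = (LINT f|cubeM UNIV. \<alpha> f * g k (f k) * W f - \<alpha> f * g k (f k) * c f)"
    proof (rule Bochner_Integration.integral_cong[OF refl])
      fix f
      have "(\<Prod>i\<in>UNIV. bump j (p i) (q i) (f i)) = g k (f k) * \<alpha> f"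
        unfolding \<alpha>_def g_def by (subst prod.remove[of _ k]) auto
      then show "R f * (\<Prod>i\<in>UNIV. bump j (p i) (q i) (f i)) = \<alpha> f * g k (f k) * W f - \<alpha> f * g k (f k) * c f"
        by (simp add: R_def algebra_simps)
    qed
    also have "\<dots> = (LINT f|cubeM UNIV. \<alpha> f * g k (f k) * W f) - (LINT f|cubeM UNIV. \<alpha> f * g k (f k) * c f)"
      by (intro Bochner_Integration.integral_diff i0[OF W g(1,2)] i0[OF c g(1,2)])
    also have "\<dots> = (LINT f|cubeM UNIV. \<alpha> f * g k (f k) * W f - \<alpha> f * (\<beta> / c0 * b (f k)) * W f)"
      unfolding three by (intro Bochner_Integration.integral_diff[symmetric] i0[OF W g(1,2)] ib)
    also have "\<dots> = (LINT f|cubeM UNIV. \<alpha> f * \<rho> (f k) * U f - \<alpha> f * \<rho> (f k) * V f)"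
      by (rule Bochner_Integration.integral_cong[OF refl]) (simp add: \<rho>_def W_def algebra_simps diff_divide_distrib)
    also have "\<dots> = (LINT f|cubeM UNIV. \<alpha> f * \<rho> (f k) * U f) - (LINT f|cubeM UNIV. \<alpha> f * \<rho> (f k) * V f)"
      by (intro Bochner_Integration.integral_diff i0[OF U \<rho> C\<rho>] i0[OF V \<rho> C\<rho>])
    also have "\<dots> = 0" using one two by simp
    finally show "(LINT f|cubeM UNIV. R f * (\<Prod>i\<in>UNIV. bump j (p i) (q i) (f i))) = 0" .
  qed
  from AE_split[OF this, of k] AE_integrable_section[OF H, of k]
  show ?thesis unfolding primitive_along_def
  proof eventually_elim
    case (elim y)
    have "AE s in L. U (y(k := s)) = (LINT \<sigma>|L. (b \<sigma> / c0) * W (y(k := \<sigma>))) + (LINT \<sigma>|L. indicator {..<s} \<sigma> * H (y(k := \<sigma>)))"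
      using elim(1) by eventually_elim (simp add: R_def W_def V_def c_def)
    then show ?case using elim(2) by blast
  qed
qed

section \<open>Mixed norms and level sets; the second embedding\<close>

lemma AE_L_iff: "(AE s in L. Q s) \<longleftrightarrow> (AE s in lborel. s \<in> I \<longrightarrow> Q s)"
  by (subst AE_restrict_space_iff) auto

lemma insert_coord_eq: "insert_coord k y s = vec_lambda (y(k := s))"
  by (simp add: insert_coord_def fun_upd_def vec_eq_iff)

lemma section_norm_wide:
  fixes f F :: "real^'n::finite \<Rightarrow> real" and k :: 'n
  assumes F: "F \<in> borel_measurable borel" and eq: "AE x in lborel. x \<in> cube I \<longrightarrow> f x = F x"
  shows "AE y in cubeM (UNIV - {k}). \<forall>\<theta>. 0 \<le> \<theta> \<longrightarrow>
    (ennreal \<theta> < section_norm k (Lq_norm \<infinity>) I f y \<longleftrightarrow> y \<in> wide k (\<lambda>x. F (vec_lambda x)) \<theta>)"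
proof -
  have "AE x in cubeM UNIV. f (vec_lambda x) = F (vec_lambda x)"
    using AE_cubeM[OF eq] .
  from AE_split[OF this, of k] AE_space
  show ?thesis
  proof eventually_elim
    case (elim y)
    define g where "g s = F (vec_lambda (y(k := s)))" for s
    have sec: "(\<lambda>s. vec_lambda (y(k := s))) \<in> borel_measurable borel"
      using measurable_vec_lambda[of "\<lambda>s. y(k := s)" borel] by (auto simp: fun_upd_def)
    have g[measurable]: "g \<in> borel_measurable borel" unfolding g_def by (rule measurable_compose[OF sec F])
    have ae: "AE s in lborel. s \<in> I \<longrightarrow> f (insert_coord k y s) = g s"
      using elim(1) by (simp add: AE_L_iff insert_coord_eq g_def)
    let ?h = "\<lambda>s. ennreal \<bar>f (insert_coord k y s)\<bar>"
    have "(\<lambda>s. f (insert_coord k y s)) \<in> borel_measurable (lebesgue_on I)"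
      by (rule measurable_lebesgue_on_AE_eq[OF borel_I g ae])
    then have h: "?h \<in> borel_measurable (lebesgue_on I)" by measurable
    have sn: "section_norm k (Lq_norm \<infinity>) I f y = esssup (lebesgue_on I) ?h"
      by (simp add: section_norm_def Lq_norm_def)
    show ?case
    proof (intro allI impI)
      fix \<theta> :: real assume \<theta>: "0 \<le> \<theta>"
      have gm: "(\<lambda>s. indicator {\<theta><..} \<bar>g s\<bar> :: ennreal) \<in> borel_measurable L"
        by (intro measurable_restrict_space1) measurable
      have "y \<in> wide k (\<lambda>x. F (vec_lambda x)) \<theta> \<longleftrightarrow> \<not> (\<integral>\<^sup>+s. indicator {\<theta><..} \<bar>g s\<bar> \<partial>L) = 0"
        using elim(2) by (simp add: wide_def g_def zero_less_iff_neq_zero del: fun_upd_apply)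
      also have "(\<integral>\<^sup>+s. indicator {\<theta><..} \<bar>g s\<bar> \<partial>L) = 0 \<longleftrightarrow> (AE s in L. \<bar>g s\<bar> \<le> \<theta>)"
        using gm by (subst nn_integral_0_iff_AE) (auto simp: indicator_def not_less)
      also have "\<dots> \<longleftrightarrow> (AE s in lborel. s \<in> I \<longrightarrow> \<bar>f (insert_coord k y s)\<bar> \<le> \<theta>)"
      proof
        assume "AE s in L. \<bar>g s\<bar> \<le> \<theta>"
        from this[unfolded AE_L_iff] ae show "AE s in lborel. s \<in> I \<longrightarrow> \<bar>f (insert_coord k y s)\<bar> \<le> \<theta>"
          by eventually_elim auto
      next
        assume "AE s in lborel. s \<in> I \<longrightarrow> \<bar>f (insert_coord k y s)\<bar> \<le> \<theta>"
        from this ae show "AE s in L. \<bar>g s\<bar> \<le> \<theta>"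
          unfolding AE_L_iff by eventually_elim auto
      qed
      also have "\<dots> \<longleftrightarrow> (AE s in lebesgue_on I. ?h s \<le> ennreal \<theta>)"
        using \<theta> by (simp add: AE_lebesgue_on_iff)
      also have "\<dots> \<longleftrightarrow> esssup (lebesgue_on I) ?h \<le> ennreal \<theta>"
      proof
        assume "esssup (lebesgue_on I) ?h \<le> ennreal \<theta>"
        note le = this
        show "AE s in lebesgue_on I. ?h s \<le> ennreal \<theta>"
          using esssup_AE[of ?h "lebesgue_on I"] by eventually_elim (use le order_trans in blast)
      qed (rule esssup_I[OF h])
      finally show "ennreal \<theta> < section_norm k (Lq_norm \<infinity>) I f y \<longleftrightarrow> y \<in> wide k (\<lambda>x. F (vec_lambda x)) \<theta>"
        unfolding sn by (simp add: not_le)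
    qed
  qed
qed

text \<open>The section norm need not be measurable before the completion of the measure, but it differs from
  that of a Borel representative only on a null set of lines.\<close>

lemma distribution_section_norm:
  fixes f F :: "real^'n::finite \<Rightarrow> real" and k :: 'n
  assumes F: "F \<in> borel_measurable borel" and eq: "AE x in lborel. x \<in> cube I \<longrightarrow> f x = F x" and \<theta>: "0 \<le> \<theta>"
  shows "distribution_fun (face_measure k I) (section_norm k (Lq_norm \<infinity>) I f) (ennreal \<theta>)
    = emeasure (cubeM (UNIV - {k})) (wide k (\<lambda>x. F (vec_lambda x)) \<theta>)"
proof -
  have U: "(\<lambda>x. F (vec_lambda x)) \<in> borel_measurable (cubeM UNIV)"
    by (rule measurable_compose[OF measurable_vec_lambda_cubeM F])
  let ?W = "wide k (\<lambda>x. F (vec_lambda x)) \<theta>"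
  let ?A = "{y \<in> space (face_measure k I). ennreal \<theta> < section_norm k (Lq_norm \<infinity>) I f y}"
  have W: "?W \<in> sets (cubeM (UNIV - {k}))" by (rule wide_measurable[OF U])
  have fm: "face_measure k I = completion (cubeM (UNIV - {k}))" by (simp add: face_measure_def)
  have ae: "AE y in face_measure k I. y \<in> ?W \<longleftrightarrow> y \<in> ?A"
    using AE_completion[OF section_norm_wide[OF F eq, of k]] AE_space unfolding fm
    by eventually_elim (use \<theta> in auto)
  have "?A \<in> sets (face_measure k I)"
    using ae unfolding fm by (rule completion.in_sets_AE) (use W in auto)
  then have "emeasure (face_measure k I) ?A = emeasure (face_measure k I) ?W"
    using ae W unfolding fm by (intro emeasure_eq_AE) auto
  then show ?thesis using W by (simp add: distribution_fun_def fm)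
qed

lemma distribution_cube:
  fixes f F :: "real^'n::finite \<Rightarrow> real"
  assumes F[measurable]: "F \<in> borel_measurable borel" and eq: "AE x in lborel. x \<in> cube I \<longrightarrow> f x = F x" and \<theta>: "0 \<le> \<theta>"
  shows "distribution_fun (lebesgue_on (cube I)) (\<lambda>x. ennreal \<bar>f x\<bar>) (ennreal \<theta>)
    = (\<integral>\<^sup>+x. indicator {\<theta><..} \<bar>F (vec_lambda x)\<bar> \<partial>cubeM UNIV)"
proof -
  let ?A = "{x \<in> space (lebesgue_on (cube I)). ennreal \<theta> < ennreal \<bar>f x\<bar>}"
  let ?B = "{x \<in> cube I. \<theta> < \<bar>F x\<bar>}"
  have f: "f \<in> borel_measurable (lebesgue_on (cube I))"
    by (rule measurable_lebesgue_on_AE_eq[OF cube_measurable F eq])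
  have B: "?B \<in> sets borel"
  proof -
    have "?B = cube I \<inter> {x \<in> space borel. \<theta> < \<bar>F x\<bar>}" by auto
    also have "\<dots> \<in> sets borel" by measurable
    finally show ?thesis .
  qed
  have "emeasure (lebesgue_on (cube I)) ?A = emeasure (lebesgue_on (cube I)) ?B"
  proof (rule emeasure_eq_AE)
    have "AE x in lebesgue_on (cube I). f x = F x" using eq by (simp add: AE_lebesgue_on_iff)
    from this AE_space show "AE x in lebesgue_on (cube I). x \<in> ?A \<longleftrightarrow> x \<in> ?B"
    proof eventually_elim
      case (elim x)
      then show ?case using \<theta> by (auto simp: ennreal_less_iff)
    qed
    show "?A \<in> sets (lebesgue_on (cube I))" using f by measurable
    show "?B \<in> sets (lebesgue_on (cube I))" using B by (subst sets_restrict_space_iff) auto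
  qed
  also have "\<dots> = emeasure lborel ?B"
    using B by (subst emeasure_restrict_space) auto
  also have "\<dots> = (\<integral>\<^sup>+x. indicator {\<theta><..} \<bar>F x\<bar> * indicator (cube I) x \<partial>lborel)"
  proof -
    have B': "?B \<in> sets lborel" using B by simp
    show ?thesis unfolding nn_integral_indicator[OF B', symmetric]
      by (intro nn_integral_cong) (auto split: split_indicator)
  qed
  also have "\<dots> = (\<integral>\<^sup>+x. indicator {\<theta><..} \<bar>F (vec_lambda x)\<bar> \<partial>cubeM UNIV)"
    by (rule nn_integral_cubeM[symmetric]) measurable
  finally show ?thesis by (simp add: distribution_fun_def)
qed

text \<open>Almost every point at which \<open>\<bar>f\<bar> > s\<close> lies on a line on which the essential supremum exceeds \<open>s\<close>.\<close>

lemma distribution_cube_le_section: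
  fixes f :: "real^'n::finite \<Rightarrow> real" and k :: 'n
  assumes f: "f \<in> borel_measurable (lebesgue_on (cube I))"
  shows "distribution_fun (lebesgue_on (cube I)) (\<lambda>x. ennreal \<bar>f x\<bar>) s
    \<le> distribution_fun (face_measure k I) (section_norm k (Lq_norm \<infinity>) I f) s"
proof (cases s)
  case top
  then show ?thesis by (simp add: distribution_fun_def)
next
  case (real \<theta>)
  interpret L: prob_space L by (rule prob_L)
  obtain F where F: "F \<in> borel_measurable borel" "AE x in lborel. x \<in> cube I \<longrightarrow> f x = F x"
    using borel_representative[OF cube_measurable f] .
  note [measurable] = F(1)
  define U where "U x = F (vec_lambda x)" for x
  have U[measurable]: "U \<in> borel_measurable (cubeM UNIV)"
    unfolding U_def by (rule measurable_compose[OF measurable_vec_lambda_cubeM F(1)])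
  have "(\<integral>\<^sup>+x. indicator {\<theta><..} \<bar>U x\<bar> \<partial>cubeM UNIV)
    = (\<integral>\<^sup>+y. (\<integral>\<^sup>+s. indicator {\<theta><..} \<bar>U (y(k := s))\<bar> \<partial>L) \<partial>cubeM (UNIV - {k}))"
    by (rule nn_integral_split) measurable
  also have "\<dots> \<le> (\<integral>\<^sup>+y. indicator (wide k U \<theta>) y \<partial>cubeM (UNIV - {k}))"
  proof (rule nn_integral_mono)
    fix y assume y: "y \<in> space (cubeM (UNIV - {k}))"
    show "(\<integral>\<^sup>+s. indicator {\<theta><..} \<bar>U (y(k := s))\<bar> \<partial>L) \<le> indicator (wide k U \<theta>) y"
    proof (cases "y \<in> wide k U \<theta>")
      case True
      have "(\<integral>\<^sup>+s. indicator {\<theta><..} \<bar>U (y(k := s))\<bar> \<partial>L) \<le> (\<integral>\<^sup>+s. 1 \<partial>L)"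
        by (intro nn_integral_mono) (simp add: indicator_def)
      then show ?thesis using True L.emeasure_space_1 by simp
    qed (use y in \<open>simp add: wide_def not_less del: fun_upd_apply\<close>)
  qed
  also have "\<dots> = emeasure (cubeM (UNIV - {k})) (wide k U \<theta>)"
    using wide_measurable[OF U] by simp
  finally show ?thesis
    using distribution_section_norm[OF F real(1), of k] distribution_cube[OF F real(1)] real by (simp add: U_def[abs_def])
qed

lemma mixed_into_lorentz_zygmund:
  fixes n :: nat
  assumes n: "n > 0"
  shows "continuous_embedding
           (mixed_space (lorentz_zygmund_norm \<infinity> (of_nat n) (-1)) (Lq_norm \<infinity>) I :: (real^'n::finite \<Rightarrow> real) set)
           (mixed_norm (lorentz_zygmund_norm \<infinity> (of_nat n) (-1)) (Lq_norm \<infinity>) I)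
           (fun_space (lorentz_zygmund_norm \<infinity> (of_nat n) (-1)) (lebesgue_on (cube I)))
           (\<lambda>f. lorentz_zygmund_norm \<infinity> (of_nat n) (-1) (lebesgue_on (cube I)) (\<lambda>x. ennreal \<bar>f x\<bar>))"
proof -
  let ?X = "lorentz_zygmund_norm \<infinity> (of_nat n) (-1)"
  let ?NB = "\<lambda>f :: real^'n \<Rightarrow> real. lorentz_zygmund_norm \<infinity> (of_nat n) (-1) (lebesgue_on (cube I)) (\<lambda>x. ennreal \<bar>f x\<bar>)"
  have key: "?NB f \<le> mixed_norm_k k ?X (Lq_norm \<infinity>) I f"
    if "f \<in> mixed_space ?X (Lq_norm \<infinity>) I" for f and k :: 'n
  proof -
    have "f \<in> borel_measurable (lebesgue_on (cube I))"
      using that by (auto simp: mixed_space_def mixed_space_k_def)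
    then show ?thesis unfolding mixed_norm_k_def
      by (intro lorentz_zygmund_norm_mono n distribution_cube_le_section)
  qed
  show ?thesis unfolding continuous_embedding_def
  proof (intro conjI exI[of _ 1] ballI subsetI)
    fix f :: "real^'n \<Rightarrow> real" assume f: "f \<in> mixed_space ?X (Lq_norm \<infinity>) I"
    obtain k :: 'n where True by blast
    have "mixed_norm_k k ?X (Lq_norm \<infinity>) I f < \<infinity>" and m: "f \<in> borel_measurable (lebesgue_on (cube I))"
      using f by (auto simp: mixed_space_def mixed_space_k_def)
    then show "f \<in> fun_space ?X (lebesgue_on (cube I))"
      using key[OF f, of k] by (simp add: fun_space_def order_le_less_trans)
    have "mixed_norm_k k ?X (Lq_norm \<infinity>) I f \<le> mixed_norm ?X (Lq_norm \<infinity>) I f"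
      unfolding mixed_norm_def by (intro member_le_sum) auto
    then show "?NB f \<le> ennreal 1 * mixed_norm ?X (Lq_norm \<infinity>) I f"
      using key[OF f, of k] by simp
  qed simp
qed

section \<open>The first embedding\<close>

lemma nn_integral_lebesgue_cube:
  "(\<integral>\<^sup>+x. h x \<partial>lebesgue_on (cube I)) = (\<integral>\<^sup>+x. h x * indicator (cube I) x \<partial>(lborel :: (real^'n::finite) measure))"
  by (subst nn_integral_restrict_space) (auto simp: nn_integral_completion)

lemma AE_interior_cube: "AE x in lborel. x \<in> cube I \<longrightarrow> x \<in> interior (cube I :: (real^'n::finite) set)"
proof -
  obtain a where ends: "{a<..<a+1} \<subseteq> I" "I \<subseteq> {a..a+1}" using obtain_left_end by blast
  let ?l = "\<chi> i. a :: real^'n" and ?u = "\<chi> i. a + 1 :: real^'n"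
  have "box ?l ?u \<subseteq> cube I" using ends by (force simp: cube_def mem_box_cart)
  then have 1: "box ?l ?u \<subseteq> interior (cube I)" by (intro interior_maximal open_box)
  have 2: "cube I \<subseteq> cbox ?l ?u" using ends by (force simp: cube_def mem_box_cart)
  have "cbox ?l ?u - box ?l ?u \<in> null_sets lebesgue"
    using negligible_frontier_interval by (simp add: negligible_iff_null_sets)
  from AE_not_in[OF this] have "AE x in lborel. x \<notin> cbox ?l ?u - box ?l ?u"
    by (simp add: AE_completion_iff)
  then show ?thesis by eventually_elim (use 1 2 in auto)
qed

lemma pairing_with_test:
  fixes v V \<phi> :: "real^'n::finite \<Rightarrow> real"
  assumes V: "V \<in> borel_measurable borel" and \<phi>: "\<phi> \<in> borel_measurable borel"
    and eq: "AE x in lborel. x \<in> cube I \<longrightarrow> v x = V x"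
  shows "(LINT x:interior (cube I)|lebesgue. v x * \<phi> x) = (LINT f|cubeM UNIV. V (vec_lambda f) * \<phi> (vec_lambda f))"
proof -
  let ?\<Omega> = "interior (cube I) :: (real^'n) set"
  let ?h = "\<lambda>x. indicator (cube I) x * (V x * \<phi> x)"
  have sub: "?\<Omega> \<subseteq> cube I" by (rule interior_subset)
  have h[measurable]: "?h \<in> borel_measurable borel" using V \<phi> cube_measurable by measurable
  have ae: "AE x in lborel. indicator ?\<Omega> x *\<^sub>R (v x * \<phi> x) = ?h x"
    using eq AE_interior_cube by eventually_elim (use sub in \<open>auto split: split_indicator\<close>)
  have "(\<lambda>x. indicator ?\<Omega> x *\<^sub>R (v x * \<phi> x)) \<in> borel_measurable (lebesgue_on UNIV)"
    by (rule measurable_lebesgue_on_AE_eq[OF _ h]) (use ae in auto)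
  then have m: "(\<lambda>x. indicator ?\<Omega> x *\<^sub>R (v x * \<phi> x)) \<in> borel_measurable lebesgue" by simp
  have "(LINT x:?\<Omega>|lebesgue. v x * \<phi> x) = (LINT x|lebesgue. ?h x)"
    unfolding set_lebesgue_integral_def
    using m h AE_completion[OF ae] by (intro integral_cong_AE) (auto intro: measurable_completion)
  also have "\<dots> = (LINT x|lborel. ?h x)" using h by (intro integral_completion) simp
  also have "\<dots> = (LINT f|cubeM UNIV. V (vec_lambda f) * \<phi> (vec_lambda f))"
    using V \<phi> by (intro integral_cubeM[symmetric]) measurable
  finally show ?thesis .
qed

lemma primitive_along_of_weak_gradient:
  fixes u F :: "real^'n::finite \<Rightarrow> real" and g :: "real^'n \<Rightarrow> real^'n" and k :: 'n
  assumes w: "weak_gradient (interior (cube I)) u g"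
    and F: "F \<in> borel_measurable borel" and uF: "AE x in lborel. x \<in> cube I \<longrightarrow> u x = F x"
    and G: "G \<in> borel_measurable borel" and gG: "AE x in lborel. x \<in> cube I \<longrightarrow> g x $ k = G x"
    and intF: "integrable (cubeM UNIV) (\<lambda>f. F (vec_lambda f))" and intG: "integrable (cubeM UNIV) (\<lambda>f. G (vec_lambda f))"
  shows "primitive_along k (\<lambda>f. F (vec_lambda f)) (\<lambda>f. G (vec_lambda f))"
proof -
  obtain a where ends: "{a<..<a+1} \<subseteq> I" "I \<subseteq> {a..a+1}" using obtain_left_end by blast
  let ?\<Omega> = "interior (cube I) :: (real^'n) set"
  show ?thesis
  proof (rule primitive_along_of_weak[OF ends intF intG])
    fix \<gamma> :: "'n \<Rightarrow> real \<Rightarrow> real" and \<rho> :: "real \<Rightarrow> real" and p q :: "'n \<Rightarrow> real"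
    assume sm: "\<And>i. smooth (\<gamma> i)" and \<rho>: "\<And>t. (\<gamma> k has_real_derivative \<rho> t) (at t)"
      and pq: "\<And>i. a < p i \<and> p i \<le> q i \<and> q i < a + 1" and out: "\<And>i t. t \<notin> {p i..q i} \<Longrightarrow> \<gamma> i t = 0"
    define \<phi> :: "real^'n \<Rightarrow> real" where "\<phi> x = (\<Prod>i\<in>UNIV. \<gamma> i (x $ i))" for x
    define \<psi> :: "real^'n \<Rightarrow> real" where "\<psi> x = \<rho> (x $ k) * (\<Prod>i\<in>UNIV - {k}. \<gamma> i (x $ i))" for x
    have "cbox (vec_lambda p) (vec_lambda q) \<subseteq> box (\<chi> i. a) (\<chi> i. a + 1)"
    proof
      fix x assume x: "x \<in> cbox (vec_lambda p) (vec_lambda q)"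
      have "a < x $ i \<and> x $ i < a + 1" for i
        using pq[of i] x[unfolded mem_box_cart, rule_format, of i] by auto
      then show "x \<in> box (\<chi> i. a) (\<chi> i. a + 1)" by (simp add: mem_box_cart)
    qed
    also have "\<dots> \<subseteq> ?\<Omega>"
      using ends by (intro interior_maximal open_box) (force simp: cube_def mem_box_cart)
    finally have test: "test_function ?\<Omega> \<phi>"
      unfolding \<phi>_def[abs_def] using sm out by (intro test_function_prod[of \<gamma> "vec_lambda p" "vec_lambda q"]) auto
    have d: "partial_deriv k \<phi> x = \<psi> x" for x
    proof -
      have "\<forall>i. \<exists>d. \<forall>t. (\<gamma> i has_real_derivative d t) (at t)"
        using sm unfolding smooth_def by (metis times_diff.simps(2))
      then obtain d where d: "\<And>i t. (\<gamma> i has_real_derivative d i t) (at t)" by metis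
      have "d k (x $ k) = \<rho> (x $ k)" using DERIV_unique[OF d \<rho>] .
      then show ?thesis
        using partial_deriv_prod(2)[of \<gamma> "\<lambda>i. d i (x $ i)" x k] d by (simp add: \<phi>_def[abs_def] \<psi>_def)
    qed
    have bc: "(\<lambda>x::real^'n. h (x $ i)) \<in> borel_measurable borel" if "h \<in> borel_measurable borel" for h :: "real \<Rightarrow> real" and i
      by (rule measurable_compose[OF _ that]) measurable
    have bs: "(\<lambda>x::real^'n. \<gamma> i (x $ i)) \<in> borel_measurable borel" for i
      by (intro bc borel_measurable_continuous_onI smooth_continuous sm)
    have \<rho>m: "\<rho> \<in> borel_measurable borel"
    proof -
      obtain \<rho>' where r: "\<And>t. (\<gamma> k has_real_derivative \<rho>' t) (at t)" "continuous_on UNIV \<rho>'"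
        using sm[of k] unfolding smooth_def by (metis times_diff.simps)
      then have "\<rho> = \<rho>'" using DERIV_unique[OF \<rho>] by blast
      then show ?thesis using r by (simp add: borel_measurable_continuous_onI)
    qed
    have \<phi>m: "\<phi> \<in> borel_measurable borel" unfolding \<phi>_def[abs_def] by (intro borel_measurable_prod bs)
    have \<psi>m: "\<psi> \<in> borel_measurable borel"
      unfolding \<psi>_def[abs_def] by (intro borel_measurable_times borel_measurable_prod bs bc \<rho>m)
    have "(LINT x:?\<Omega>|lebesgue. u x * partial_deriv k \<phi> x) = - (LINT x:?\<Omega>|lebesgue. g x $ k * \<phi> x)"
      using w test unfolding weak_gradient_def by blast
    then have "(LINT f|cubeM UNIV. F (vec_lambda f) * \<psi> (vec_lambda f)) = - (LINT f|cubeM UNIV. G (vec_lambda f) * \<phi> (vec_lambda f))"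
      unfolding d pairing_with_test[OF F \<psi>m uF] pairing_with_test[OF G \<phi>m gG] .
    then show "(LINT f|cubeM UNIV. F (vec_lambda f) * (\<rho> (f k) * (\<Prod>i\<in>UNIV-{k}. \<gamma> i (f i))))
      = - (LINT f|cubeM UNIV. G (vec_lambda f) * (\<Prod>i\<in>UNIV. \<gamma> i (f i)))"
      by (simp add: \<phi>_def \<psi>_def)
  qed
qed

lemma sobolev_section_bound:
  fixes u :: "real^'n::finite \<Rightarrow> real"
  assumes n: "n = CARD('n)" "n \<ge> 2" and u: "u \<in> sobolev_space (of_nat n) I"
    and A: "0 < A" "sobolev_norm (of_nat n) I u \<le> ennreal A"
  defines "C \<equiv> ((4 * exp 1 * real n) ^ n + ((8 * exp 1 * real n) ^ n + 6 * (16 * exp 1) ^ n * (2 * real n) ^ (n - 1))) * real n ^ n + 1"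
  shows "mixed_norm_k k (lorentz_zygmund_norm \<infinity> (of_nat n) (-1)) (Lq_norm \<infinity>) I u \<le> ennreal (C * A)"
proof -
  have n0: "n > 0" using n by simp
  define \<Omega> where "\<Omega> = (interior (cube I) :: (real^'n) set)"
  define g where "g = grad \<Omega> u"
  have um: "u \<in> borel_measurable (lebesgue_on (cube I))" and "\<exists>g. weak_gradient \<Omega> u g"
    using u by (auto simp: sobolev_space_def fun_space_def \<Omega>_def)
  from someI_ex[OF this(2)] have w: "weak_gradient \<Omega> u g" unfolding g_def grad_def .
  have A2: "Lq_norm (of_nat n) (lebesgue_on (cube I)) (\<lambda>x. ennreal \<bar>u x\<bar>) \<le> ennreal A"
    "Lq_norm (of_nat n) (lebesgue_on (cube I)) (\<lambda>x. ennreal (norm (g x))) \<le> ennreal A"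
  proof -
    have le: "x \<le> z \<and> y \<le> z" if "x + y \<le> z" for x y z :: ennreal
    proof -
      have 1: "x + 0 \<le> x + y" by (rule add_left_mono) simp
      have 2: "0 + y \<le> x + y" by (rule add_right_mono) simp
      show ?thesis using order_trans[OF 1 that] order_trans[OF 2 that] by simp
    qed
    note le' = le[OF A(2)[unfolded sobolev_norm_def]]
    show "Lq_norm (of_nat n) (lebesgue_on (cube I)) (\<lambda>x. ennreal \<bar>u x\<bar>) \<le> ennreal A"
      "Lq_norm (of_nat n) (lebesgue_on (cube I)) (\<lambda>x. ennreal (norm (g x))) \<le> ennreal A"
      unfolding g_def \<Omega>_def by (rule le'[THEN conjunct1], rule le'[THEN conjunct2])
  qed
  have uA: "(\<integral>\<^sup>+x. ennreal \<bar>u x\<bar> ^ n \<partial>lebesgue_on (cube I)) \<le> ennreal (A ^ n)"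
    and gA: "(\<integral>\<^sup>+x. ennreal (norm (g x)) ^ n \<partial>lebesgue_on (cube I)) \<le> ennreal (A ^ n)"
    using A2 A(1) unfolding Lq_norm_of_nat[OF n0] by (simp_all add: ennpowr_inverse_le_iff[OF n0])
  obtain F where F: "F \<in> borel_measurable borel" "AE x in lborel. x \<in> cube I \<longrightarrow> u x = F x"
    using borel_representative[OF cube_measurable um] .
  have gm: "(\<lambda>x. indicator \<Omega> x *\<^sub>R g x) \<in> borel_measurable lebesgue"
    using w by (intro locally_integrable_measurable) (auto simp: weak_gradient_def \<Omega>_def)
  have "\<forall>i. \<exists>G. G \<in> borel_measurable borel \<and> (AE x in lborel. x \<in> cube I \<longrightarrow> g x $ i = G x)"
  proof
    fix i
    have "(\<lambda>x. (indicator \<Omega> x *\<^sub>R g x) $ i) \<in> borel_measurable lebesgue"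
      by (rule measurable_compose[OF gm]) measurable
    then have "(\<lambda>x. (indicator \<Omega> x *\<^sub>R g x) $ i) \<in> borel_measurable (lebesgue_on (cube I))"
      by (rule measurable_restrict_space1)
    from borel_representative[OF cube_measurable this]
    obtain G where G: "G \<in> borel_measurable borel" "AE x in lborel. x \<in> cube I \<longrightarrow> (indicator \<Omega> x *\<^sub>R g x) $ i = G x" by blast
    from G(2) AE_interior_cube have "AE x in lborel. x \<in> cube I \<longrightarrow> g x $ i = G x"
      by eventually_elim (auto simp: \<Omega>_def)
    then show "\<exists>G. G \<in> borel_measurable borel \<and> (AE x in lborel. x \<in> cube I \<longrightarrow> g x $ i = G x)"
      using G by blast
  qed
  from choice[OF this] obtain G where G: "\<And>i. G i \<in> borel_measurable borel"
    "\<And>i. AE x in lborel. x \<in> cube I \<longrightarrow> g x $ i = G i x" by blast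
  define U where "U f = F (vec_lambda f)" for f
  define h where "h i f = G i (vec_lambda f)" for i f
  have U: "U \<in> borel_measurable (cubeM UNIV)"
    unfolding U_def by (rule measurable_compose[OF measurable_vec_lambda_cubeM F(1)])
  have h: "h i \<in> borel_measurable (cubeM UNIV)" for i
    unfolding h_def by (rule measurable_compose[OF measurable_vec_lambda_cubeM G(1)])
  have U_A: "(\<integral>\<^sup>+f. ennreal (\<bar>U f\<bar> ^ n) \<partial>cubeM UNIV) \<le> ennreal (A ^ n)"
  proof -
    have "(\<integral>\<^sup>+f. ennreal (\<bar>U f\<bar> ^ n) \<partial>cubeM UNIV) = (\<integral>\<^sup>+x. ennreal (\<bar>F x\<bar> ^ n) * indicator (cube I) x \<partial>lborel)"
      unfolding U_def using F by (intro nn_integral_cubeM) measurable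
    also have "\<dots> = (\<integral>\<^sup>+x. ennreal \<bar>u x\<bar> ^ n * indicator (cube I) x \<partial>lborel)"
      using F(2) by (intro nn_integral_cong_AE, eventually_elim) (auto simp: ennreal_power split: split_indicator)
    finally show ?thesis using uA by (simp add: nn_integral_lebesgue_cube)
  qed
  have h_A: "(\<integral>\<^sup>+f. ennreal ((\<Sum>i\<in>UNIV. \<bar>h i f\<bar>) ^ n) \<partial>cubeM UNIV) \<le> ennreal ((real n * A) ^ n)"
  proof -
    have "(\<integral>\<^sup>+f. ennreal ((\<Sum>i\<in>UNIV. \<bar>h i f\<bar>) ^ n) \<partial>cubeM UNIV)
      = (\<integral>\<^sup>+x. ennreal ((\<Sum>i\<in>UNIV. \<bar>G i x\<bar>) ^ n) * indicator (cube I) x \<partial>lborel)"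
      unfolding h_def using G by (intro nn_integral_cubeM) measurable
    also have "\<dots> \<le> (\<integral>\<^sup>+x. ennreal (real n ^ n) * (ennreal (norm (g x)) ^ n * indicator (cube I) x) \<partial>lborel)"
    proof (rule nn_integral_mono_AE)
      have "AE x in lborel. \<forall>i. x \<in> cube I \<longrightarrow> g x $ i = G i x"
        using G(2) by (intro AE_all_countable[THEN iffD2] allI)
      then show "AE x in lborel. ennreal ((\<Sum>i\<in>UNIV. \<bar>G i x\<bar>) ^ n) * indicator (cube I) x
          \<le> ennreal (real n ^ n) * (ennreal (norm (g x)) ^ n * indicator (cube I) x)"
      proof eventually_elim
        case (elim x)
        show ?case
        proof (cases "x \<in> cube I")
          case True
          have "(\<Sum>i\<in>UNIV. \<bar>G i x\<bar>) \<le> (\<Sum>i\<in>(UNIV::'n set). norm (g x))"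
            using elim True component_le_norm_cart[of "g x"] by (intro sum_mono) auto
          then have "(\<Sum>i\<in>UNIV. \<bar>G i x\<bar>) ^ n \<le> (real n * norm (g x)) ^ n"
            using n by (intro power_mono) (auto intro: sum_nonneg)
          then show ?thesis using True
            by (simp add: power_mult_distrib ennreal_power ennreal_leI flip: ennreal_mult)
        qed simp
      qed
    qed
    also have "\<dots> = ennreal (real n ^ n) * (\<integral>\<^sup>+x. ennreal (norm (g x)) ^ n \<partial>lebesgue_on (cube I))"
    proof -
      define N where "N x = norm (g x)" for x
      have Nm[measurable]: "N \<in> borel_measurable (lebesgue_on (cube I))"
        using u unfolding N_def by (simp add: sobolev_space_def fun_space_def g_def \<Omega>_def)
      have "(\<integral>\<^sup>+x. ennreal (real n ^ n) * (ennreal (N x) ^ n * indicator (cube I) x) \<partial>lborel)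
        = (\<integral>\<^sup>+x. ennreal (real n ^ n) * ennreal (N x) ^ n \<partial>lebesgue_on (cube I))"
        unfolding nn_integral_lebesgue_cube by (simp only: mult.assoc)
      also have "\<dots> = ennreal (real n ^ n) * (\<integral>\<^sup>+x. ennreal (N x) ^ n \<partial>lebesgue_on (cube I))"
        by (intro nn_integral_cmult) measurable
      finally show ?thesis unfolding N_def .
    qed
    also have "\<dots> \<le> ennreal (real n ^ n) * ennreal (A ^ n)" by (intro mult_left_mono gA) simp
    also have "\<dots> = ennreal ((real n * A) ^ n)" using A by (simp add: power_mult_distrib flip: ennreal_mult)
    finally show ?thesis .
  qed
  have U_A': "(\<integral>\<^sup>+f. ennreal (\<bar>U f\<bar> ^ n) \<partial>cubeM UNIV) \<le> ennreal ((real n * A) ^ n)"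
  proof -
    have "A ^ n \<le> (real n * A) ^ n" using A n by (intro power_mono) auto
    then show ?thesis using U_A by (meson ennreal_leI order_trans)
  qed
  have hi_int: "integrable (cubeM UNIV) (h i)" for i
  proof (rule integrable_of_power[OF prob_cubeM h _ n0])
    have "(\<integral>\<^sup>+f. ennreal (\<bar>h i f\<bar> ^ n) \<partial>cubeM UNIV) \<le> (\<integral>\<^sup>+f. ennreal ((\<Sum>i\<in>UNIV. \<bar>h i f\<bar>) ^ n) \<partial>cubeM UNIV)"
      by (intro nn_integral_mono ennreal_leI power_mono member_le_sum) auto
    then show "(\<integral>\<^sup>+f. ennreal (\<bar>h i f\<bar> ^ n) \<partial>cubeM UNIV) < \<infinity>"
      using h_A by (simp add: order_le_less_trans)
  qed
  have U_int: "integrable (cubeM UNIV) U"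
    by (rule integrable_of_power[OF prob_cubeM U _ n0]) (use U_A in \<open>simp add: order_le_less_trans\<close>)
  have ac: "primitive_along i U (h i)" for i
    using primitive_along_of_weak_gradient[OF w[unfolded \<Omega>_def] F G(1) G(2)] U_int hi_int
    by (simp add: U_def[abs_def] h_def[abs_def])
  \<comment> \<open>The sum of the absolute values of the \<open>n\<close> partial derivatives has norm at most \<open>n * A\<close>.\<close>
  define \<Lambda> where "\<Lambda> = 4 * exp 1 * real n * (real n * A)"
  have \<Lambda>0: "0 < \<Lambda>" using A n by (simp add: \<Lambda>_def)
  obtain X where X: "\<And>j. 1 \<le> X j"
    "\<And>j k. emeasure (cubeM (UNIV - {k})) (wide k U (\<Lambda> * 2 ^ j)) \<le> ennreal (exp (1 - X j))"
    "(\<Sum>j. ennreal ((\<Lambda> * 2 ^ Suc j) ^ n / X j ^ (n - 1)))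
       \<le> ennreal (((8 * exp 1 * real n) ^ n + 6 * (16 * exp 1) ^ n * (2 * real n) ^ (n - 1)) * (real n * A) ^ n)"
    using wide_decay[OF U h n ac _ U_A' h_A] A n unfolding \<Lambda>_def by auto
  let ?K = "(8 * exp 1 * real n) ^ n + 6 * (16 * exp 1) ^ n * (2 * real n) ^ (n - 1)"
  have K0: "0 \<le> ?K" by simp
  have "(\<integral>\<^sup>+t. ennreal (1 / (t * (1 - ln t) ^ n)) * rearrangement (face_measure k I) (section_norm k (Lq_norm \<infinity>) I u) t ^ n
      * indicator {0<..<1} t \<partial>lborel)
    \<le> ennreal (\<Lambda> ^ n) + (\<Sum>j. ennreal ((\<Lambda> * 2 ^ Suc j) ^ n / X j ^ (n - 1)))"
  proof (rule lorentz_zygmund_dyadic_bound[OF n(2) \<Lambda>0 X(1)])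
    fix j
    show "distribution_fun (face_measure k I) (section_norm k (Lq_norm \<infinity>) I u) (ennreal (\<Lambda> * 2 ^ j)) \<le> ennreal (exp (1 - X j))"
      using distribution_section_norm[OF F, of "\<Lambda> * 2 ^ j" k] X(2)[of k j] \<Lambda>0 by (simp add: U_def[abs_def])
  qed
  also have "\<dots> \<le> ennreal (\<Lambda> ^ n) + ennreal (?K * (real n * A) ^ n)"
    by (intro add_left_mono X(3))
  also have "\<dots> = ennreal (\<Lambda> ^ n + ?K * (real n * A) ^ n)"
    using \<Lambda>0 K0 A by (intro ennreal_plus[symmetric]) auto
  also have "\<Lambda> ^ n + ?K * (real n * A) ^ n = (C - 1) * A ^ n"
  proof -
    have gen: "x * (y * z) + K * (y * z) = ((x + K) * y + 1 - 1) * z" for x y z K :: real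
      by (simp add: algebra_simps)
    have 1: "\<Lambda> ^ n = (4 * exp 1 * real n) ^ n * (real n * A) ^ n" unfolding \<Lambda>_def by (rule power_mult_distrib)
    show ?thesis unfolding 1 power_mult_distrib[of "real n" A n] C_def by (rule gen)
  qed
  also have "ennreal ((C - 1) * A ^ n) \<le> ennreal ((C * A) ^ n)"
  proof (rule ennreal_leI)
    \<comment> \<open>The bound for the \<open>n\<close>th power has the constant \<open>C - 1\<close>; this avoids an \<open>n\<close>th root.\<close>
    have C1: "1 \<le> C" unfolding C_def using K0 by simp
    have "C - 1 \<le> C" by simp
    also have "\<dots> \<le> C ^ n" using C1 n0 by (intro self_le_power) auto
    finally show "(C - 1) * A ^ n \<le> (C * A) ^ n"
      unfolding power_mult_distrib using A by (intro mult_right_mono) auto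
  qed
  finally show ?thesis
    unfolding mixed_norm_k_def lorentz_zygmund_norm_eq[OF n0]
    using A(1) K0 by (subst ennpowr_inverse_le_iff[OF n0]) (auto simp: C_def)
qed

text \<open>The bound for the section norms holds for every \<open>A > 0\<close> above the Sobolev norm; the limit covers
  functions of norm \<open>0\<close>, for which there is no admissible \<open>A\<close> equal to the norm.\<close>

lemma sobolev_into_mixed:
  fixes n :: nat
  assumes n: "n = CARD('n::finite)" "n \<ge> 2"
  shows "continuous_embedding
           (sobolev_space (of_nat n) I :: (real^'n \<Rightarrow> real) set)
           (sobolev_norm (of_nat n) I)
           (mixed_space (lorentz_zygmund_norm \<infinity> (of_nat n) (-1)) (Lq_norm \<infinity>) I)
           (mixed_norm (lorentz_zygmund_norm \<infinity> (of_nat n) (-1)) (Lq_norm \<infinity>) I)"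
proof -
  let ?X = "lorentz_zygmund_norm \<infinity> (of_nat n) (-1)"
  define C where "C = ((4 * exp 1 * real n) ^ n + ((8 * exp 1 * real n) ^ n + 6 * (16 * exp 1) ^ n * (2 * real n) ^ (n - 1))) * real n ^ n + (1::real)"
  have C0: "0 < C" unfolding C_def by (intro add_nonneg_pos) auto
  have bound: "mixed_norm_k k ?X (Lq_norm \<infinity>) I u \<le> ennreal (C * A)"
    if "u \<in> sobolev_space (of_nat n) I" "0 < A" "sobolev_norm (of_nat n) I u \<le> ennreal A" for u :: "real^'n \<Rightarrow> real" and A k
    unfolding C_def by (rule sobolev_section_bound[OF n that])
  have fin: "sobolev_norm (of_nat n) I u < \<infinity>" if "u \<in> sobolev_space (of_nat n) I" for u :: "real^'n \<Rightarrow> real"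
    using that unfolding sobolev_space_def sobolev_norm_def fun_space_def by simp
  show ?thesis unfolding continuous_embedding_def
  proof (intro conjI exI[of _ "real n * C"] ballI subsetI)
    show "0 \<le> real n * C" using C0 by simp
    fix u :: "real^'n \<Rightarrow> real" assume u: "u \<in> sobolev_space (of_nat n) I"
    obtain r where r: "0 \<le> r" "sobolev_norm (of_nat n) I u = ennreal r"
      using fin[OF u] by (cases "sobolev_norm (of_nat n) I u") auto
    have "mixed_norm_k k ?X (Lq_norm \<infinity>) I u < \<infinity>" for k
      using bound[OF u, of "r + 1" k] r by (simp add: ennreal_leI order_le_less_trans)
    moreover have "u \<in> borel_measurable (lebesgue_on (cube I))"
      using u by (auto simp: sobolev_space_def fun_space_def)
    ultimately show "u \<in> mixed_space ?X (Lq_norm \<infinity>) I"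
      unfolding mixed_space_def mixed_space_k_def by blast
  next
    fix u :: "real^'n \<Rightarrow> real" assume u: "u \<in> sobolev_space (of_nat n) I"
    obtain r where r: "0 \<le> r" "sobolev_norm (of_nat n) I u = ennreal r"
      using fin[OF u] by (cases "sobolev_norm (of_nat n) I u") auto
    have "mixed_norm ?X (Lq_norm \<infinity>) I u \<le> ennreal (real n * C * r) + ennreal e" if e: "0 < e" for e
    proof -
      define A where "A = r + e / (real n * C)"
      have A: "0 < A" "r \<le> A" using r e C0 n by (auto simp: A_def add_nonneg_pos)
      have "mixed_norm ?X (Lq_norm \<infinity>) I u \<le> (\<Sum>k\<in>(UNIV::'n set). ennreal (C * A))"
        unfolding mixed_norm_def using A r by (intro sum_mono bound[OF u]) (auto intro: ennreal_leI)
      also have "\<dots> = ennreal (real n * (C * A))"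
        using n C0 A by (simp add: ennreal_of_nat_eq_real_of_nat flip: ennreal_mult)
      also have "real n * (C * A) = real n * C * r + e"
        using C0 n by (simp add: A_def field_simps)
      also have "ennreal \<dots> = ennreal (real n * C * r) + ennreal e" using r C0 e by simp
      finally show ?thesis .
    qed
    then have "mixed_norm ?X (Lq_norm \<infinity>) I u \<le> ennreal (real n * C * r)" by (rule ennreal_le_epsilon)
    moreover have "ennreal (real n * C * r) = ennreal (real n * C) * ennreal r"
      using r(1) C0 by (intro ennreal_mult) auto
    ultimately show "mixed_norm ?X (Lq_norm \<infinity>) I u \<le> ennreal (real n * C) * sobolev_norm (of_nat n) I u"
      unfolding r(2) by (rule ord_le_eq_trans)
  qed
qed

section \<open>Strictness of the second embedding\<close>

text \<open>A function of the \<open>k\<close>th coordinate alone whose level sets shrink like \<open>exp (- \<theta>^4)\<close>, so that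
  \<open>f\<^sup>*(t) = (ln (1/t))\<^bsup>1/4\<^esup>\<close>. This growth is slow enough for \<open>L\<^bsup>\<infinity>,n;-1\<^esup>\<close> because
  \<open>n \<ge> 2\<close>, but on every line of direction \<open>k\<close> the function is unbounded.\<close>

lemma mixed_ne_lorentz_zygmund:
  fixes n :: nat
  assumes n: "n \<ge> 2"
  shows "(mixed_space (lorentz_zygmund_norm \<infinity> (of_nat n) (-1)) (Lq_norm \<infinity>) I :: (real^'n::finite \<Rightarrow> real) set)
    \<noteq> fun_space (lorentz_zygmund_norm \<infinity> (of_nat n) (-1)) (lebesgue_on (cube I))"
proof -
  let ?X = "lorentz_zygmund_norm \<infinity> (of_nat n) (-1)"
  obtain a where ends: "{a<..<a+1} \<subseteq> I" "I \<subseteq> {a..a+1}" using obtain_left_end by blast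
  obtain k :: 'n where True by blast
  interpret L: prob_space L by (rule prob_L)
  interpret Pk: prob_space "cubeM (UNIV - {k})" by (rule prob_cubeM)
  have n0: "n > 0" using n by simp
  define g where "g s = sqrt (sqrt \<bar>ln (s - a)\<bar>)" for s
  define f :: "real^'n \<Rightarrow> real" where "f x = g (x $ k)" for x
  have gm[measurable]: "g \<in> borel_measurable borel" unfolding g_def by measurable
  have g0: "0 \<le> g s" for s by (simp add: g_def)
  have f: "f \<in> borel_measurable borel" unfolding f_def by (rule measurable_compose[OF _ gm]) measurable
  have ff: "AE x in lborel. x \<in> cube I \<longrightarrow> f x = f x" by simp
  have fm: "f \<in> borel_measurable (lebesgue_on (cube I))"
    by (rule measurable_lebesgue_on_AE_eq[OF cube_measurable f ff])
  have level: "\<theta> < g s \<longleftrightarrow> a < s \<and> s < a + exp (- (\<theta> ^ 4))" if s: "s \<in> I" and \<theta>: "0 \<le> \<theta>" for s \<theta>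
  proof -
    have "\<theta> < g s \<longleftrightarrow> \<theta>\<^sup>2 < sqrt \<bar>ln (s - a)\<bar>"
      unfolding g_def using \<theta> by (metis abs_of_nonneg real_less_rsqrt real_sqrt_abs real_sqrt_less_iff)
    also have "\<dots> \<longleftrightarrow> (\<theta>\<^sup>2)\<^sup>2 < \<bar>ln (s - a)\<bar>"
      using \<theta> by (metis abs_of_nonneg real_sqrt_abs real_sqrt_less_iff zero_le_power2)
    also have "(\<theta>\<^sup>2)\<^sup>2 = \<theta> ^ 4" by simp
    also have "\<theta> ^ 4 < \<bar>ln (s - a)\<bar> \<longleftrightarrow> a < s \<and> s < a + exp (- (\<theta> ^ 4))"
    proof (cases "a < s")
      case True
      then have r: "0 < s - a" "s - a \<le> 1" using s ends by auto
      then have "\<bar>ln (s - a)\<bar> = - ln (s - a)" by simp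
      then have "\<theta> ^ 4 < \<bar>ln (s - a)\<bar> \<longleftrightarrow> ln (s - a) < - (\<theta> ^ 4)" by linarith
      also have "\<dots> \<longleftrightarrow> s - a < exp (- (\<theta> ^ 4))" using r by (metis exp_less_cancel_iff exp_ln)
      finally show ?thesis using True by auto
    next
      case False
      then have "s = a" using s ends by force
      then show ?thesis using \<theta> by simp
    qed
    finally show ?thesis .
  qed
  have sub: "{a<..<a + exp (- (\<theta> ^ 4))} \<subseteq> I" if "0 \<le> \<theta>" for \<theta>
  proof -
    have "exp (- (\<theta> ^ 4)) \<le> 1" using that by simp
    then have "x \<in> {a<..<a + 1}" if "x \<in> {a<..<a + exp (- (\<theta> ^ 4))}" for x
      using that unfolding greaterThanLessThan_iff by linarith
    then have "{a<..<a + exp (- (\<theta> ^ 4))} \<subseteq> {a<..<a + 1}" by (rule subsetI)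
    then show ?thesis using ends(1) by (rule subset_trans)
  qed
  have int: "(\<integral>\<^sup>+s. indicator {\<theta><..} \<bar>g s\<bar> \<partial>L) = ennreal (exp (- (\<theta> ^ 4)))" if \<theta>: "0 \<le> \<theta>" for \<theta>
  proof -
    have s: "{a<..<a + exp (- (\<theta> ^ 4))} \<in> sets L"
      using sub[OF \<theta>] by (auto simp: sets_restrict_space)
    have "(\<integral>\<^sup>+s. indicator {\<theta><..} \<bar>g s\<bar> \<partial>L) = (\<integral>\<^sup>+s. indicator {a<..<a + exp (- (\<theta> ^ 4))} s \<partial>L)"
      using level[OF _ \<theta>] g0 by (intro nn_integral_cong) (auto split: split_indicator)
    also have "\<dots> = emeasure L {a<..<a + exp (- (\<theta> ^ 4))}" using s by simp
    also have "\<dots> = ennreal (exp (- (\<theta> ^ 4)))" using sub[OF \<theta>] by (simp add: emeasure_restrict_space)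
    finally show ?thesis .
  qed
  define U :: "('n \<Rightarrow> real) \<Rightarrow> real" where "U x = f (vec_lambda x)" for x
  have Uk: "U (y(k := s)) = g s" for y s by (simp add: U_def f_def)
  have U[measurable]: "U \<in> borel_measurable (cubeM UNIV)"
    unfolding U_def by (rule measurable_compose[OF measurable_vec_lambda_cubeM f])
  have df: "distribution_fun (lebesgue_on (cube I)) (\<lambda>x. ennreal \<bar>f x\<bar>) (ennreal \<theta>) = ennreal (exp (- (\<theta> ^ 4)))"
    if \<theta>: "0 \<le> \<theta>" for \<theta>
  proof -
    have "distribution_fun (lebesgue_on (cube I)) (\<lambda>x. ennreal \<bar>f x\<bar>) (ennreal \<theta>)
        = (\<integral>\<^sup>+x. indicator {\<theta><..} \<bar>U x\<bar> \<partial>cubeM UNIV)"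
      unfolding U_def by (rule distribution_cube[OF f ff \<theta>])
    also have "\<dots> = (\<integral>\<^sup>+y. (\<integral>\<^sup>+s. indicator {\<theta><..} \<bar>U (y(k := s))\<bar> \<partial>L) \<partial>cubeM (UNIV - {k}))"
      by (rule nn_integral_split) measurable
    also have "\<dots> = ennreal (exp (- (\<theta> ^ 4)))" unfolding Uk int[OF \<theta>] by (simp add: Pk.emeasure_space_1)
    finally show ?thesis .
  qed
  have "f \<in> fun_space ?X (lebesgue_on (cube I))"
  proof -
    define X :: "nat \<Rightarrow> real" where "X j = 1 + (2 ^ j) ^ 4" for j
    have "(\<integral>\<^sup>+t. ennreal (1 / (t * (1 - ln t) ^ n)) * rearrangement (lebesgue_on (cube I)) (\<lambda>x. ennreal \<bar>f x\<bar>) t ^ n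
        * indicator {0<..<1} t \<partial>lborel)
      \<le> ennreal (1 ^ n) + (\<Sum>j. ennreal ((1 * 2 ^ Suc j) ^ n / X j ^ (n - 1)))"
      by (rule lorentz_zygmund_dyadic_bound) (use n df in \<open>auto simp: X_def\<close>)
    also have "(\<Sum>j. ennreal ((1 * 2 ^ Suc j) ^ n / X j ^ (n - 1))) \<le> (\<Sum>j. ennreal (2 ^ n * (1 / 4) ^ j))"
    proof (intro suminf_le summableI ennreal_leI)
      fix j
      define d :: real where "d = 2 ^ j"
      have d: "1 \<le> d" by (simp add: d_def)
      have "d ^ (n + 2) \<le> d ^ (4 * (n - 1))" using d n by (intro power_increasing) auto
      also have "\<dots> = (d ^ 4) ^ (n - 1)" by (simp add: power_mult)
      also have "\<dots> \<le> X j ^ (n - 1)" unfolding X_def d_def by (intro power_mono) auto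
      finally have "(2 * d) ^ n / X j ^ (n - 1) \<le> (2 * d) ^ n / d ^ (n + 2)"
        using d by (intro divide_left_mono) (auto simp: X_def add_pos_nonneg)
      also have "\<dots> = 2 ^ n * (1 / d\<^sup>2)" using d by (simp add: power_mult_distrib power_add power2_eq_square)
      also have "1 / d\<^sup>2 = (1 / 4) ^ j"
        by (simp add: d_def power2_eq_square power_one_over flip: power_mult_distrib)
      finally show "(1 * 2 ^ Suc j) ^ n / X j ^ (n - 1) \<le> 2 ^ n * (1 / 4) ^ j" by (simp add: d_def)
    qed
    also have "(\<Sum>j. ennreal (2 ^ n * (1 / 4) ^ j)) < \<infinity>"
      by (subst suminf_ennreal2) (auto intro!: summable_mult summable_geometric)
    finally have "(\<integral>\<^sup>+t. ennreal (1 / (t * (1 - ln t) ^ n)) * rearrangement (lebesgue_on (cube I)) (\<lambda>x. ennreal \<bar>f x\<bar>) t ^ n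
        * indicator {0<..<1} t \<partial>lborel) < \<infinity>"
      by (simp add: ennreal_add_less_top add_left_mono order_le_less_trans)
    then show ?thesis using fm unfolding fun_space_def lorentz_zygmund_norm_eq[OF n0] by (simp add: ennpowr_less_top_iff[simplified])
  qed
  moreover have "f \<notin> mixed_space ?X (Lq_norm \<infinity>) I"
  proof
    assume "f \<in> mixed_space ?X (Lq_norm \<infinity>) I"
    then have fin: "?X (face_measure k I) (section_norm k (Lq_norm \<infinity>) I f) < \<infinity>"
      unfolding mixed_space_def mixed_space_k_def mixed_norm_k_def by blast
    have d1: "distribution_fun (face_measure k I) (section_norm k (Lq_norm \<infinity>) I f) (ennreal \<theta>) = 1" if \<theta>: "0 \<le> \<theta>" for \<theta>
    proof -
      have "wide k U \<theta> = space (cubeM (UNIV - {k}))" unfolding wide_def Uk int[OF \<theta>] by simp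
      then show ?thesis using distribution_section_norm[OF f ff \<theta>, of k] Pk.emeasure_space_1
        by (simp add: U_def[abs_def])
    qed
    have r: "rearrangement (face_measure k I) (section_norm k (Lq_norm \<infinity>) I f) t = \<infinity>" if t: "t < 1" for t
    proof -
      have "s = \<infinity>" if "distribution_fun (face_measure k I) (section_norm k (Lq_norm \<infinity>) I f) s \<le> ennreal t" for s
      proof (cases s)
        case (real \<theta>)
        then show ?thesis using that d1[of \<theta>] t by (simp add: ennreal_ge_1)
      qed simp
      then show ?thesis unfolding rearrangement_def infinity_ennreal_def by (intro Inf_eqI) (auto simp: top_unique)
    qed
    have "(\<integral>\<^sup>+t. ennreal (1 / (t * (1 - ln t) ^ n)) * rearrangement (face_measure k I) (section_norm k (Lq_norm \<infinity>) I f) t ^ n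
        * indicator {0<..<1} t \<partial>lborel) = (\<integral>\<^sup>+t. \<infinity> * indicator {0<..<1::real} t \<partial>lborel)"
    proof (rule nn_integral_cong)
      fix t :: real
      show "ennreal (1 / (t * (1 - ln t) ^ n)) * rearrangement (face_measure k I) (section_norm k (Lq_norm \<infinity>) I f) t ^ n
        * indicator {0<..<1} t = \<infinity> * indicator {0<..<1} t"
      proof (cases "t \<in> {0<..<1}")
        case True
        then have "0 < 1 - ln t" using ln_less_zero[of t] unfolding greaterThanLessThan_iff by linarith
        then have "0 < 1 / (t * (1 - ln t) ^ n)" using True by simp
        then have "ennreal (1 / (t * (1 - ln t) ^ n)) \<noteq> 0" unfolding ennreal_eq_0_iff not_le .
        moreover have "rearrangement (face_measure k I) (section_norm k (Lq_norm \<infinity>) I f) t ^ n = \<infinity>"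
          using r[of t] True n0 by simp
        ultimately have "ennreal (1 / (t * (1 - ln t) ^ n)) * rearrangement (face_measure k I) (section_norm k (Lq_norm \<infinity>) I f) t ^ n = \<infinity>"
          by (simp only: infinity_ennreal_def ennreal_mult_top if_False)
        then show ?thesis using True by (simp only: indicator_simps mult_1_right)
      qed simp
    qed
    also have "\<dots> = \<infinity>" by (simp add: nn_integral_cmult)
    finally show False using fin unfolding lorentz_zygmund_norm_eq[OF n0] by (simp add: ennpowr_def)
  qed
  ultimately show ?thesis by blast
qed

end

section \<open>The embeddings\<close>

theorem corollary5p5:
  fixes I :: "real set"
  assumes "CARD('n::finite) \<ge> 2"
    and "is_interval I"
    and "emeasure lborel I = 1"
  defines "n \<equiv> of_nat CARD('n) :: ennreal"
  defines "Q \<equiv> cube I :: (real^'n) set"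
  shows "continuous_embedding
           (sobolev_space n I :: (real^'n \<Rightarrow> real) set)
           (sobolev_norm n I)
           (mixed_space (lorentz_zygmund_norm \<infinity> n (-1)) (Lq_norm \<infinity>) I)
           (mixed_norm (lorentz_zygmund_norm \<infinity> n (-1)) (Lq_norm \<infinity>) I)
       \<and> continuous_embedding
           (mixed_space (lorentz_zygmund_norm \<infinity> n (-1)) (Lq_norm \<infinity>) I :: (real^'n \<Rightarrow> real) set)
           (mixed_norm (lorentz_zygmund_norm \<infinity> n (-1)) (Lq_norm \<infinity>) I)
           (fun_space (lorentz_zygmund_norm \<infinity> n (-1)) (lebesgue_on Q))
           (\<lambda>f. lorentz_zygmund_norm \<infinity> n (-1) (lebesgue_on Q) (\<lambda>x. ennreal \<bar>f x\<bar>))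
       \<and> (mixed_space (lorentz_zygmund_norm \<infinity> n (-1)) (Lq_norm \<infinity>) I :: (real^'n \<Rightarrow> real) set)
           \<noteq> fun_space (lorentz_zygmund_norm \<infinity> n (-1)) (lebesgue_on Q)"
proof -
  interpret unit_interval I using assms(2,3) by unfold_locales
  have n: "CARD('n) > 0" "CARD('n) \<ge> 2" using assms(1) by auto
  show ?thesis
    unfolding n_def Q_def
    by (intro conjI sobolev_into_mixed[OF refl n(2)] mixed_into_lorentz_zygmund[OF n(1)]
      mixed_ne_lorentz_zygmund[OF n(2)])
qed

end
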